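(* Let $n\ge2$, let $A$ be a proper non-empty subset of $\{1,\dots,n\}$ and $B=\{1,\dots,n\}\setminus A$. For each $i=1,\dots,n$ let $\Phi_i=\{\varphi_{i,k}\}_{k=-\infty}^{\infty}$ be a sequence of Blaschke products with no common non-constant inner factor (that is, for each $i$ no non-constant inner function divides $\varphi_{i,k}$ for every $k\in\mathbb{Z}$). Suppose $\Phi_i$ is increasing for all $i\in A$ and decreasing for all $i\in B$. Let $$\mathcal{Q}_{\bm{\Phi}}=\bigvee_{k=-\infty}^{\infty}\mathcal{Q}_{\varphi_{1,k}}\otimes\cdots\otimes\mathcal{Q}_{\varphi_{n,k}}\subseteq H^2(\mathbb{D}^n).$$ Then $$\operatorname{co-rank}\mathcal{Q}_{\bm{\Phi}}=\sup_{(\xi_1,\dots,\xi_n)\in\Lambda}\#\tilde{Z}(\xi_1,\dots,\xi_n).$$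
   Context: $\mathbb{N}$ includes $0$. $H^2(\mathbb{D}^n)$ is the Hardy space over the open unit polydisc, identified with the $n$-fold Hilbert space tensor product $H^2(\mathbb{D})\otimes\cdots\otimes H^2(\mathbb{D})$; $M_{z_i}$ is multiplication by $z_i$. $\bigvee$ denotes closed linear span. A quotient module $\mathcal{Q}$ of $H^2(\mathbb{D}^n)$ is a closed subspace whose orthogonal complement is invariant under all $M_{z_i}$; thus $\mathcal{Q}$ is invariant under all $M_{z_i}^*$. For a commuting $n$-tuple $T=(T_1,\dots,T_n)$ of bounded operators on a separable Hilbert space $\mathcal{H}$ and $S\subseteq\mathcal{H}$, let $[S]_T=\bigvee\{p(T_1,\dots,T_n)h: p\in\mathbb{C}[z_1,\dots,z_n],\,h\in S\}$ (with $[\emptyset]_T=\{0\}$), and $\operatorname{rank}T=\inf\{\#S: S\subseteq\mathcal{H},\,[S]_T=\mathcal{H}\}\in\mathbb{N}\cup\{\infty\}$. For a quotient module, $\operatorname{co-rank}\mathcal{Q}=\operatorname{rank}(M_{z_1}^*|_{\mathcal{Q}},\dots,M_{z_n}^*|_{\mathcal{Q}})$. For an inner function $\varphi$ on $\mathbb{D}$, $\mathcal{Q}_\varphi=H^2(\mathbb{D})\ominus\varphi H^2(\mathbb{D})$. For $\alpha\in\mathbb{D}$, $b_\alpha(z)=\frac{z-\alpha}{1-\bar\alpha z}$. A Blaschke product is an inner function $\varphi=\prod_m b_{\alpha_m}^{l_m}$ (finite or countable product, with the factors multiplied by unimodular constants as needed for convergence), with distinct $\alpha_m\in\mathbb{D}$,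 integers $l_m\ge1$, and $\sum_m l_m(1-|\alpha_m|)<\infty$. For such $\varphi$ put $\mathcal{I}_\varphi=\{b_{\alpha_m}^{l_m}\}_m$, and for $\xi=b_{\alpha}^{l}$ with $l\ge1$ put $P(\xi)=b_\alpha$. Divisibility $|$ is divisibility among inner functions. $\operatorname{ord}(\varphi,b_\alpha)$ is the order of the zero of $\varphi$ at $\alpha$. A sequence $\{\varphi_{i,k}\}_k$ is increasing if $\varphi_{i,k}|\varphi_{i,k+1}$ for all $k$, and decreasing if $\varphi_{i,k+1}|\varphi_{i,k}$ for all $k$. Put $\Lambda_k=\mathcal{I}_{\varphi_{1,k}}\times\cdots\times\mathcal{I}_{\varphi_{n,k}}$ for $k\in\mathbb{Z}$ and $\Lambda=\bigcup_{k\in\mathbb{Z}}\Lambda_k$. For $(\xi_1,\dots,\xi_n)\in\Lambda$ put $l_{i,k}=\operatorname{ord}(\varphi_{i,k},P(\xi_i))$, $Z(\xi_1,\dots,\xi_n)=\{k\in\mathbb{Z}: P(\xi_i)|\varphi_{i,k}\text{ for all }i=1,\dots,n\}$, and $$\mathcal{Q}(\xi_1,\dots,\xi_n)=\bigvee_{k\in Z(\xi_1,\dots,\xi_n)}\mathcal{Q}_{P(\xi_1)^{l_{1,k}}}\otimes\cdots\otimes\mathcal{Q}_{P(\xi_n)^{l_{n,k}}}.$$ $\tilde{Z}(\xi_1,\dots,\xi_n)$ denotes a subset of $Z(\xi_1,\dots,\xi_n)$ of minimal cardinality such that $\mathcal{Q}(\xi_1,\dots,\xi_n)=\bigvee_{k\in\tilde{Z}(\xi_1,\dots,\xi_n)}\mathcal{Q}_{P(\xi_1)^{l_{1,k}}}\otimes\cdots\otimes\mathcal{Q}_{P(\xi_n)^{l_{n,k}}}$.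 Suprema are taken in $\mathbb{N}\cup\{\infty\}$. *)

theory Defs
  imports
    "HOL-Complex_Analysis.Complex_Analysis"
    "HOL-Library.Extended_Nat"
    "HOL-Library.Poly_Mapping"
begin

section \<open>The Hardy space over the polydisc\<close>

definition polydisc :: "(complex^'n) set" where
  "polydisc = {z. \<forall>i. norm (z $ i) < 1}"

definition monomial :: "('n::finite \<Rightarrow> nat) \<Rightarrow> complex^'n \<Rightarrow> complex" where
  "monomial k z = (\<Prod>i\<in>UNIV. (z $ i) ^ k i)"

definition taylor :: "(complex^'n::finite \<Rightarrow> complex) \<Rightarrow> (('n \<Rightarrow> nat) \<Rightarrow> complex) \<Rightarrow> bool" where
  "taylor f a \<longleftrightarrow>
     (\<lambda>k. (norm (a k))\<^sup>2) summable_on UNIV \<and>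
     (\<forall>z\<in>polydisc. ((\<lambda>k. a k * monomial k z) has_sum f z) UNIV)"

text \<open>
  The space \<open>H\<^sup>2\<close> of the \<open>n\<close>-dimensional polydisc, where \<open>n\<close> is the cardinality of the index
  type: the functions on the polydisc with a power series expansion whose coefficients are square
  summable.  Elements are total functions, so they are normalised to \<open>0\<close> outside the polydisc.
\<close>

typedef 'n hardy = "{f :: complex^'n::finite \<Rightarrow> complex.
    (\<exists>a. taylor f a) \<and> (\<forall>z. z \<notin> polydisc \<longrightarrow> f z = 0)}"
  morphisms hardy_fun Abs_hardy
proof
  show "(\<lambda>_. 0) \<in> {f :: complex^'n \<Rightarrow> complex. (\<exists>a. taylor f a) \<and> (\<forall>z. z \<notin> polydisc \<longrightarrow> f z = 0)}"
    by (auto simp: taylor_def intro!: exI[of _ "\<lambda>_. 0"])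
qed

setup_lifting type_definition_hardy

definition hardy_coeff :: "'n::finite hardy \<Rightarrow> ('n \<Rightarrow> nat) \<Rightarrow> complex" where
  "hardy_coeff f = (THE a. taylor (hardy_fun f) a)"

text \<open>\<open>H\<^sup>2\<close> of the unit disc is the case of a one-element index type.\<close>

type_synonym hardy_disc = "1 hardy"


subsection \<open>Uniqueness of the coefficients\<close>

lemma digits_unique:
  fixes a b :: "nat \<Rightarrow> nat"
  assumes "(\<Sum>j<m. a j * B ^ j) = (\<Sum>j<m. b j * B ^ j)"
    and "\<And>j. j < m \<Longrightarrow> a j < B" "\<And>j. j < m \<Longrightarrow> b j < B" and "j < m"
  shows "a j = b j"
  using assms
proof (induction m arbitrary: a b j)
  case 0
  then show ?case by simp
next
  case (Suc m)
  have shift: "(\<Sum>j<Suc m. c j * B ^ j) = c 0 + B * (\<Sum>j<m. c (Suc j) * B ^ j)" for c :: "nat \<Rightarrow> nat"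
    by (subst sum.lessThan_Suc_shift) (simp add: sum_distrib_left mult_ac)
  have eq: "a 0 + B * (\<Sum>j<m. a (Suc j) * B ^ j) = b 0 + B * (\<Sum>j<m. b (Suc j) * B ^ j)"
    using Suc.prems(1) unfolding shift .
  have lt: "a 0 < B" "b 0 < B" using Suc.prems(2,3) by auto
  have "(a 0 + B * (\<Sum>j<m. a (Suc j) * B ^ j)) mod B = (b 0 + B * (\<Sum>j<m. b (Suc j) * B ^ j)) mod B"
    using eq by simp
  then have 0: "a 0 = b 0" using lt by simp
  with eq lt have "(\<Sum>j<m. a (Suc j) * B ^ j) = (\<Sum>j<m. b (Suc j) * B ^ j)" by simp
  from Suc.IH[OF this] Suc.prems(2,3,4) 0 show ?case
    by (cases j) auto
qed

lemma finite_degree: "finite {k :: 'n::finite \<Rightarrow> nat. (\<Sum>i\<in>UNIV. k i) = d}"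
proof (rule finite_subset)
  show "{k :: 'n \<Rightarrow> nat. (\<Sum>i\<in>UNIV. k i) = d} \<subseteq> (UNIV \<rightarrow>\<^sub>E {..d})"
    by (auto simp: PiE_def intro: member_le_sum)
  show "finite (UNIV \<rightarrow>\<^sub>E {..d} :: ('n \<Rightarrow> nat) set)"
    by (intro finite_PiE) auto
qed

lemma power_series_zero_imp_coeff_zero:
  fixes a :: "nat \<Rightarrow> complex"
  assumes "\<And>t. norm t < 1 \<Longrightarrow> (\<lambda>n. a n * t ^ n) sums 0"
  shows "a n = 0"
proof (cases "n = 0")
  case True
  with assms[of 0] show ?thesis by simp
next
  case False
  show ?thesis
  proof (rule ccontr)
    assume nz: "a n \<noteq> 0"
    obtain s where "0 < s" "\<And>z::complex. z \<in> cball 0 s - {0} \<Longrightarrow> (0::complex) \<noteq> 0"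
      using powser_0_nonzero[of 1 0 a "\<lambda>_. 0" n] assms nz False by auto
    moreover from \<open>0 < s\<close> have "complex_of_real s \<in> cball 0 s - {0}" by simp
    ultimately show False by blast
  qed
qed

lemma homogeneous_zero_imp_coeff_zero:
  fixes c :: "('n::finite \<Rightarrow> nat) \<Rightarrow> complex"
  assumes zero: "\<And>w. w \<in> polydisc \<Longrightarrow> (\<Sum>k | (\<Sum>i\<in>UNIV. k i) = d. c k * monomial k w) = 0"
    and deg: "(\<Sum>i\<in>UNIV. k0 i) = d"
  shows "c k0 = 0"
proof -
  define K where "K = {k :: 'n \<Rightarrow> nat. (\<Sum>i\<in>UNIV. k i) = d}"
  have finK: "finite K" unfolding K_def by (rule finite_degree)
  obtain e where e: "bij_betw e (UNIV :: 'n set) {..<CARD('n)}"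
    using ex_bij_betw_finite_nat[of "UNIV :: 'n set"] by (auto simp: atLeast0LessThan)
  define B where "B = Suc d"
  define w where "w k = (\<Sum>i\<in>UNIV. k i * B ^ e i)" for k :: "'n \<Rightarrow> nat"
  define e' where "e' = inv_into UNIV e"
  have e'e: "e' (e i) = i" for i
    unfolding e'_def using e by (simp add: bij_betw_def)
  have w_alt: "w k = (\<Sum>j<CARD('n). k (e' j) * B ^ j)" for k
    unfolding w_def using sum.reindex_bij_betw[OF e, of "\<lambda>j. k (e' j) * B ^ j"] by (simp add: e'e)
  have le: "k i < B" if "k \<in> K" for k i
  proof -
    have "k i \<le> (\<Sum>i\<in>UNIV. k i)" by (rule member_le_sum) auto
    then show ?thesis using that by (simp add: K_def B_def)
  qed
  have inj: "k = k0" if "k \<in> K" "w k = w k0" for k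
  proof
    fix i
    have "k (e' j) = k0 (e' j)" if "j < CARD('n)" for j
      using digits_unique[of "\<lambda>j. k (e' j)" B "CARD('n)" "\<lambda>j. k0 (e' j)" j] le[OF \<open>k \<in> K\<close>]
        le[of k0] deg that \<open>w k = w k0\<close> by (simp add: w_alt K_def)
    from this[of "e i"] e show "k i = k0 i" by (auto simp: e'e bij_betw_def)
  qed
  define p where "p = (\<Sum>k\<in>K. monom (c k) (w k))"
  have pz: "poly p s = 0" if "norm s < 1" for s :: complex
  proof -
    define v :: "complex^'n" where "v = (\<chi> i. s ^ (B ^ e i))"
    have v: "v \<in> polydisc"
      using that by (auto simp: v_def polydisc_def norm_power B_def intro!: power_Suc_less_one
          simp: power_less_one_iff)
    have "monomial k v = s ^ w k" for k
      by (simp add: monomial_def v_def w_def power_sum power_mult[symmetric] mult.commute)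
    then have "poly p s = (\<Sum>k\<in>K. c k * monomial k v)"
      by (simp add: p_def poly_sum poly_monom)
    also have "\<dots> = 0" using zero[OF v] by (simp add: K_def)
    finally show ?thesis .
  qed
  have "p = 0"
  proof (rule ccontr)
    assume "p \<noteq> 0"
    then have "finite {x. poly p x = 0}" by (rule poly_roots_finite)
    then have "finite (ball (0::complex) 1)"
      by (rule rev_finite_subset) (auto simp: pz)
    then show False
      using uncountable_ball[of 1 "0::complex"] countable_finite[of "ball (0::complex) 1"] by simp
  qed
  have "coeff p (w k0) = (\<Sum>k\<in>K. if k = k0 then c k else 0)"
    unfolding p_def coeff_sum by (intro sum.cong) (auto dest: inj)
  also have "\<dots> = c k0" using finK deg by (simp add: K_def)
  finally show ?thesis using \<open>p = 0\<close> by simp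
qed

lemma has_sum_zero_imp_coeff_zero:
  fixes c :: "('n::finite \<Rightarrow> nat) \<Rightarrow> complex"
  assumes "\<And>z. z \<in> polydisc \<Longrightarrow> ((\<lambda>k. c k * monomial k z) has_sum 0) UNIV"
  shows "c k = 0"
proof -
  define D where "D k = (\<Sum>i\<in>UNIV. k i)" for k :: "'n \<Rightarrow> nat"
  define P where "P d w = (\<Sum>k | D k = d. c k * monomial k w)" for d w
  have "P d w = 0" if w: "w \<in> polydisc" for d w
  proof (rule power_series_zero_imp_coeff_zero)
    fix t :: complex assume t: "norm t < 1"
    have tw: "(\<chi> i. t * w $ i) \<in> polydisc"
    proof -
      have "norm (t * w $ i) < 1" for i
        using t w mult_strict_mono'[of "norm t" 1 "norm (w $ i)" 1]
        by (simp add: polydisc_def norm_mult)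
      then show ?thesis by (simp add: polydisc_def)
    qed
    have mon: "monomial k (\<chi> i. t * w $ i) = t ^ D k * monomial k w" for k
      by (simp add: monomial_def D_def power_mult_distrib prod.distrib power_sum)
    have *: "((\<lambda>k. c k * (t ^ D k * monomial k w)) has_sum 0) UNIV"
      using assms[OF tw] by (simp add: mon)
    have bij: "bij_betw snd (SIGMA d:UNIV. {k. D k = d}) UNIV"
      by (rule bij_betwI[where g = "\<lambda>k. (D k, k)"]) auto
    have "((\<lambda>x. c (snd x) * (t ^ D (snd x) * monomial (snd x) w)) has_sum 0)
            (SIGMA d:UNIV. {k. D k = d})"
      using has_sum_reindex_bij_betw[OF bij, of "\<lambda>k. c k * (t ^ D k * monomial k w)" 0] * by simp
    then have "((\<lambda>d. P d w * t ^ d) has_sum 0) UNIV"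
    proof (rule has_sum_SigmaD)
      fix d :: nat
      have "((\<lambda>k. c k * (t ^ D k * monomial k w)) has_sum
              (\<Sum>k | D k = d. c k * (t ^ D k * monomial k w))) {k. D k = d}"
        using finite_degree[of d] by (intro has_sum_finite) (simp add: D_def)
      also have "(\<Sum>k | D k = d. c k * (t ^ D k * monomial k w)) = P d w * t ^ d"
        unfolding P_def sum_distrib_right by (intro sum.cong) auto
      finally show "((\<lambda>k. c (snd (d, k)) * (t ^ D (snd (d, k)) * monomial (snd (d, k)) w)) has_sum
              P d w * t ^ d) {k. D k = d}" by simp
    qed
    then show "(\<lambda>d. P d w * t ^ d) sums 0" by (rule has_sum_imp_sums)
  qed
  then show ?thesis
    unfolding P_def D_def by (rule homogeneous_zero_imp_coeff_zero) auto
qed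

lemma taylor_unique:
  assumes "taylor f a" "taylor f b"
  shows "a = b"
proof
  fix k
  have "((\<lambda>k. (a k - b k) * monomial k z) has_sum 0) UNIV" if "z \<in> polydisc" for z
  proof -
    have "((\<lambda>k. a k * monomial k z + - (b k * monomial k z)) has_sum (f z + - f z)) UNIV"
      using assms that by (intro has_sum_add has_sum_uminusI) (auto simp: taylor_def)
    then show ?thesis by (simp add: algebra_simps)
  qed
  from has_sum_zero_imp_coeff_zero[OF this] show "a k = b k" by simp
qed


subsection \<open>Linear and metric structure\<close>

lemma square_summable_add:
  fixes a b :: "'a \<Rightarrow> complex"
  assumes "(\<lambda>k. (norm (a k))\<^sup>2) summable_on UNIV" "(\<lambda>k. (norm (b k))\<^sup>2) summable_on UNIV"
  shows "(\<lambda>k. (norm (a k + b k))\<^sup>2) summable_on UNIV"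
proof (rule summable_on_comparison_test)
  show "(\<lambda>k. 2 * (norm (a k))\<^sup>2 + 2 * (norm (b k))\<^sup>2) summable_on UNIV"
    using assms by (intro summable_on_add summable_on_cmult_right)
  fix k
  have "(norm (a k + b k))\<^sup>2 \<le> (norm (a k) + norm (b k))\<^sup>2"
    by (intro power_mono norm_triangle_ineq) auto
  also have "\<dots> \<le> 2 * (norm (a k))\<^sup>2 + 2 * (norm (b k))\<^sup>2"
    using sum_squares_bound[of "norm (a k)" "norm (b k)"] by (simp add: power2_sum)
  finally show "(norm (a k + b k))\<^sup>2 \<le> 2 * (norm (a k))\<^sup>2 + 2 * (norm (b k))\<^sup>2" .
qed auto

lemma taylor_add: "taylor f a \<Longrightarrow> taylor g b \<Longrightarrow> taylor (\<lambda>z. f z + g z) (\<lambda>k. a k + b k)"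
  by (auto simp: taylor_def distrib_right intro!: square_summable_add has_sum_add)

lemma taylor_scale: "taylor f a \<Longrightarrow> taylor (\<lambda>z. c * f z) (\<lambda>k. c * a k)"
  by (auto simp: taylor_def norm_mult power_mult_distrib mult.assoc
      intro!: summable_on_cmult_right has_sum_cmult_right)

lemma taylor_zero: "taylor (\<lambda>_. 0) (\<lambda>_. 0)"
  by (simp add: taylor_def)

lift_definition cscale :: "complex \<Rightarrow> 'n::finite hardy \<Rightarrow> 'n hardy" is
  "\<lambda>c f z. c * f z"
  by (auto dest: taylor_scale)

lemma taylor_hardy: "taylor (hardy_fun f) (hardy_coeff f)"
proof -
  obtain a where a: "taylor (hardy_fun f) a" using hardy_fun[of f] by blast
  show ?thesis
    unfolding hardy_coeff_def by (rule theI[of _ a]) (use a taylor_unique in blast)+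
qed

lemma hardy_coeff_eqI: "taylor (hardy_fun f) a \<Longrightarrow> hardy_coeff f = a"
  using taylor_hardy taylor_unique by blast

definition cinner :: "'n::finite hardy \<Rightarrow> 'n hardy \<Rightarrow> complex" where
  "cinner f g = (\<Sum>\<^sub>\<infinity>k. hardy_coeff f k * cnj (hardy_coeff g k))"

instantiation hardy :: (finite) real_inner
begin

lift_definition zero_hardy :: "'a hardy" is "\<lambda>_. 0"
  using taylor_zero by blast

lift_definition plus_hardy :: "'a hardy \<Rightarrow> 'a hardy \<Rightarrow> 'a hardy" is "\<lambda>f g z. f z + g z"
  by (auto dest: taylor_add)

definition uminus_hardy :: "'a hardy \<Rightarrow> 'a hardy" where "- f = cscale (-1) f"

definition minus_hardy :: "'a hardy \<Rightarrow> 'a hardy \<Rightarrow> 'a hardy" where "f - g = f + - (g :: 'a hardy)"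

definition scaleR_hardy :: "real \<Rightarrow> 'a hardy \<Rightarrow> 'a hardy" where
  "r *\<^sub>R f = cscale (complex_of_real r) f"

definition inner_hardy :: "'a hardy \<Rightarrow> 'a hardy \<Rightarrow> real" where
  "inner f g = Re (cinner f g)"

definition norm_hardy :: "'a hardy \<Rightarrow> real" where "norm f = sqrt (inner f (f :: 'a hardy))"

definition sgn_hardy :: "'a hardy \<Rightarrow> 'a hardy" where "sgn f = inverse (norm f) *\<^sub>R (f :: 'a hardy)"

definition dist_hardy :: "'a hardy \<Rightarrow> 'a hardy \<Rightarrow> real" where "dist f g = norm (f - (g :: 'a hardy))"

definition uniformity_hardy :: "('a hardy \<times> 'a hardy) filter" where
  "uniformity_hardy = (INF e\<in>{0 <..}. principal {(f, g). dist f g < e})"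

definition open_hardy :: "'a hardy set \<Rightarrow> bool" where
  "open_hardy U = (\<forall>f\<in>U. eventually (\<lambda>(f', g). f' = f \<longrightarrow> g \<in> U) uniformity)"

instance
proof
  have coeff_add: "hardy_coeff (f + g) = (\<lambda>k. hardy_coeff f k + hardy_coeff g k)" for f g :: "'a hardy"
    by (rule hardy_coeff_eqI) (simp add: plus_hardy.rep_eq taylor_add taylor_hardy)
  have coeff_scale: "hardy_coeff (cscale c f) = (\<lambda>k. c * hardy_coeff f k)" for c and f :: "'a hardy"
    by (rule hardy_coeff_eqI) (simp add: cscale.rep_eq taylor_scale taylor_hardy)
  have coeff_0: "hardy_coeff (0 :: 'a hardy) = (\<lambda>_. 0)"
    by (rule hardy_coeff_eqI) (simp add: zero_hardy.rep_eq taylor_zero)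
  have square: "(\<lambda>k. (norm (hardy_coeff f k))\<^sup>2) summable_on UNIV" for f :: "'a hardy"
    using taylor_hardy[of f] by (simp add: taylor_def)
  have summable: "(\<lambda>k. hardy_coeff f k * cnj (hardy_coeff g k)) summable_on UNIV" for f g :: "'a hardy"
  proof (rule abs_summable_summable, rule summable_on_comparison_test)
    show "(\<lambda>k. (norm (hardy_coeff f k))\<^sup>2 + (norm (hardy_coeff g k))\<^sup>2) summable_on UNIV"
      by (intro summable_on_add square)
    show "norm (hardy_coeff f k * cnj (hardy_coeff g k)) \<le> (norm (hardy_coeff f k))\<^sup>2 + (norm (hardy_coeff g k))\<^sup>2" for k
      using sum_squares_bound[of "norm (hardy_coeff f k)" "norm (hardy_coeff g k)"]
        mult_nonneg_nonneg[OF norm_ge_zero norm_ge_zero, of "hardy_coeff f k" "hardy_coeff g k"]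
      by (simp add: norm_mult mult.assoc del: zero_le_mult_iff mult_nonneg_nonneg)
  qed auto
  have inner_sum: "((\<lambda>k. (norm (hardy_coeff f k))\<^sup>2) has_sum inner f f) UNIV" for f :: "'a hardy"
  proof -
    have "((\<lambda>k. Re (hardy_coeff f k * cnj (hardy_coeff f k))) has_sum Re (cinner f f)) UNIV"
      unfolding cinner_def by (intro has_sum_Re has_sum_infsum summable)
    then show ?thesis
      by (simp add: inner_hardy_def complex_mult_cnj cmod_power2)
  qed
  fix f g h :: "'a hardy" and r s :: real
  show "f + g + h = f + (g + h)" by transfer (simp add: add.assoc)
  show "f + g = g + f" by transfer (simp add: add.commute)
  show "0 + f = f" by transfer simp
  show "- f + f = 0" unfolding uminus_hardy_def by transfer simp
  show "f - g = f + - g" by (rule minus_hardy_def)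
  show "r *\<^sub>R (f + g) = r *\<^sub>R f + r *\<^sub>R g"
    unfolding scaleR_hardy_def by transfer (simp add: distrib_left)
  show "(r + s) *\<^sub>R f = r *\<^sub>R f + s *\<^sub>R f"
    unfolding scaleR_hardy_def by transfer (simp add: distrib_right)
  show "r *\<^sub>R s *\<^sub>R f = (r * s) *\<^sub>R f"
    unfolding scaleR_hardy_def by transfer (simp add: mult.assoc)
  show "1 *\<^sub>R f = f" unfolding scaleR_hardy_def by transfer simp
  show "dist f g = norm (f - g)" by (rule dist_hardy_def)
  show "sgn f = inverse (norm f) *\<^sub>R f" by (rule sgn_hardy_def)
  show "(uniformity :: ('a hardy \<times> 'a hardy) filter) = (INF e\<in>{0 <..}. principal {(x, y). dist x y < e})"
    by (rule uniformity_hardy_def)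
  show "open U = (\<forall>x\<in>U. \<forall>\<^sub>F (x', y) in uniformity. x' = x \<longrightarrow> y \<in> U)" for U :: "'a hardy set"
    by (rule open_hardy_def)
  have cinner_cnj: "cinner f g = cnj (cinner g f)"
    unfolding cinner_def infsum_cnj[symmetric] by (simp add: mult.commute)
  show "inner f g = inner g f" unfolding inner_hardy_def by (subst cinner_cnj) simp
  have "cinner (f + g) h = cinner f h + cinner g h"
    by (simp add: cinner_def coeff_add distrib_right infsum_add summable)
  then show "inner (f + g) h = inner f h + inner g h" by (simp add: inner_hardy_def)
  have "cinner (r *\<^sub>R f) g = complex_of_real r * cinner f g"
    by (simp add: cinner_def scaleR_hardy_def coeff_scale mult.assoc infsum_cmult_right')
  then show "inner (r *\<^sub>R f) g = r * inner f g" by (simp add: inner_hardy_def)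
  show "0 \<le> inner f f"
    using inner_sum[of f] by (rule has_sum_nonneg) auto
  show "inner f f = 0 \<longleftrightarrow> f = 0"
  proof
    assume "inner f f = 0"
    then have "(norm (hardy_coeff f k))\<^sup>2 = 0" for k
      using inner_sum[of f] nonneg_has_sum_le_0D[where f = "\<lambda>k. (norm (hardy_coeff f k))\<^sup>2" and A = UNIV and x = k]
      by fastforce
    then have "hardy_coeff f = (\<lambda>_. 0)" by auto
    then have "((\<lambda>k::'a \<Rightarrow> nat. 0) has_sum hardy_fun f z) UNIV" if "z \<in> polydisc" for z
      using taylor_hardy[of f] that by (simp add: taylor_def)
    from infsumI[OF this] have "hardy_fun f z = 0" for z
      using hardy_fun[of f] by (cases "z \<in> polydisc") auto
    then show "f = 0" by transfer auto
  next
    assume "f = 0"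
    then show "inner f f = 0" by (simp add: inner_hardy_def cinner_def coeff_0)
  qed
  show "norm f = sqrt (inner f f)" by (rule norm_hardy_def)
qed

end

global_interpretation hardy: vector_space "cscale :: complex \<Rightarrow> 'n::finite hardy \<Rightarrow> 'n hardy"
  by standard (transfer; simp add: algebra_simps)+

definition closed_span :: "'n::finite hardy set \<Rightarrow> 'n hardy set" where
  "closed_span X = closure (hardy.span X)"

text \<open>
  The Hilbert space tensor product of subspaces \<open>Q i\<close> of \<open>H\<^sup>2\<close> of the disc, inside \<open>H\<^sup>2\<close> of the
  polydisc: an elementary tensor is the function taking \<open>z\<close> to the product of the \<open>f i (z $ i)\<close>.
\<close>

definition hardy_tensor :: "('n::finite \<Rightarrow> hardy_disc set) \<Rightarrow> 'n hardy set" where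
  "hardy_tensor Q = closed_span {F. \<exists>f. (\<forall>i. f i \<in> Q i) \<and>
     (\<forall>z\<in>polydisc. hardy_fun F z = (\<Prod>i\<in>UNIV. hardy_fun (f i) (vec (z $ i))))}"

lemma taylor_mult_variable:
  fixes f :: "complex^'n::finite \<Rightarrow> complex"
  assumes "taylor f a"
  shows "taylor (\<lambda>z. z $ i * f z) (\<lambda>k. if k i = 0 then 0 else a (k(i := k i - 1)))"
proof -
  define S where "S k = k(i := Suc (k i))" for k :: "'n \<Rightarrow> nat"
  have inj: "inj S"
  proof (rule injI)
    fix k k' assume eq: "S k = S k'"
    show "k = k'"
    proof
      fix j show "k j = k' j" using fun_cong[OF eq, of j] by (cases "j = i") (auto simp: S_def)
    qed
  qed
  have rng: "k \<in> range S \<longleftrightarrow> k i \<noteq> 0" for k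
  proof
    assume "k i \<noteq> 0"
    then have "k = S (k(i := k i - 1))" by (simp add: S_def)
    then show "k \<in> range S" by blast
  qed (auto simp: S_def)
  define b where "b k = (if k i = 0 then 0 else a (k(i := k i - 1)))" for k
  have bS: "b (S k) = a k" for k by (simp add: b_def S_def)
  have mon: "monomial (S k) z = z $ i * monomial k z" for k and z :: "complex^'n"
  proof -
    have "monomial (S k) z = (\<Prod>j\<in>UNIV. (if j = i then z $ i else 1) * (z $ j) ^ k j)"
      unfolding monomial_def S_def by (intro prod.cong) auto
    then show ?thesis by (simp add: prod.distrib monomial_def)
  qed
  have "(\<lambda>k. (norm (b k))\<^sup>2) summable_on range S"
    using assms by (subst summable_on_reindex[OF inj]) (simp add: o_def bS taylor_def)
  then have 1: "(\<lambda>k. (norm (b k))\<^sup>2) summable_on UNIV"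
    by (rule summable_on_cong_neutral[THEN iffD1, rotated -1]) (auto simp: rng b_def)
  have 2: "((\<lambda>k. b k * monomial k z) has_sum z $ i * f z) UNIV" if "z \<in> polydisc" for z
  proof -
    have "((\<lambda>k. z $ i * (a k * monomial k z)) has_sum z $ i * f z) UNIV"
      using assms that by (intro has_sum_cmult_right) (simp add: taylor_def)
    then have "((\<lambda>k. b k * monomial k z) has_sum z $ i * f z) (range S)"
      by (subst has_sum_reindex[OF inj]) (simp add: o_def bS mon mult_ac)
    then show ?thesis
      by (rule has_sum_cong_neutral[THEN iffD1, rotated -1]) (auto simp: rng b_def)
  qed
  from 1 2 show ?thesis unfolding taylor_def b_def by blast
qed

lift_definition Mz :: "'n::finite \<Rightarrow> 'n hardy \<Rightarrow> 'n hardy" is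
  "\<lambda>i f (z :: complex^'n). z $ i * f z"
  by (auto dest: taylor_mult_variable)


section \<open>Rank of a tuple of operators\<close>

definition ecard :: "'a set \<Rightarrow> enat" where
  "ecard S = (if finite S then enat (card S) else \<infinity>)"

text \<open>
  \<open>p(T\<^sub>1, \<dots>, T\<^sub>n) h\<close> for a polynomial \<open>p\<close> in the variables \<open>z\<^sub>i\<close>, represented as a finitely
  supported map from exponents to coefficients.  The fold applies the \<open>T i ^^ m i\<close> one after the
  other; it is meaningful only for commuting operators, where the order is immaterial.
\<close>

definition poly_apply ::
    "(('n::finite \<Rightarrow>\<^sub>0 nat) \<Rightarrow>\<^sub>0 complex) \<Rightarrow> ('n \<Rightarrow> 'm::finite hardy \<Rightarrow> 'm hardy) \<Rightarrow> 'm hardy \<Rightarrow> 'm hardy" where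
  "poly_apply p T h = (\<Sum>m\<in>Poly_Mapping.keys p. cscale (Poly_Mapping.lookup p m)
     (Finite_Set.fold (\<lambda>i. T i ^^ Poly_Mapping.lookup m i) h UNIV))"

definition generated :: "('n::finite \<Rightarrow> 'm::finite hardy \<Rightarrow> 'm hardy) \<Rightarrow> 'm hardy set \<Rightarrow> 'm hardy set" where
  "generated T S = closed_span {poly_apply p T h | p h. h \<in> S}"

text \<open>The rank of the restriction of \<open>T\<close> to a closed \<open>T\<close>-invariant subspace \<open>H\<close>.\<close>

definition rank_on :: "'m::finite hardy set \<Rightarrow> ('n::finite \<Rightarrow> 'm hardy \<Rightarrow> 'm hardy) \<Rightarrow> enat" where
  "rank_on H T = Inf {ecard S | S. S \<subseteq> H \<and> generated T S = H}"

text \<open>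
  The library's \<^const>\<open>adjoint\<close> is taken with respect to the real inner product, the real part of
  \<^const>\<open>cinner\<close>.  For a complex-linear operator this is the usual Hilbert space adjoint.
\<close>

definition co_rank :: "'n::finite hardy set \<Rightarrow> enat" where
  "co_rank Q = rank_on Q (\<lambda>i. adjoint (Mz i))"


section \<open>Inner functions and Blaschke products\<close>

text \<open>
  Functions on the disc are total functions on the complex plane, of which only the values on the
  open unit disc matter.
\<close>

definition inner_function :: "(complex \<Rightarrow> complex) \<Rightarrow> bool" where
  "inner_function \<phi> \<longleftrightarrow>
     \<phi> holomorphic_on ball 0 1 \<and> bounded (\<phi> ` ball 0 1) \<and>
     (AE t in lborel. t \<in> {0..2 * pi} \<longrightarrow>
        (\<exists>l. ((\<lambda>r. \<phi> (complex_of_real r * cis t)) \<longlongrightarrow> l) (at_left 1) \<and> norm l = 1))"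

definition inner_dvd :: "(complex \<Rightarrow> complex) \<Rightarrow> (complex \<Rightarrow> complex) \<Rightarrow> bool" where
  "inner_dvd \<psi> \<phi> \<longleftrightarrow> (\<exists>\<theta>. inner_function \<theta> \<and> (\<forall>z\<in>ball 0 1. \<phi> z = \<psi> z * \<theta> z))"

text \<open>\<open>\<Q>\<^sub>\<phi>\<close>, the orthogonal complement of \<open>\<phi> H\<^sup>2\<close>.\<close>

definition model_space :: "(complex \<Rightarrow> complex) \<Rightarrow> hardy_disc set" where
  "model_space \<phi> = {f. \<forall>(g :: hardy_disc) (h :: hardy_disc).
     (\<forall>z\<in>ball 0 1. hardy_fun h (vec z) = \<phi> z * hardy_fun g (vec z)) \<longrightarrow> cinner f h = 0}"

definition blaschke_factor :: "complex \<Rightarrow> complex \<Rightarrow> complex" where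
  "blaschke_factor \<alpha> z = (z - \<alpha>) / (1 - cnj \<alpha> * z)"

text \<open>
  \<open>\<phi>\<close> is the product of the \<open>b\<^bsub>\<alpha> m\<^esub> ^ l m\<close> for \<open>m \<in> M\<close>, each multiplied by a unimodular constant;
  \<open>M\<close> may be empty, finite or infinite.  Divergence to \<open>0\<close> does not count as convergence for
  \<^const>\<open>has_prod\<close>.
\<close>

definition blaschke_form ::
    "(complex \<Rightarrow> complex) \<Rightarrow> nat set \<Rightarrow> (nat \<Rightarrow> complex) \<Rightarrow> (nat \<Rightarrow> nat) \<Rightarrow> bool" where
  "blaschke_form \<phi> M \<alpha> l \<longleftrightarrow>
     inj_on \<alpha> M \<and> (\<forall>m\<in>M. norm (\<alpha> m) < 1 \<and> l m \<ge> 1) \<and>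
     (\<lambda>m. real (l m) * (1 - norm (\<alpha> m))) summable_on M \<and>
     (\<exists>c. (\<forall>m\<in>M. norm (c m) = 1) \<and>
        (\<forall>z\<in>ball 0 1.
           (\<lambda>m. if m \<in> M then c m * blaschke_factor (\<alpha> m) z ^ l m else 1) has_prod \<phi> z))"

definition blaschke_product :: "(complex \<Rightarrow> complex) \<Rightarrow> bool" where
  "blaschke_product \<phi> \<longleftrightarrow> inner_function \<phi> \<and> (\<exists>M \<alpha> l. blaschke_form \<phi> M \<alpha> l)"

text \<open>\<open>\<I>\<^sub>\<phi>\<close>; it does not depend on how \<open>\<phi>\<close> is written as a product.\<close>

definition blaschke_parts :: "(complex \<Rightarrow> complex) \<Rightarrow> (complex \<Rightarrow> complex) set" where
  "blaschke_parts \<phi> =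
     {\<lambda>z. blaschke_factor (\<alpha> m) z ^ l m | M \<alpha> l m. blaschke_form \<phi> M \<alpha> l \<and> m \<in> M}"

definition prime_part :: "(complex \<Rightarrow> complex) \<Rightarrow> complex \<Rightarrow> complex" where
  "prime_part \<xi> = (THE b. \<exists>\<alpha> l. norm \<alpha> < 1 \<and> l \<ge> (1::nat) \<and>
     b = blaschke_factor \<alpha> \<and> \<xi> = (\<lambda>z. blaschke_factor \<alpha> z ^ l))"

text \<open>For a Blaschke product \<open>\<phi>\<close> and \<open>b = b\<^sub>\<alpha>\<close>, the order of the zero of \<open>\<phi>\<close> at \<open>\<alpha>\<close>.\<close>

definition ord_at :: "(complex \<Rightarrow> complex) \<Rightarrow> (complex \<Rightarrow> complex) \<Rightarrow> nat" where
  "ord_at \<phi> b = nat (zorder \<phi> (THE \<alpha>. norm \<alpha> < 1 \<and> b = blaschke_factor \<alpha>))"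


section \<open>Sequences of Blaschke products\<close>

definition increasing_seq :: "(int \<Rightarrow> complex \<Rightarrow> complex) \<Rightarrow> bool" where
  "increasing_seq \<phi> \<longleftrightarrow> (\<forall>k. inner_dvd (\<phi> k) (\<phi> (k + 1)))"

definition decreasing_seq :: "(int \<Rightarrow> complex \<Rightarrow> complex) \<Rightarrow> bool" where
  "decreasing_seq \<phi> \<longleftrightarrow> (\<forall>k. inner_dvd (\<phi> (k + 1)) (\<phi> k))"

definition no_common_inner_factor :: "(int \<Rightarrow> complex \<Rightarrow> complex) \<Rightarrow> bool" where
  "no_common_inner_factor \<phi> \<longleftrightarrow>
     (\<forall>\<psi>. inner_function \<psi> \<and> (\<forall>k. inner_dvd \<psi> (\<phi> k)) \<longrightarrow> \<psi> constant_on ball 0 1)"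

definition Q_Phi :: "('n::finite \<Rightarrow> int \<Rightarrow> complex \<Rightarrow> complex) \<Rightarrow> 'n hardy set" where
  "Q_Phi \<phi> = closed_span (\<Union>k. hardy_tensor (\<lambda>i. model_space (\<phi> i k)))"

definition Lambda :: "('n \<Rightarrow> int \<Rightarrow> complex \<Rightarrow> complex) \<Rightarrow> ('n \<Rightarrow> complex \<Rightarrow> complex) set" where
  "Lambda \<phi> = (\<Union>k. {\<xi>. \<forall>i. \<xi> i \<in> blaschke_parts (\<phi> i k)})"

definition Z_set ::
    "('n \<Rightarrow> int \<Rightarrow> complex \<Rightarrow> complex) \<Rightarrow> ('n \<Rightarrow> complex \<Rightarrow> complex) \<Rightarrow> int set" where
  "Z_set \<phi> \<xi> = {k. \<forall>i. inner_dvd (prime_part (\<xi> i)) (\<phi> i k)}"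

definition Q_local ::
    "('n::finite \<Rightarrow> int \<Rightarrow> complex \<Rightarrow> complex) \<Rightarrow> ('n \<Rightarrow> complex \<Rightarrow> complex) \<Rightarrow> int set \<Rightarrow> 'n hardy set" where
  "Q_local \<phi> \<xi> Y = closed_span (\<Union>k\<in>Y. hardy_tensor (\<lambda>i.
     model_space (\<lambda>z. prime_part (\<xi> i) z ^ ord_at (\<phi> i k) (prime_part (\<xi> i)))))"

text \<open>
  A subset of \<^term>\<open>Z_set \<phi> \<xi>\<close> of minimal cardinality that still gives \<open>\<Q>(\<xi>\<^sub>1, \<dots>, \<xi>\<^sub>n)\<close>.  There may be
  several; \<^const>\<open>arg_min\<close> selects one.
\<close>

definition Z_tilde ::
    "('n::finite \<Rightarrow> int \<Rightarrow> complex \<Rightarrow> complex) \<Rightarrow> ('n \<Rightarrow> complex \<Rightarrow> complex) \<Rightarrow> int set" where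
  "Z_tilde \<phi> \<xi> = (ARG_MIN ecard Y. Y \<subseteq> Z_set \<phi> \<xi> \<and> Q_local \<phi> \<xi> Y = Q_local \<phi> \<xi> (Z_set \<phi> \<xi>))"

end

theory Submission
  imports Defs
begin

text \<open>
  For a Blaschke product, the model space is the closed span of the generalised eigenvectors
  \<open>z\<^sup>j / (1 - cnj a * z)\<^sup>j\<^sup>+\<^sup>1\<close> of the backward shift, \<open>j\<close> below the order of the zero \<open>a\<close>.  Hence the
  quotient module is the closed span of countably many finite-dimensional joint generalised
  eigenspaces, the local spaces at the points \<open>p\<close>, each of them a union of boxes of exponents; as one
  sequence increases and another one decreases to order \<open>0\<close>, only finitely many indices matter at \<open>p\<close>.

  Upper bound: the local space at \<open>p\<close> is generated by the top corners of the boxes of a minimal set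
  of indices.  Adding up such corners over all \<open>p\<close> with rapidly decreasing weights gives global
  generators, because polynomials in the backward shifts separate the finitely many first points.

  Lower bound: each maximal box at \<open>p\<close> gives a function \<open>g\<close> for which \<open>(z\<^sub>i - p\<^sub>i) g\<close> is orthogonal to the
  quotient module for all \<open>i\<close>.  So \<open>f \<mapsto> \<langle>f, g\<rangle>\<close> vanishes on the module generated by \<open>S\<close> as soon as it
  vanishes on \<open>S\<close>, and these functionals are dual to the top corners of the maximal boxes.
\<close>

section \<open>\<open>H\<^sup>2\<close> as a sequence space\<close>

definition square_summable :: "('a \<Rightarrow> complex) \<Rightarrow> bool" where
  "square_summable a \<longleftrightarrow> (\<lambda>k. (norm (a k))\<^sup>2) summable_on UNIV"

lemma square_summable_product:
  fixes a b :: "'a \<Rightarrow> complex"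
  assumes "square_summable a" "square_summable b"
  shows "(\<lambda>k. norm (a k * b k)) summable_on UNIV"
  by (rule abs_summable_product)
    (use assms in \<open>simp_all add: square_summable_def norm_mult power2_eq_square\<close>)

lemma square_summableI:
  fixes a :: "'a \<Rightarrow> complex"
  assumes "\<And>F. finite F \<Longrightarrow> (\<Sum>k\<in>F. (norm (a k))\<^sup>2) \<le> C"
  shows "square_summable a" "(\<Sum>\<^sub>\<infinity>k. (norm (a k))\<^sup>2) \<le> C"
proof -
  show 1: "square_summable a"
    unfolding square_summable_def
    by (rule nonneg_bdd_above_summable_on) (auto intro!: bdd_aboveI2[where M = C] assms)
  show "(\<Sum>\<^sub>\<infinity>k. (norm (a k))\<^sup>2) \<le> C"
    using 1 unfolding square_summable_def by (rule infsum_le_finite_sums) (use assms in auto)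
qed

lemma abs_summable_prod:
  fixes f :: "'n::finite \<Rightarrow> 'b::countable \<Rightarrow> complex"
  assumes "\<And>i. (\<lambda>k. norm (f i k)) summable_on UNIV"
  shows "(\<lambda>k. norm (\<Prod>i\<in>UNIV. f i (k i))) summable_on UNIV"
    and "(\<Sum>\<^sub>\<infinity>k. \<Prod>i\<in>UNIV. f i (k i)) = (\<Prod>i\<in>UNIV. \<Sum>\<^sub>\<infinity>k. f i k)"
proof -
  have "Infinite_Set_Sum.abs_summable_on (\<lambda>k. \<Prod>i\<in>UNIV. f i (k i)) (PiE UNIV (\<lambda>_::'n. UNIV :: 'b set))"
    using assms abs_summable_equivalent by (intro abs_summable_on_prod_PiE) auto
  then show "(\<lambda>k. norm (\<Prod>i\<in>UNIV. f i (k i))) summable_on UNIV"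
    by (simp add: abs_summable_equivalent)
  show "(\<Sum>\<^sub>\<infinity>k. \<Prod>i\<in>UNIV. f i (k i)) = (\<Prod>i\<in>UNIV. \<Sum>\<^sub>\<infinity>k. f i k)"
    using infsum_prod_PiE_abs[of "UNIV :: 'n set" f "\<lambda>_. UNIV"] assms by simp
qed

lemma square_summable_prod:
  fixes f :: "'n::finite \<Rightarrow> 'b::countable \<Rightarrow> complex"
  assumes "\<And>i. square_summable (f i)"
  shows "square_summable (\<lambda>k. \<Prod>i\<in>UNIV. f i (k i))"
proof -
  have "(\<lambda>k. norm (\<Prod>i\<in>UNIV. (f i (k i))\<^sup>2)) summable_on UNIV"
    using assms abs_summable_prod(1)[of "\<lambda>i k. (f i k)\<^sup>2"]
    by (simp add: square_summable_def norm_power)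
  then show ?thesis
    by (simp add: square_summable_def prod_power_distrib flip: norm_power)
qed

lemma square_summable_power:
  fixes z :: complex
  assumes "norm z < 1"
  shows "square_summable (\<lambda>n. z ^ n)"
proof -
  have "summable (\<lambda>n. ((norm z)\<^sup>2) ^ n)"
    using assms by (intro summable_geometric) (simp add: abs_square_less_1)
  then have "(\<lambda>n. ((norm z)\<^sup>2) ^ n) summable_on UNIV"
    by (subst summable_on_UNIV_nonneg_real_iff) auto
  moreover have "(norm (z ^ n))\<^sup>2 = ((norm z)\<^sup>2) ^ n" for n
    by (simp only: norm_power power_mult [symmetric] mult.commute)
  ultimately show ?thesis
    by (simp add: square_summable_def)
qed

lemma square_summable_monomial: "z \<in> polydisc \<Longrightarrow> square_summable (\<lambda>k. monomial k z)"
  unfolding monomial_def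
  by (rule square_summable_prod) (simp add: square_summable_power polydisc_def)

lemma hardy_coeff_add: "hardy_coeff (f + g) = (\<lambda>k. hardy_coeff f k + hardy_coeff g k)"
  by (rule hardy_coeff_eqI) (simp add: plus_hardy.rep_eq taylor_add taylor_hardy)

lemma hardy_coeff_cscale: "hardy_coeff (cscale c f) = (\<lambda>k. c * hardy_coeff f k)"
  by (rule hardy_coeff_eqI) (simp add: cscale.rep_eq taylor_scale taylor_hardy)

lemma hardy_coeff_0: "hardy_coeff 0 = (\<lambda>_. 0)"
  by (rule hardy_coeff_eqI) (simp add: zero_hardy.rep_eq taylor_zero)

lemma hardy_coeff_diff: "hardy_coeff (f - g) = (\<lambda>k. hardy_coeff f k - hardy_coeff g k)"
  by (simp only: minus_hardy_def uminus_hardy_def hardy_coeff_add hardy_coeff_cscale) simp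

lemma square_summable_coeff: "square_summable (hardy_coeff f)"
  using taylor_hardy[of f] by (simp add: taylor_def square_summable_def)

lemma hardy_fun_has_sum:
  "z \<in> polydisc \<Longrightarrow> ((\<lambda>k. hardy_coeff f k * monomial k z) has_sum hardy_fun f z) UNIV"
  using taylor_hardy[of f] by (simp add: taylor_def)

lemma hardy_fun_eqI: "(\<And>z. z \<in> polydisc \<Longrightarrow> hardy_fun f z = hardy_fun g z) \<Longrightarrow> f = g"
proof -
  assume eq: "\<And>z. z \<in> polydisc \<Longrightarrow> hardy_fun f z = hardy_fun g z"
  have "hardy_fun f z = hardy_fun g z" for z
    using hardy_fun[of f] hardy_fun[of g] eq[of z] by (cases "z \<in> polydisc") auto
  then show "f = g" by (simp add: hardy_fun_inject[symmetric] ext)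
qed

lemma hardy_eqI:
  assumes "\<And>k. hardy_coeff f k = hardy_coeff g k"
  shows "f = g"
proof (rule hardy_fun_eqI)
  fix z :: "complex^'a" assume "z \<in> polydisc"
  then show "hardy_fun f z = hardy_fun g z"
    using hardy_fun_has_sum[of z f] hardy_fun_has_sum[of z g]
    by (intro has_sum_unique[of "\<lambda>k. hardy_coeff g k * monomial k z"]) (simp_all add: assms)
qed

lemma ex_hardy_coeff:
  assumes "square_summable a"
  shows "\<exists>f. hardy_coeff f = a"
proof -
  define f where "f z = (if z \<in> polydisc then \<Sum>\<^sub>\<infinity>k. a k * monomial k z else 0)" for z
  have "taylor f a"
    unfolding taylor_def
  proof (intro conjI ballI)
    show "(\<lambda>k. (norm (a k))\<^sup>2) summable_on UNIV" using assms by (simp add: square_summable_def)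
    fix z :: "complex^'a" assume z: "z \<in> polydisc"
    have "(\<lambda>k. a k * monomial k z) summable_on UNIV"
      by (rule abs_summable_summable[OF square_summable_product[OF assms square_summable_monomial[OF z]]])
    moreover have "f z = (\<Sum>\<^sub>\<infinity>k. a k * monomial k z)" using z by (simp add: f_def)
    ultimately show "((\<lambda>k. a k * monomial k z) has_sum f z) UNIV"
      by (metis has_sum_infsum)
  qed
  moreover have "hardy_fun (Abs_hardy f) = f"
  proof (rule Abs_hardy_inverse, intro CollectI conjI exI[of _ a] allI impI)
    show "taylor f a" by fact
  qed (simp add: f_def)
  ultimately have "hardy_coeff (Abs_hardy f) = a" by (intro hardy_coeff_eqI) simp
  then show ?thesis ..
qed

definition hardy_of :: "(('n::finite \<Rightarrow> nat) \<Rightarrow> complex) \<Rightarrow> 'n hardy" where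
  "hardy_of a = (SOME f. hardy_coeff f = a)"

lemma hardy_coeff_hardy_of: "square_summable a \<Longrightarrow> hardy_coeff (hardy_of a) = a"
  unfolding hardy_of_def by (rule someI_ex) (rule ex_hardy_coeff)

lemma cinner_has_sum:
  "((\<lambda>k. hardy_coeff f k * cnj (hardy_coeff g k)) has_sum cinner f g) UNIV"
proof -
  have "square_summable (\<lambda>k. cnj (hardy_coeff g k))"
    using square_summable_coeff[of g] by (simp add: square_summable_def)
  then have "(\<lambda>k. hardy_coeff f k * cnj (hardy_coeff g k)) summable_on UNIV"
    by (rule abs_summable_summable[OF square_summable_product[OF square_summable_coeff]])
  then show ?thesis unfolding cinner_def by (rule has_sum_infsum)
qed

lemma cinner_add_left: "cinner (f + g) h = cinner f h + cinner g h"
  using has_sum_add[OF cinner_has_sum[of f h] cinner_has_sum[of g h]]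
  by (intro has_sum_unique[OF cinner_has_sum]) (simp add: hardy_coeff_add distrib_right)

lemma cinner_cscale_left: "cinner (cscale c f) g = c * cinner f g"
  using has_sum_cmult_right[OF cinner_has_sum[of f g], of c]
  by (intro has_sum_unique[OF cinner_has_sum]) (simp add: hardy_coeff_cscale mult.assoc)

lemma cinner_commute: "cinner f g = cnj (cinner g f)"
  unfolding cinner_def infsum_cnj[symmetric] by (simp add: mult.commute)

lemma cinner_add_right: "cinner f (g + h) = cinner f g + cinner f h"
  by (subst (1 2 3) cinner_commute) (simp add: cinner_add_left)

lemma cinner_cscale_right: "cinner f (cscale c g) = cnj c * cinner f g"
  by (subst (1 2) cinner_commute) (simp add: cinner_cscale_left)

lemma cinner_diff_left: "cinner (f - g) h = cinner f h - cinner g h"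
  by (simp only: minus_hardy_def uminus_hardy_def cinner_add_left cinner_cscale_left) simp

lemma cinner_diff_right: "cinner f (g - h) = cinner f g - cinner f h"
  by (simp only: minus_hardy_def uminus_hardy_def cinner_add_right cinner_cscale_right) simp

lemma cinner_0_left [simp]: "cinner 0 f = 0"
  using cinner_add_left[of 0 0 f] by simp

lemma cinner_0_right [simp]: "cinner f 0 = 0"
  using cinner_add_right[of f 0 0] by simp

lemma cinner_sum_right: "cinner f (\<Sum>x\<in>X. g x) = (\<Sum>x\<in>X. cinner f (g x))"
  by (induction X rule: infinite_finite_induct) (auto simp: cinner_add_right)

lemma norm_has_sum: "((\<lambda>k. (norm (hardy_coeff f k))\<^sup>2) has_sum (norm f)\<^sup>2) UNIV"
proof -
  have "((\<lambda>k. Re (hardy_coeff f k * cnj (hardy_coeff f k))) has_sum Re (cinner f f)) UNIV"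
    by (intro has_sum_Re cinner_has_sum)
  moreover have "Re (cinner f f) = (norm f)\<^sup>2"
    by (metis inner_hardy_def power2_norm_eq_inner)
  ultimately show ?thesis by (simp add: complex_mult_cnj cmod_power2)
qed

lemma cinner_self: "cinner f f = complex_of_real ((norm f)\<^sup>2)"
proof -
  have "((\<lambda>k. complex_of_real ((norm (hardy_coeff f k))\<^sup>2)) has_sum complex_of_real ((norm f)\<^sup>2)) UNIV"
    using norm_has_sum by (rule has_sum_of_real)
  then show ?thesis
    by (intro has_sum_unique[OF cinner_has_sum]) (simp only: complex_norm_square)
qed

lemma norm_hardy_le:
  assumes "\<And>F. finite F \<Longrightarrow> (\<Sum>k\<in>F. (norm (hardy_coeff f k))\<^sup>2) \<le> C\<^sup>2" "C \<ge> 0"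
  shows "norm f \<le> C"
proof -
  have "(norm f)\<^sup>2 \<le> C\<^sup>2"
    using has_sum_le_finite_sums[OF norm_has_sum] assms(1) by blast
  then show ?thesis using assms(2) power2_le_imp_le by blast
qed

lemma sum_coeff_le_norm: "finite F \<Longrightarrow> (\<Sum>k\<in>F. (norm (hardy_coeff f k))\<^sup>2) \<le> (norm f)\<^sup>2"
  by (rule finite_sum_le_has_sum[OF norm_has_sum]) auto

lemma coeff_le_norm: "norm (hardy_coeff f k) \<le> norm f"
  by (rule power2_le_imp_le) (use sum_coeff_le_norm[of "{k}" f] in simp_all)

lemma norm_cscale: "norm (cscale c f) = norm c * norm f"
proof -
  have "(norm (cscale c f))\<^sup>2 = (norm c * norm f)\<^sup>2"
    using has_sum_cmult_right[OF norm_has_sum[of f], of "(norm c)\<^sup>2"]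
    by (intro has_sum_unique[OF norm_has_sum]) (simp add: hardy_coeff_cscale norm_mult power_mult_distrib)
  then show ?thesis by (simp add: power2_eq_iff_nonneg)
qed

lemma cinner_cauchy_schwarz: "norm (cinner f g) \<le> norm f * norm g"
proof (cases "cinner f g = 0")
  case False
  define c where "c = cnj (cinner f g) / complex_of_real (norm (cinner f g))"
  have [simp]: "norm c = 1" using False by (simp add: c_def norm_divide)
  have "cinner (cscale c f) g = (cnj (cinner f g) * cinner f g) / complex_of_real (norm (cinner f g))"
    by (simp add: c_def cinner_cscale_left)
  also have "cnj (cinner f g) * cinner f g = complex_of_real (norm (cinner f g)) * complex_of_real (norm (cinner f g))"
    using complex_norm_square[of "cinner f g"] by (simp add: power2_eq_square mult.commute)
  finally have "cinner (cscale c f) g = complex_of_real (norm (cinner f g))" using False by simp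
  then have "norm (cinner f g) = inner (cscale c f) g" by (simp add: inner_hardy_def)
  also have "\<dots> \<le> norm (cscale c f) * norm g" by (rule norm_cauchy_schwarz)
  finally show ?thesis by (simp add: norm_cscale)
qed auto

lemma scaleR_eq_cscale: "r *\<^sub>R f = cscale (complex_of_real r) f"
  by (rule scaleR_hardy_def)

instance hardy :: (finite) complete_space
proof
  fix X :: "nat \<Rightarrow> 'a hardy" assume X: "Cauchy X"
  have "Cauchy (\<lambda>n. hardy_coeff (X n) k)" for k
  proof (rule metric_CauchyI)
    fix e :: real assume "e > 0"
    with X obtain N where N: "\<And>m n. m \<ge> N \<Longrightarrow> n \<ge> N \<Longrightarrow> dist (X m) (X n) < e"
      by (meson Cauchy_def)
    have "dist (hardy_coeff (X m) k) (hardy_coeff (X n) k) \<le> dist (X m) (X n)" for m n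
      using coeff_le_norm[of "X m - X n" k] by (simp add: dist_norm hardy_coeff_diff)
    then show "\<exists>M. \<forall>m\<ge>M. \<forall>n\<ge>M. dist (hardy_coeff (X m) k) (hardy_coeff (X n) k) < e"
      using N by (meson le_less_trans)
  qed
  then have "\<forall>k. \<exists>l. (\<lambda>n. hardy_coeff (X n) k) \<longlonglongrightarrow> l"
    by (simp add: Cauchy_convergent_iff convergent_def)
  from choice[OF this] obtain a where a: "\<And>k. (\<lambda>n. hardy_coeff (X n) k) \<longlonglongrightarrow> a k"
    by blast
  have bound: "(\<Sum>k\<in>F. (norm (hardy_coeff (X m) k - a k))\<^sup>2) \<le> e\<^sup>2"
    if "\<And>n. n \<ge> N \<Longrightarrow> dist (X m) (X n) < e" "finite F" for m N e F
  proof (rule tendsto_upperbound)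
    show "(\<lambda>n. \<Sum>k\<in>F. (norm (hardy_coeff (X m) k - hardy_coeff (X n) k))\<^sup>2)
        \<longlonglongrightarrow> (\<Sum>k\<in>F. (norm (hardy_coeff (X m) k - a k))\<^sup>2)"
      by (intro tendsto_intros a)
    have "(\<Sum>k\<in>F. (norm (hardy_coeff (X m) k - hardy_coeff (X n) k))\<^sup>2) \<le> e\<^sup>2" if "n \<ge> N" for n
    proof -
      have "norm (X m - X n) \<le> e" using \<open>\<And>n. n \<ge> N \<Longrightarrow> dist (X m) (X n) < e\<close>[OF that] by (simp add: dist_norm)
      then have "(norm (X m - X n))\<^sup>2 \<le> e\<^sup>2" by (intro power_mono) auto
      with sum_coeff_le_norm[OF \<open>finite F\<close>, of "X m - X n"] show ?thesis by (simp add: hardy_coeff_diff)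
    qed
    then show "\<forall>\<^sub>F n in sequentially. (\<Sum>k\<in>F. (norm (hardy_coeff (X m) k - hardy_coeff (X n) k))\<^sup>2) \<le> e\<^sup>2"
      by (auto simp: eventually_sequentially)
  qed simp
  have sq: "square_summable a"
  proof -
    from X obtain N where N: "\<And>m n. m \<ge> N \<Longrightarrow> n \<ge> N \<Longrightarrow> dist (X m) (X n) < 1"
      by (meson Cauchy_def zero_less_one)
    have "square_summable (\<lambda>k. hardy_coeff (X N) k - a k)"
      by (rule square_summableI[where C = "1\<^sup>2"]) (use N bound[of N N 1] in auto)
    then have 1: "square_summable (\<lambda>k. - (hardy_coeff (X N) k - a k))"
      unfolding square_summable_def by (simp add: norm_minus_commute)
    show ?thesis
      using square_summable_add[of "hardy_coeff (X N)" "\<lambda>k. - (hardy_coeff (X N) k - a k)"] 1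
        square_summable_coeff[of "X N"] unfolding square_summable_def by simp
  qed
  have "X \<longlonglongrightarrow> hardy_of a"
  proof (rule metric_LIMSEQ_I)
    fix e :: real assume "e > 0"
    with X obtain N where N: "\<And>m n. m \<ge> N \<Longrightarrow> n \<ge> N \<Longrightarrow> dist (X m) (X n) < e / 2"
      by (meson Cauchy_def half_gt_zero)
    have "dist (X m) (hardy_of a) < e" if "m \<ge> N" for m
    proof -
      have "norm (X m - hardy_of a) \<le> e / 2"
        by (rule norm_hardy_le)
          (use N that bound[of N m "e/2"] \<open>e > 0\<close> in \<open>auto simp: hardy_coeff_diff hardy_coeff_hardy_of sq\<close>)
      then show ?thesis using \<open>e > 0\<close> by (simp add: dist_norm)
    qed
    then show "\<exists>no. \<forall>n\<ge>no. dist (X n) (hardy_of a) < e" by blast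
  qed
  then show "convergent X" by (auto simp: convergent_def)
qed

instance hardy :: (finite) banach ..

definition backward_shift :: "'n::finite \<Rightarrow> 'n hardy \<Rightarrow> 'n hardy" where
  "backward_shift i f = hardy_of (\<lambda>k. hardy_coeff f (k(i := Suc (k i))))"

lemma inj_Suc_upd: "inj (\<lambda>k :: 'n \<Rightarrow> nat. k(i := Suc (k i)))"
proof (rule injI, rule ext)
  fix k k' :: "'n \<Rightarrow> nat" and j assume eq: "k(i := Suc (k i)) = k'(i := Suc (k' i))"
  show "k j = k' j" using fun_cong[OF eq, of j] by (cases "j = i") auto
qed

lemma hardy_coeff_backward_shift:
  "hardy_coeff (backward_shift i f) = (\<lambda>k. hardy_coeff f (k(i := Suc (k i))))"
  unfolding backward_shift_def
proof (rule hardy_coeff_hardy_of)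
  have "(\<lambda>k. (norm (hardy_coeff f k))\<^sup>2) summable_on range (\<lambda>k. k(i := Suc (k i)))"
    using square_summable_coeff[of f] unfolding square_summable_def
    by (rule summable_on_subset_banach) auto
  then show "square_summable (\<lambda>k. hardy_coeff f (k(i := Suc (k i))))"
    by (simp add: summable_on_reindex[OF inj_Suc_upd] o_def square_summable_def)
qed

lemma hardy_coeff_Mz:
  "hardy_coeff (Mz i f) = (\<lambda>k. if k i = 0 then 0 else hardy_coeff f (k(i := k i - 1)))"
  by (rule hardy_coeff_eqI) (simp add: Mz.rep_eq taylor_mult_variable taylor_hardy)

lemma cinner_Mz: "cinner (Mz i f) g = cinner f (backward_shift i g)"
proof -
  have "((\<lambda>k. hardy_coeff f k * cnj (hardy_coeff g (k(i := Suc (k i))))) has_sum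
      cinner f (backward_shift i g)) UNIV"
    using cinner_has_sum[of f "backward_shift i g"] by (simp add: hardy_coeff_backward_shift)
  then have "((\<lambda>k. hardy_coeff (Mz i f) k * cnj (hardy_coeff g k)) has_sum
      cinner f (backward_shift i g)) (range (\<lambda>k. k(i := Suc (k i))))"
    by (subst has_sum_reindex[OF inj_Suc_upd]) (simp add: o_def hardy_coeff_Mz)
  then have "((\<lambda>k. hardy_coeff (Mz i f) k * cnj (hardy_coeff g k)) has_sum
      cinner f (backward_shift i g)) UNIV"
  proof (rule has_sum_cong_neutral[THEN iffD1, rotated -1])
    fix k assume "k \<in> UNIV - range (\<lambda>k. k(i := Suc (k i)))"
    moreover have "k = (\<lambda>k. k(i := Suc (k i))) (k(i := k i - 1))" if "k i \<noteq> 0"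
      using that by simp
    ultimately have "k i = 0" by blast
    then show "hardy_coeff (Mz i f) k * cnj (hardy_coeff g k) = 0" by (simp add: hardy_coeff_Mz)
  qed auto
  then show ?thesis by (rule has_sum_unique[OF cinner_has_sum])
qed

lemma cinner_backward_shift: "cinner (backward_shift i f) g = cinner f (Mz i g)"
  by (subst (1 2) cinner_commute) (simp add: cinner_Mz)

lemma adjoint_Mz: "adjoint (Mz i) = backward_shift i"
  by (rule adjoint_unique) (simp add: inner_hardy_def cinner_Mz)

lemma backward_shift_add: "backward_shift i (f + g) = backward_shift i f + backward_shift i g"
  by (rule hardy_eqI) (simp add: hardy_coeff_backward_shift hardy_coeff_add)

lemma backward_shift_cscale: "backward_shift i (cscale c f) = cscale c (backward_shift i f)"
  by (rule hardy_eqI) (simp add: hardy_coeff_backward_shift hardy_coeff_cscale)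

lemma backward_shift_commute:
  "backward_shift i (backward_shift j f) = backward_shift j (backward_shift i f)"
proof (cases "i = j")
  case False
  then show ?thesis
    by (intro hardy_eqI) (simp add: hardy_coeff_backward_shift fun_upd_twist)
qed simp

lemma norm_backward_shift_le: "norm (backward_shift i f) \<le> norm f"
proof (rule norm_hardy_le)
  fix F :: "('a \<Rightarrow> nat) set" assume "finite F"
  then have "(\<Sum>k\<in>(\<lambda>k. k(i := Suc (k i))) ` F. (norm (hardy_coeff f k))\<^sup>2) \<le> (norm f)\<^sup>2"
    by (intro sum_coeff_le_norm) auto
  then show "(\<Sum>k\<in>F. (norm (hardy_coeff (backward_shift i f) k))\<^sup>2) \<le> (norm f)\<^sup>2"
    by (subst (asm) sum.reindex) (auto simp: hardy_coeff_backward_shift intro: inj_on_subset[OF inj_Suc_upd])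
qed simp

lemma norm_Mz: "norm (Mz i f) = norm f"
proof -
  have "backward_shift i (Mz i f) = f"
    by (rule hardy_eqI) (simp add: hardy_coeff_backward_shift hardy_coeff_Mz)
  then have "cinner (Mz i f) (Mz i f) = cinner f f" by (simp add: cinner_Mz)
  then have "(norm (Mz i f))\<^sup>2 = (norm f)\<^sup>2" by (metis cinner_self of_real_eq_iff)
  then show ?thesis by (simp add: power2_eq_iff_nonneg)
qed

section \<open>Closed subspaces\<close>

definition bounded_clinear :: "('n::finite hardy \<Rightarrow> 'm::finite hardy) \<Rightarrow> bool" where
  "bounded_clinear T \<longleftrightarrow> bounded_linear T \<and> (\<forall>c x. T (cscale c x) = cscale c (T x))"

lemma bounded_clinearI:
  assumes "\<And>x y. T (x + y) = T x + T y" "\<And>c x. T (cscale c x) = cscale c (T x)"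
    and "\<And>x. norm (T x) \<le> norm x * K"
  shows "bounded_clinear T"
  unfolding bounded_clinear_def
  by (intro conjI allI bounded_linear_intro[where K = K]) (simp_all add: assms scaleR_eq_cscale)

lemma bounded_clinearD:
  assumes "bounded_clinear T"
  shows "bounded_linear T" "T (x + y) = T x + T y" "T (cscale c x) = cscale c (T x)"
    "T (x - y) = T x - T y" "T 0 = 0" "T (\<Sum>i\<in>I. f i) = (\<Sum>i\<in>I. T (f i))"
proof -
  show T: "bounded_linear T" using assms by (simp add: bounded_clinear_def)
  interpret bounded_linear T by (rule T)
  show "T (x + y) = T x + T y" "T (x - y) = T x - T y" "T 0 = 0" "T (\<Sum>i\<in>I. f i) = (\<Sum>i\<in>I. T (f i))"
    by (simp_all add: add diff sum)
  show "T (cscale c x) = cscale c (T x)" using assms by (simp add: bounded_clinear_def)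
qed

lemma bounded_clinear_cscale: "bounded_clinear (cscale c)"
  by (rule bounded_clinearI[where K = "norm c"])
    (simp_all add: hardy.scale_right_distrib mult.commute norm_cscale)

lemma bounded_clinear_backward_shift: "bounded_clinear (backward_shift i)"
  by (rule bounded_clinearI[where K = 1])
    (simp_all add: backward_shift_add backward_shift_cscale norm_backward_shift_le)

lemma Mz_add: "Mz i (f + g) = Mz i f + Mz i g"
  by (rule hardy_eqI) (simp add: hardy_coeff_Mz hardy_coeff_add)

lemma Mz_cscale: "Mz i (cscale c f) = cscale c (Mz i f)"
  by (rule hardy_eqI) (simp add: hardy_coeff_Mz hardy_coeff_cscale)

definition closed_subspace :: "'n::finite hardy set \<Rightarrow> bool" where
  "closed_subspace V \<longleftrightarrow> hardy.subspace V \<and> closed V"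

lemma closed_subspaceD:
  assumes "closed_subspace V"
  shows "closed V" "0 \<in> V" "x \<in> V \<Longrightarrow> y \<in> V \<Longrightarrow> x + y \<in> V" "x \<in> V \<Longrightarrow> cscale c x \<in> V"
    "x \<in> V \<Longrightarrow> y \<in> V \<Longrightarrow> x - y \<in> V" "(\<And>i. i \<in> I \<Longrightarrow> f i \<in> V) \<Longrightarrow> sum f I \<in> V"
  using assms unfolding closed_subspace_def
  by (auto intro: hardy.subspace_0 hardy.subspace_add hardy.subspace_scale hardy.subspace_diff
      hardy.subspace_sum)

lemma closed_subspaceI:
  assumes "closed V" "0 \<in> V" "\<And>x y. x \<in> V \<Longrightarrow> y \<in> V \<Longrightarrow> x + y \<in> V"
    "\<And>c x. x \<in> V \<Longrightarrow> cscale c x \<in> V"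
  shows "closed_subspace V"
  unfolding closed_subspace_def by (intro conjI hardy.subspaceI assms)

lemma closed_subspace_vimage:
  assumes "bounded_clinear T" "closed_subspace V"
  shows "closed_subspace (T -` V)"
proof (rule closed_subspaceI)
  show "closed (T -` V)"
    using assms bounded_clinearD(1) closed_subspaceD(1)
    by (intro closed_vimage) (auto intro: linear_continuous_on)
qed (use assms in \<open>auto simp: bounded_clinearD closed_subspaceD\<close>)

lemma closed_subspace_Int:
  "closed_subspace V \<Longrightarrow> closed_subspace W \<Longrightarrow> closed_subspace (V \<inter> W)"
  by (auto intro!: closed_subspaceI simp: closed_subspaceD)

lemma closed_subspace_orthogonal: "closed_subspace {f. cinner f g = 0}"
proof (rule closed_subspaceI)
  have "continuous_on UNIV (\<lambda>f. cinner f g)"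
  proof (rule linear_continuous_on, rule bounded_linear_intro[where K = "norm g"])
    show "cinner (r *\<^sub>R x) g = r *\<^sub>R cinner x g" for r x
      by (simp add: scaleR_eq_cscale cinner_cscale_left scaleR_conv_of_real)
  qed (simp_all add: cinner_add_left cinner_cauchy_schwarz)
  then show "closed {f. cinner f g = 0}"
    by (intro closed_Collect_eq) auto
qed (simp_all add: cinner_add_left cinner_cscale_left)

lemma closed_subspace_closed_span: "closed_subspace (closed_span X)"
proof (rule closed_subspaceI)
  have sub: "hardy.subspace (hardy.span X)" by (rule hardy.subspace_span)
  show "closed (closed_span X)" unfolding closed_span_def by (rule closed_closure)
  show "0 \<in> closed_span X"
    unfolding closed_span_def using closure_subset hardy.span_zero by blast
  show "x + y \<in> closed_span X" if "x \<in> closed_span X" "y \<in> closed_span X" for x y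
  proof -
    from that obtain s t where "\<forall>n. s n \<in> hardy.span X" "s \<longlonglongrightarrow> x" "\<forall>n. t n \<in> hardy.span X" "t \<longlonglongrightarrow> y"
      unfolding closed_span_def closure_sequential by blast
    then have "\<forall>n. s n + t n \<in> hardy.span X" "(\<lambda>n. s n + t n) \<longlonglongrightarrow> x + y"
      by (auto intro: hardy.span_add tendsto_add)
    then show ?thesis unfolding closed_span_def closure_sequential by (intro exI conjI)
  qed
  show "cscale c x \<in> closed_span X" if "x \<in> closed_span X" for c x
  proof -
    from that obtain s where "\<forall>n. s n \<in> hardy.span X" "s \<longlonglongrightarrow> x"
      unfolding closed_span_def closure_sequential by blast
    then have "\<forall>n. cscale c (s n) \<in> hardy.span X" "(\<lambda>n. cscale c (s n)) \<longlonglongrightarrow> cscale c x"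
      using bounded_linear.tendsto[OF bounded_clinearD(1)[OF bounded_clinear_cscale]]
      by (auto intro: hardy.span_scale)
    then show ?thesis unfolding closed_span_def closure_sequential by (intro exI conjI)
  qed
qed

lemma closed_span_superset: "X \<subseteq> closed_span X"
  unfolding closed_span_def using closure_subset hardy.span_superset by blast

lemma closed_span_minimal:
  assumes "X \<subseteq> V" "closed_subspace V"
  shows "closed_span X \<subseteq> V"
  unfolding closed_span_def
  using assms hardy.span_minimal[of X V] by (intro closure_minimal) (auto simp: closed_subspace_def)

lemma closed_span_eqI:
  assumes "X \<subseteq> closed_span Y" "Y \<subseteq> closed_span X"
  shows "closed_span X = closed_span Y"
  by (intro equalityI closed_span_minimal closed_subspace_closed_span assms)

lemma closed_span_UN_closed_span: "closed_span (\<Union>k\<in>K. closed_span (X k)) = closed_span (\<Union>k\<in>K. X k)"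
proof (rule closed_span_eqI)
  have "closed_span (X k) \<subseteq> closed_span (\<Union>k\<in>K. X k)" if "k \<in> K" for k
    using that closed_span_superset by (intro closed_span_minimal closed_subspace_closed_span) blast
  then show "(\<Union>k\<in>K. closed_span (X k)) \<subseteq> closed_span (\<Union>k\<in>K. X k)" by blast
  have "X k \<subseteq> closed_span (\<Union>k\<in>K. closed_span (X k))" if "k \<in> K" for k
    using that closed_span_superset[of "X k"] closed_span_superset[of "\<Union>k\<in>K. closed_span (X k)"] by blast
  then show "(\<Union>k\<in>K. X k) \<subseteq> closed_span (\<Union>k\<in>K. closed_span (X k))" by blast
qed

lemma closed_span_image_subset:
  assumes "bounded_clinear T" "closed_subspace V" "\<And>x. x \<in> X \<Longrightarrow> T x \<in> V" "x \<in> closed_span X"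
  shows "T x \<in> V"
  using closed_span_minimal[OF _ closed_subspace_vimage[OF assms(1,2)], of X] assms(3,4) by auto

lemma ex_nearest_point:
  assumes V: "closed_subspace V"
  shows "\<exists>v\<in>V. \<forall>w\<in>V. norm (f - v) \<le> norm (f - w)"
proof -
  define D where "D = infdist f V"
  have ne: "V \<noteq> {}" using closed_subspaceD(2)[OF V] by auto
  have D: "D \<le> norm (f - w)" if "w \<in> V" for w
    unfolding D_def using that by (metis dist_norm infdist_le)
  have "D \<ge> 0" by (simp add: D_def infdist_nonneg)
  have "\<exists>v\<in>V. norm (f - v) < D + 1 / (real n + 1)" for n
  proof (rule ccontr)
    assume "\<not> ?thesis"
    then have "D + 1 / (real n + 1) \<le> infdist f V"
      using ne unfolding infdist_def by (auto intro!: cINF_greatest simp: dist_norm not_less)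
    moreover have "1 / (real n + 1) > 0" by simp
    ultimately show False by (simp add: D_def)
  qed
  then obtain v where v: "\<And>n. v n \<in> V" "\<And>n. norm (f - v n) < D + 1 / (real n + 1)" by metis
  have lim0: "(\<lambda>n. D + 1 / (real n + 1)) \<longlonglongrightarrow> D"
    using tendsto_add[OF tendsto_const LIMSEQ_inverse_real_of_nat, of D]
    by (simp add: inverse_eq_divide add.commute)
  have lim: "(\<lambda>n. norm (f - v n)) \<longlonglongrightarrow> D"
    by (rule tendsto_sandwich[OF _ _ tendsto_const lim0]) (use v D in \<open>auto intro!: always_eventually simp: less_imp_le\<close>)
  define b where "b n = 2 * (norm (f - v n))\<^sup>2 - 2 * D\<^sup>2" for n
  have "b \<longlonglongrightarrow> 2 * D\<^sup>2 - 2 * D\<^sup>2"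
    unfolding b_def by (intro tendsto_intros lim)
  then have b: "b \<longlonglongrightarrow> 0" by simp
  have par: "(norm (v m - v n))\<^sup>2 \<le> b m + b n" for m n
  proof -
    have "v m + v n \<in> V" using v V by (simp add: closed_subspaceD)
    then have "(1/2) *\<^sub>R (v m + v n) \<in> V" using V by (simp add: closed_subspaceD scaleR_eq_cscale)
    then have "D\<^sup>2 \<le> (norm (f - (1/2) *\<^sub>R (v m + v n)))\<^sup>2"
      using D \<open>D \<ge> 0\<close> by (intro power_mono) auto
    moreover have "(norm (v m - v n))\<^sup>2 = 2 * (norm (f - v m))\<^sup>2 + 2 * (norm (f - v n))\<^sup>2
        - 4 * (norm (f - (1/2) *\<^sub>R (v m + v n)))\<^sup>2"
      by (simp add: power2_norm_eq_inner inner_simps inner_commute algebra_simps)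
    ultimately show ?thesis by (simp add: b_def)
  qed
  have "Cauchy v"
  proof (rule metric_CauchyI)
    fix e :: real assume "e > 0"
    then have "\<forall>\<^sub>F n in sequentially. b n < e\<^sup>2 / 2"
      using b by (intro order_tendstoD(2)) auto
    then obtain N where N: "\<And>n. n \<ge> N \<Longrightarrow> b n < e\<^sup>2 / 2" by (auto simp: eventually_sequentially)
    have "dist (v m) (v n) < e" if "m \<ge> N" "n \<ge> N" for m n
    proof -
      have "(norm (v m - v n))\<^sup>2 < e\<^sup>2" using par[of m n] N[OF that(1)] N[OF that(2)] by linarith
      then show ?thesis using \<open>e > 0\<close> by (simp add: dist_norm power2_less_imp_less)
    qed
    then show "\<exists>M. \<forall>m\<ge>M. \<forall>n\<ge>M. dist (v m) (v n) < e" by blast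
  qed
  then obtain u where u: "v \<longlonglongrightarrow> u" using Cauchy_convergent_iff convergent_def by blast
  have "u \<in> V" using closed_sequentially[OF closed_subspaceD(1)[OF V]] v u by blast
  moreover have "(\<lambda>n. norm (f - v n)) \<longlonglongrightarrow> norm (f - u)" by (intro tendsto_intros u)
  then have "norm (f - u) = D" using lim LIMSEQ_unique by blast
  ultimately show ?thesis using D by blast
qed

lemma orthogonal_projection:
  assumes V: "closed_subspace V"
  shows "\<exists>v\<in>V. \<forall>w\<in>V. cinner (f - v) w = 0"
proof -
  obtain v where v: "v \<in> V" "\<And>w. w \<in> V \<Longrightarrow> norm (f - v) \<le> norm (f - w)"
    using ex_nearest_point[OF V] by blast
  have re: "inner (f - v) w = 0" if "w \<in> V" for w
  proof (cases "w = 0")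
    case False
    define t where "t = inner (f - v) w / (norm w)\<^sup>2"
    have "v + t *\<^sub>R w \<in> V" using v V that by (simp add: closed_subspaceD scaleR_eq_cscale)
    then have "(norm (f - v))\<^sup>2 \<le> (norm (f - (v + t *\<^sub>R w)))\<^sup>2" using v by (intro power_mono) auto
    also have "f - (v + t *\<^sub>R w) = (f - v) - t *\<^sub>R w" by simp
    also have "(norm \<dots>)\<^sup>2 = (norm (f - v))\<^sup>2 - 2 * t * inner (f - v) w + t\<^sup>2 * (norm w)\<^sup>2"
      using dot_norm_neg[of "f - v" "t *\<^sub>R w"] by (simp add: power_mult_distrib field_simps)
    also have "t\<^sup>2 * (norm w)\<^sup>2 = t * inner (f - v) w"
      using False by (simp add: t_def power2_eq_square)
    finally have "t * inner (f - v) w \<le> 0" by simp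
    then have "(inner (f - v) w)\<^sup>2 / (norm w)\<^sup>2 \<le> 0" by (simp add: t_def power2_eq_square)
    then show ?thesis using False by (simp add: divide_le_0_iff)
  qed simp
  have "cinner (f - v) w = 0" if "w \<in> V" for w
  proof (rule complex_eqI)
    show "Re (cinner (f - v) w) = Re 0" using re[OF that] by (simp add: inner_hardy_def)
    have "inner (f - v) (cscale \<i> w) = 0" using re V that by (simp add: closed_subspaceD)
    then show "Im (cinner (f - v) w) = Im 0" by (simp add: inner_hardy_def cinner_cscale_right)
  qed
  with v show ?thesis by blast
qed

lemma closed_subspace_dense:
  assumes "closed_subspace V" "closed_subspace W" "V \<subseteq> W"
    and "\<And>f. f \<in> W \<Longrightarrow> (\<And>v. v \<in> V \<Longrightarrow> cinner f v = 0) \<Longrightarrow> f = 0"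
  shows "W = V"
proof (intro equalityI assms(3) subsetI)
  fix f assume f: "f \<in> W"
  obtain v where v: "v \<in> V" "\<And>w. w \<in> V \<Longrightarrow> cinner (f - v) w = 0"
    using orthogonal_projection[OF assms(1)] by blast
  have "f - v \<in> W" using f v assms by (auto intro: closed_subspaceD)
  with assms(4) v have "f - v = 0" by blast
  with v show "f \<in> V" by simp
qed

section \<open>Elementary tensors\<close>

definition disc_coeff :: "hardy_disc \<Rightarrow> nat \<Rightarrow> complex" where
  "disc_coeff f n = hardy_coeff f (\<lambda>_. n)"

definition disc_fun :: "hardy_disc \<Rightarrow> complex \<Rightarrow> complex" where
  "disc_fun f z = hardy_fun f (vec z)"

lemma bij_const_num1: "bij (\<lambda>n::nat. (\<lambda>_::1. n))"
proof (rule bijI)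
  show "inj (\<lambda>n::nat. (\<lambda>_::1. n))" by (rule injI) (metis)
  have "k = (\<lambda>_. k 1)" for k :: "1 \<Rightarrow> nat" by (rule ext) (metis num1_eq1)
  then show "surj (\<lambda>n::nat. (\<lambda>_::1. n))"
    by (intro surjI[of "\<lambda>n _. n" "\<lambda>k. k 1"]) (rule sym)
qed

lemma has_sum_num1: "(f has_sum s) UNIV \<longleftrightarrow> ((\<lambda>n. f (\<lambda>_::1. n::nat)) has_sum s) UNIV"
  using has_sum_reindex_bij_betw[OF bij_const_num1, of f s] by simp

lemma square_summable_num1: "square_summable a \<longleftrightarrow> square_summable (\<lambda>n. a (\<lambda>_::1. n::nat))"
  using summable_on_reindex_bij_betw[OF bij_const_num1, of "\<lambda>k. (norm (a k))\<^sup>2"]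
  by (simp add: square_summable_def)

lemma hardy_coeff_disc: "hardy_coeff f k = disc_coeff f (k 1)"
proof -
  have "k = (\<lambda>_. k 1)" by (rule ext) (metis num1_eq1)
  from arg_cong[OF this, of "hardy_coeff f"] show ?thesis unfolding disc_coeff_def .
qed

lemma disc_eqI: "(\<And>n. disc_coeff f n = disc_coeff g n) \<Longrightarrow> f = g"
  by (rule hardy_eqI) (simp add: hardy_coeff_disc)

lemma vec_mem_polydisc: "norm z < 1 \<Longrightarrow> vec z \<in> polydisc"
  by (simp add: polydisc_def)

lemma square_summable_disc_coeff: "square_summable (disc_coeff f)"
  using square_summable_coeff[of f] unfolding square_summable_num1 disc_coeff_def .

lemma ex_disc_coeff:
  assumes "square_summable a"
  shows "\<exists>f. disc_coeff f = a"
proof -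
  have "square_summable (\<lambda>k::1 \<Rightarrow> nat. a (k 1))" using assms by (simp add: square_summable_num1)
  then obtain f where "hardy_coeff f = (\<lambda>k::1 \<Rightarrow> nat. a (k 1))" using ex_hardy_coeff by blast
  then have "disc_coeff f = a" by (auto simp: disc_coeff_def)
  then show ?thesis by blast
qed

lemma disc_fun_has_sum:
  assumes "norm z < 1"
  shows "((\<lambda>n. disc_coeff f n * z ^ n) has_sum disc_fun f z) UNIV"
  using hardy_fun_has_sum[OF vec_mem_polydisc[OF assms], of f] unfolding has_sum_num1
  by (simp add: disc_coeff_def disc_fun_def monomial_def)

lemma disc_cinner_has_sum: "((\<lambda>n. disc_coeff f n * cnj (disc_coeff g n)) has_sum cinner f g) UNIV"
  using cinner_has_sum[of f g] unfolding has_sum_num1 by (simp add: disc_coeff_def)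

lemma square_summable_cnj: "square_summable a \<Longrightarrow> square_summable (\<lambda>k. cnj (a k))"
  by (simp add: square_summable_def)

definition tensor :: "('n::finite \<Rightarrow> hardy_disc) \<Rightarrow> 'n hardy" where
  "tensor f = hardy_of (\<lambda>k. \<Prod>i\<in>UNIV. disc_coeff (f i) (k i))"

lemma hardy_coeff_tensor: "hardy_coeff (tensor f) k = (\<Prod>i\<in>UNIV. disc_coeff (f i) (k i))"
  unfolding tensor_def
  by (subst hardy_coeff_hardy_of) (rule square_summable_prod square_summable_disc_coeff refl)+

lemma hardy_fun_tensor:
  assumes z: "z \<in> polydisc"
  shows "hardy_fun (tensor f) z = (\<Prod>i\<in>UNIV. disc_fun (f i) (z $ i))"
proof -
  have zi: "norm (z $ i) < 1" for i using z by (simp add: polydisc_def)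
  have "(\<lambda>n. norm (disc_coeff (f i) n * (z $ i) ^ n)) summable_on UNIV" for i
    by (rule square_summable_product[OF square_summable_disc_coeff square_summable_power[OF zi]])
  note abs_summable_prod(2)[of "\<lambda>i n. disc_coeff (f i) n * (z $ i) ^ n", OF this]
  moreover have "(\<Sum>\<^sub>\<infinity>n. disc_coeff (f i) n * (z $ i) ^ n) = disc_fun (f i) (z $ i)" for i
    by (rule infsumI[OF disc_fun_has_sum[OF zi]])
  moreover have "(\<Sum>\<^sub>\<infinity>k. \<Prod>i\<in>UNIV. disc_coeff (f i) (k i) * (z $ i) ^ k i) = hardy_fun (tensor f) z"
    using infsumI[OF hardy_fun_has_sum[OF z, of "tensor f"]]
    by (simp add: hardy_coeff_tensor monomial_def prod.distrib)
  ultimately show ?thesis by simp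
qed

lemma cinner_tensor: "cinner (tensor f) (tensor g) = (\<Prod>i\<in>UNIV. cinner (f i) (g i))"
proof -
  have "(\<lambda>n. norm (disc_coeff (f i) n * cnj (disc_coeff (g i) n))) summable_on UNIV" for i
    by (rule square_summable_product[OF square_summable_disc_coeff
          square_summable_cnj[OF square_summable_disc_coeff]])
  note abs_summable_prod(2)[of "\<lambda>i n. disc_coeff (f i) n * cnj (disc_coeff (g i) n)", OF this]
  moreover have "(\<Sum>\<^sub>\<infinity>n. disc_coeff (f i) n * cnj (disc_coeff (g i) n)) = cinner (f i) (g i)" for i
    by (rule infsumI[OF disc_cinner_has_sum])
  moreover have "(\<Sum>\<^sub>\<infinity>k. \<Prod>i\<in>UNIV. disc_coeff (f i) (k i) * cnj (disc_coeff (g i) (k i))) =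
      cinner (tensor f) (tensor g)"
    using infsumI[OF cinner_has_sum[of "tensor f" "tensor g"]]
    by (simp add: hardy_coeff_tensor prod.distrib)
  ultimately show ?thesis by simp
qed

lemma prod_upd: "(\<Prod>j\<in>UNIV. h j ((f(i := x)) j)) = h i x * (\<Prod>j\<in>UNIV - {i}. h j (f j))"
  for i :: "'n::finite" and h :: "'n \<Rightarrow> 'a \<Rightarrow> 'b::comm_monoid_mult"
  by (subst prod.remove[of _ i]) (auto intro!: arg_cong2[of _ _ _ _ "(*)"] prod.cong)

lemma hardy_coeff_tensor_upd:
  "hardy_coeff (tensor (f(i := x))) k = disc_coeff x (k i) * (\<Prod>j\<in>UNIV - {i}. disc_coeff (f j) (k j))"
  unfolding hardy_coeff_tensor by (rule prod_upd[of "\<lambda>j x. disc_coeff x (k j)"])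

lemma norm_tensor_upd:
  "(norm (tensor (f(i := x))))\<^sup>2 = (norm x)\<^sup>2 * (\<Prod>j\<in>UNIV - {i}. (norm (f j))\<^sup>2)"
proof -
  have "complex_of_real ((norm (tensor f))\<^sup>2) = complex_of_real (\<Prod>j\<in>UNIV. (norm (f j))\<^sup>2)" for f :: "'a \<Rightarrow> _"
    unfolding cinner_self[symmetric] cinner_tensor by (simp add: cinner_self)
  then have "(norm (tensor f))\<^sup>2 = (\<Prod>j\<in>UNIV. (norm (f j))\<^sup>2)" for f :: "'a \<Rightarrow> _"
    using of_real_eq_iff by blast
  then show ?thesis by (simp only: prod_upd[of "\<lambda>j x. (norm x)\<^sup>2"])
qed

lemma bounded_clinear_tensor_upd: "bounded_clinear (\<lambda>x. tensor (f(i := x)))"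
proof (rule bounded_clinearI[where K = "sqrt (\<Prod>j\<in>UNIV - {i}. (norm (f j))\<^sup>2)"])
  show "tensor (f(i := x + y)) = tensor (f(i := x)) + tensor (f(i := y))" for x y
    by (rule hardy_eqI) (simp only: hardy_coeff_tensor_upd hardy_coeff_add disc_coeff_def distrib_right)
  show "tensor (f(i := cscale c x)) = cscale c (tensor (f(i := x)))" for c x
    by (rule hardy_eqI) (simp only: hardy_coeff_tensor_upd hardy_coeff_cscale disc_coeff_def mult.assoc)
  show "norm (tensor (f(i := x))) \<le> norm x * sqrt (\<Prod>j\<in>UNIV - {i}. (norm (f j))\<^sup>2)" for x
    by (rule power2_le_imp_le)
      (simp_all add: norm_tensor_upd power_mult_distrib prod_nonneg mult_nonneg_nonneg)
qed

lemma hardy_tensor_eq: "hardy_tensor Q = closed_span {tensor f | f. \<forall>i. f i \<in> Q i}"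
proof -
  have "(\<forall>z\<in>polydisc. hardy_fun F z = (\<Prod>i\<in>UNIV. hardy_fun (f i) (vec (z $ i)))) \<longleftrightarrow> F = tensor f" for F f
    using hardy_fun_eqI[of F "tensor f"] hardy_fun_tensor by (auto simp: disc_fun_def)
  then show ?thesis unfolding hardy_tensor_def by (intro arg_cong[of _ _ closed_span]) auto
qed

lemma tensor_mem_closed_subspace:
  assumes V: "closed_subspace V" and X: "\<And>f. (\<And>i. f i \<in> X i) \<Longrightarrow> tensor f \<in> V"
    and f: "\<And>i. f i \<in> closed_span (X i)"
  shows "tensor f \<in> V"
proof -
  have "finite J \<Longrightarrow> (\<And>i. i \<in> J \<Longrightarrow> g i \<in> closed_span (X i)) \<Longrightarrow> (\<And>i. i \<notin> J \<Longrightarrow> g i \<in> X i) \<Longrightarrow>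
      tensor g \<in> V" for g J
  proof (induction J arbitrary: g rule: finite_induct)
    case empty
    then show ?case using X by auto
  next
    case (insert j J)
    have "tensor (g(j := x)) \<in> V" if "x \<in> X j" for x
      using that insert.prems insert.hyps by (intro insert.IH) auto
    then have "tensor (g(j := g j)) \<in> V"
      using closed_span_image_subset[OF bounded_clinear_tensor_upd V] insert.prems by blast
    then show ?case by simp
  qed
  from this[of UNIV f] f show ?thesis by simp
qed

lemma hardy_tensor_closed_span:
  "hardy_tensor (\<lambda>i. closed_span (X i)) = closed_span {tensor f | f. \<forall>i. f i \<in> X i}"
  unfolding hardy_tensor_eq
proof (rule closed_span_eqI)
  show "{tensor f |f. \<forall>i. f i \<in> closed_span (X i)} \<subseteq> closed_span {tensor f |f. \<forall>i. f i \<in> X i}"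
  proof safe
    fix f assume f: "\<forall>i. f i \<in> closed_span (X i)"
    show "tensor f \<in> closed_span {tensor f |f. \<forall>i. f i \<in> X i}"
      by (rule tensor_mem_closed_subspace[of _ X])
        (use f closed_subspace_closed_span closed_span_superset[of "{tensor f |f. \<forall>i. f i \<in> X i}"] in blast)+
  qed
  have "{tensor f |f. \<forall>i. f i \<in> X i} \<subseteq> {tensor f |f. \<forall>i. f i \<in> closed_span (X i)}"
    using closed_span_superset by blast
  also have "\<dots> \<subseteq> closed_span \<dots>" by (rule closed_span_superset)
  finally show "{tensor f |f. \<forall>i. f i \<in> X i} \<subseteq> closed_span {tensor f |f. \<forall>i. f i \<in> closed_span (X i)}" .
qed

section \<open>Kernel functions and division in the disc\<close>

lemma bounded_clinear_Mz: "bounded_clinear (Mz i)"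
  by (rule bounded_clinearI[where K = 1]) (simp_all add: Mz_add Mz_cscale norm_Mz)

lemma ex_neumann:
  fixes x :: "'n::finite hardy"
  assumes T: "bounded_clinear T" "\<And>x. norm (T x) \<le> norm x" and a: "norm a < 1"
  shows "\<exists>y. y = x + cscale a (T y)"
proof -
  define S where "S = (\<lambda>x. cscale a (T x))"
  have S: "bounded_linear S"
    unfolding S_def
    by (rule bounded_linear_compose[OF bounded_clinearD(1)[OF bounded_clinear_cscale]
          bounded_clinearD(1)[OF T(1)]])
  have "norm ((S ^^ n) x) \<le> norm x * norm a ^ n" for n
  proof (induction n)
    case (Suc n)
    have "norm ((S ^^ Suc n) x) = norm a * norm (T ((S ^^ n) x))" by (simp add: S_def norm_cscale)
    also have "\<dots> \<le> norm a * (norm x * norm a ^ n)"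
      by (intro mult_left_mono order_trans[OF T(2) Suc.IH]) auto
    finally show ?case by (simp add: mult_ac)
  qed simp
  moreover have "summable (\<lambda>n. norm x * norm a ^ n)"
    using a by (intro summable_mult summable_geometric) simp
  ultimately have sm: "summable (\<lambda>n. (S ^^ n) x)"
    by (rule summable_comparison_test'[where N = 0, rotated])
  define y where "y = suminf (\<lambda>n. (S ^^ n) x)"
  have "S y = suminf (\<lambda>n. (S ^^ Suc n) x)"
    unfolding y_def using bounded_linear.suminf[OF S sm] by simp
  then have "y = x + S y"
    unfolding y_def using suminf_split_head[OF sm] by (simp add: algebra_simps)
  then show ?thesis unfolding S_def by blast
qed

text \<open>\<open>szego a j\<close> is the function \<open>z\<^sup>j / (1 - cnj a * z)\<^sup>j\<^sup>+\<^sup>1\<close>, which represents \<open>f \<mapsto> f\<^sup>(\<^sup>j\<^sup>)(a) / j!\<close>.\<close>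

primrec szego :: "complex \<Rightarrow> nat \<Rightarrow> hardy_disc" where
  "szego a 0 = (SOME k. disc_coeff k = (\<lambda>n. cnj a ^ n))"
| "szego a (Suc j) = Mz 1 (SOME y. y = szego a j + cscale (cnj a) (Mz 1 y))"

lemma disc_coeff_szego_0: "norm a < 1 \<Longrightarrow> disc_coeff (szego a 0) = (\<lambda>n. cnj a ^ n)"
  unfolding szego.simps by (rule someI_ex) (simp add: ex_disc_coeff square_summable_power)

lemma disc_coeff_backward_shift: "disc_coeff (backward_shift 1 f) n = disc_coeff f (Suc n)"
  unfolding disc_coeff_def hardy_coeff_backward_shift
  by (rule arg_cong[of _ _ "hardy_coeff f"]) (auto simp: fun_eq_iff)

lemma disc_coeff_Mz: "disc_coeff (Mz 1 f) n = (if n = 0 then 0 else disc_coeff f (n - 1))"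
  by (simp add: hardy_coeff_Mz hardy_coeff_disc disc_coeff_def[of "Mz 1 f"])

lemma disc_coeff_simps:
  "disc_coeff (f + g) n = disc_coeff f n + disc_coeff g n"
  "disc_coeff (f - g) n = disc_coeff f n - disc_coeff g n"
  "disc_coeff (cscale c f) n = c * disc_coeff f n"
  by (simp_all add: disc_coeff_def hardy_coeff_add hardy_coeff_diff hardy_coeff_cscale)

lemma disc_fun_simps:
  "disc_fun (f + g) z = disc_fun f z + disc_fun g z"
  "disc_fun (f - g) z = disc_fun f z - disc_fun g z"
  "disc_fun (cscale c f) z = c * disc_fun f z"
  "disc_fun (Mz 1 f) z = z * disc_fun f z"
proof -
  show 1: "disc_fun (f + g) z = disc_fun f z + disc_fun g z" for f g
    by (simp add: disc_fun_def plus_hardy.rep_eq)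
  show 2: "disc_fun (cscale c f) z = c * disc_fun f z" for f c
    by (simp add: disc_fun_def cscale.rep_eq)
  have "disc_fun ((f - g) + g) z = disc_fun (f - g) z + disc_fun g z" by (rule 1)
  then show "disc_fun (f - g) z = disc_fun f z - disc_fun g z" by simp
  show "disc_fun (Mz 1 f) z = z * disc_fun f z"
    by (simp add: disc_fun_def Mz.rep_eq)
qed

lemma cinner_szego_0:
  assumes "norm a < 1"
  shows "cinner f (szego a 0) = disc_fun f a"
  using disc_cinner_has_sum[of f "szego a 0"]
  by (rule has_sum_unique)
    (use disc_fun_has_sum[OF assms, of f] in \<open>simp add: disc_coeff_szego_0[OF assms] del: szego.simps\<close>)

lemma backward_shift_szego_0:
  "norm a < 1 \<Longrightarrow> backward_shift 1 (szego a 0) = cscale (cnj a) (szego a 0)"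
  by (rule disc_eqI) (simp add: disc_coeff_backward_shift disc_coeff_simps disc_coeff_szego_0 del: szego.simps)

lemma backward_shift_Mz: "backward_shift i (Mz i f) = f"
  by (rule hardy_eqI) (simp add: hardy_coeff_backward_shift hardy_coeff_Mz)

lemma backward_shift_szego_Suc:
  assumes "norm a < 1"
  shows "backward_shift 1 (szego a (Suc j)) = cscale (cnj a) (szego a (Suc j)) + szego a j"
proof -
  define y where "y = (SOME y. y = szego a j + cscale (cnj a) (Mz 1 y))"
  have "y = szego a j + cscale (cnj a) (Mz 1 y)"
    unfolding y_def by (rule someI_ex, rule ex_neumann) (use assms in \<open>simp_all add: bounded_clinear_Mz norm_Mz\<close>)
  moreover have "szego a (Suc j) = Mz 1 y" by (simp add: y_def)
  ultimately show ?thesis by (metis add.commute backward_shift_Mz)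
qed

lemmas [simp del] = szego.simps

definition mult_sub :: "complex \<Rightarrow> hardy_disc \<Rightarrow> hardy_disc" where
  "mult_sub a f = Mz 1 f - cscale a f"

lemma disc_fun_mult_sub: "disc_fun (mult_sub a f) z = (z - a) * disc_fun f z"
  by (simp add: mult_sub_def disc_fun_simps algebra_simps)

lemma cinner_mult_sub_szego:
  assumes "norm b < 1"
  shows "cinner (mult_sub a f) (szego b 0) = (b - a) * cinner f (szego b 0)"
    and "cinner (mult_sub a f) (szego b (Suc j)) =
      (b - a) * cinner f (szego b (Suc j)) + cinner f (szego b j)"
  using assms by (simp_all add: mult_sub_def cinner_diff_left cinner_Mz cinner_cscale_left
      backward_shift_szego_0 backward_shift_szego_Suc cinner_add_right cinner_cscale_right algebra_simps)

lemma cinner_mult_sub_funpow_szego: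
  assumes "norm a < 1"
  shows "cinner ((mult_sub a ^^ l) f) (szego a j) = (if j < l then 0 else cinner f (szego a (j - l)))"
proof (induction l arbitrary: j)
  case (Suc l)
  show ?case using Suc by (cases j) (simp_all add: cinner_mult_sub_szego[OF assms])
qed simp

lemma mult_sub_dvd:
  assumes a: "norm a < 1" and z: "disc_fun f a = 0"
  shows "\<exists>u. f = mult_sub a u"
proof -
  obtain u where u: "u = backward_shift 1 f + cscale a (backward_shift 1 u)"
    using ex_neumann[OF bounded_clinear_backward_shift norm_backward_shift_le a] by blast
  define d where "d = f - mult_sub a u"
  have d: "disc_coeff d n = 0" if "n \<noteq> 0" for n
  proof -
    from that obtain m where n: "n = Suc m" by (cases n) auto
    have "disc_coeff u m = disc_coeff f n + a * disc_coeff u n"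
      using arg_cong[OF u, of "\<lambda>f. disc_coeff f m"] by (simp add: disc_coeff_simps disc_coeff_backward_shift n)
    then show ?thesis by (simp add: d_def mult_sub_def disc_coeff_simps disc_coeff_Mz n)
  qed
  have "((\<lambda>n. disc_coeff d n * a ^ n) has_sum disc_coeff d 0) {0}"
    by (rule has_sum_finiteI) simp_all
  then have "((\<lambda>n. disc_coeff d n * a ^ n) has_sum disc_coeff d 0) UNIV"
    by (rule has_sum_cong_neutral[THEN iffD1, rotated -1]) (auto simp: d)
  from has_sum_unique[OF this disc_fun_has_sum[OF a]]
  have "disc_coeff d 0 = 0" using z by (simp add: d_def disc_fun_simps disc_fun_mult_sub)
  have "d = 0"
  proof (rule disc_eqI)
    show "disc_coeff d n = disc_coeff 0 n" for n
      using d[of n] \<open>disc_coeff d 0 = 0\<close> by (cases "n = 0") (simp_all add: disc_coeff_def hardy_coeff_0)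
  qed
  then show ?thesis by (auto simp: d_def)
qed

lemma disc_fun_holomorphic: "disc_fun f holomorphic_on ball 0 1"
proof (rule power_series_holomorphic)
  fix w :: complex assume "w \<in> ball 0 1"
  then show "(\<lambda>n. disc_coeff f n * (w - 0) ^ n) sums disc_fun f w"
    using has_sum_imp_sums[OF disc_fun_has_sum] by simp
qed

lemma continuous_eq_at_point:
  fixes f g :: "complex \<Rightarrow> complex"
  assumes "continuous_on (ball 0 1) f" "continuous_on (ball 0 1) g" "norm a < 1"
    and "\<And>z. norm z < 1 \<Longrightarrow> z \<noteq> a \<Longrightarrow> f z = g z"
  shows "f a = g a"
proof -
  have "isCont f a" "isCont g a" using assms by (auto simp: continuous_on_eq_continuous_at)
  then have "f \<midarrow>a\<rightarrow> f a" "g \<midarrow>a\<rightarrow> g a" by (simp_all add: isCont_def)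
  moreover have "\<forall>\<^sub>F z in at a. f z = g z"
  proof -
    have "\<forall>\<^sub>F z in at a. z \<in> ball 0 1 - {a}"
      using assms(3) eventually_at_in_open[of "ball 0 1" a] by simp
    then show ?thesis by eventually_elim (auto intro: assms(4))
  qed
  then have "f \<midarrow>a\<rightarrow> g a \<longleftrightarrow> g \<midarrow>a\<rightarrow> g a" by (intro filterlim_cong) auto
  ultimately show ?thesis using LIM_unique by blast
qed

lemma mult_sub_funpow_dvd:
  assumes a: "norm a < 1" and w: "continuous_on (ball 0 1) w"
    and eq: "\<And>z. norm z < 1 \<Longrightarrow> disc_fun f z = (z - a) ^ l * w z"
  shows "\<exists>u. f = (mult_sub a ^^ l) u \<and> (\<forall>z. norm z < 1 \<longrightarrow> disc_fun u z = w z)"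
  using eq
proof (induction l arbitrary: f)
  case (Suc l)
  have "disc_fun f a = 0" using Suc.prems a by simp
  from mult_sub_dvd[OF a this] obtain g where g: "f = mult_sub a g" by blast
  have off: "disc_fun g z = (z - a) ^ l * w z" if "norm z < 1" "z \<noteq> a" for z
    using Suc.prems[OF that(1)] that(2) by (simp add: g disc_fun_mult_sub mult.assoc)
  have "disc_fun g a = (a - a) ^ l * w a"
    by (rule continuous_eq_at_point[OF _ _ a off])
      (auto intro!: continuous_intros w holomorphic_on_imp_continuous_on[OF disc_fun_holomorphic])
  with off have "disc_fun g z = (z - a) ^ l * w z" if "norm z < 1" for z
    using that by (cases "z = a") auto
  from Suc.IH[OF this] obtain u where "g = (mult_sub a ^^ l) u" "\<forall>z. norm z < 1 \<longrightarrow> disc_fun u z = w z"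
    by blast
  then show ?case using g by auto
qed auto

definition vanishes :: "hardy_disc \<Rightarrow> complex \<Rightarrow> nat \<Rightarrow> bool" where
  "vanishes f a l \<longleftrightarrow> (\<forall>j<l. cinner f (szego a j) = 0)"

definition mult_one_sub :: "complex \<Rightarrow> hardy_disc \<Rightarrow> hardy_disc" where
  "mult_one_sub a f = f - cscale (cnj a) (Mz 1 f)"

lemma disc_fun_mult_one_sub: "disc_fun (mult_one_sub a f) z = (1 - cnj a * z) * disc_fun f z"
  by (simp add: mult_one_sub_def disc_fun_simps algebra_simps)

lemma norm_mult_one_sub: "norm (mult_one_sub a f) = norm (mult_sub a f)"
proof -
  have M: "cinner (Mz 1 f) (Mz 1 f) = cinner f f" by (simp add: cinner_self norm_Mz)
  have "cinner (mult_one_sub a f) (mult_one_sub a f) = cinner (mult_sub a f) (mult_sub a f)"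
    unfolding mult_one_sub_def mult_sub_def cinner_diff_left cinner_diff_right cinner_cscale_left
      cinner_cscale_right M
    by (simp add: algebra_simps)
  then have "(norm (mult_one_sub a f))\<^sup>2 = (norm (mult_sub a f))\<^sup>2" by (metis cinner_self of_real_eq_iff)
  then show ?thesis by (simp add: power2_eq_iff_nonneg)
qed

lemma one_minus_cnj_mult_nonzero:
  assumes "norm a < 1" "norm z \<le> 1"
  shows "1 - cnj a * z \<noteq> 0"
proof
  assume "1 - cnj a * z = 0"
  then have "norm (cnj a * z) = 1" by simp
  moreover have "norm (cnj a * z) \<le> norm a * 1"
    unfolding norm_mult using assms by (intro mult_mono) auto
  ultimately show False using assms by simp
qed

lemma norm_blaschke_factor:
  assumes "norm a < 1"
  shows "norm z = 1 \<Longrightarrow> norm (blaschke_factor a z) = 1"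
    and "norm z < 1 \<Longrightarrow> norm (blaschke_factor a z) < 1"
proof -
  have *: "(norm (1 - cnj a * z))\<^sup>2 - (norm (z - a))\<^sup>2 = (1 - (norm a)\<^sup>2) * (1 - (norm z)\<^sup>2)" for z
    unfolding cmod_power2 by (simp add: power2_eq_square) algebra
  show "norm (blaschke_factor a z) = 1" if "norm z = 1"
  proof -
    have "(norm (1 - cnj a * z))\<^sup>2 = (norm (z - a))\<^sup>2" using *[of z] that by simp
    then have "norm (1 - cnj a * z) = norm (z - a)" by (simp add: power2_eq_iff_nonneg)
    moreover have "norm (1 - cnj a * z) \<noteq> 0"
      using one_minus_cnj_mult_nonzero[OF assms, of z] that by simp
    ultimately show ?thesis by (simp add: blaschke_factor_def norm_divide)
  qed
  show "norm (blaschke_factor a z) < 1" if "norm z < 1"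
  proof -
    have "(1 - (norm a)\<^sup>2) * (1 - (norm z)\<^sup>2) > 0"
      using that assms by (intro mult_pos_pos) (simp_all add: abs_square_less_1)
    then have "(norm (z - a))\<^sup>2 < (norm (1 - cnj a * z))\<^sup>2" using *[of z] by simp
    then have "norm (z - a) < norm (1 - cnj a * z)" by (rule power2_less_imp_less) simp
    then show ?thesis by (simp add: blaschke_factor_def norm_divide divide_less_eq)
  qed
qed

lemma blaschke_factor_dvd:
  assumes a: "norm a < 1" and orth: "cinner f (szego a 0) = 0"
  shows "\<exists>g. norm g = norm f \<and> (\<forall>z. norm z < 1 \<longrightarrow> disc_fun f z = blaschke_factor a z * disc_fun g z) \<and>
    (\<forall>l. vanishes f a (Suc l) \<longrightarrow> vanishes g a l) \<and>
    (\<forall>b l. norm b < 1 \<longrightarrow> b \<noteq> a \<longrightarrow> vanishes f b l \<longrightarrow> vanishes g b l)"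
proof -
  obtain u where u: "f = mult_sub a u"
    using mult_sub_dvd[OF a] orth by (auto simp: cinner_szego_0[OF a])
  define g where "g = mult_one_sub a u"
  have g: "vanishes g b l" if "norm b < 1" "vanishes u b l" for b l
    unfolding vanishes_def
  proof safe
    fix j assume "j < l"
    then show "cinner g (szego b j) = 0"
      using that unfolding vanishes_def by (cases j) (simp_all add: g_def mult_one_sub_def cinner_diff_left cinner_cscale_left cinner_Mz
          backward_shift_szego_0 backward_shift_szego_Suc cinner_add_right cinner_cscale_right)
  qed
  have "norm g = norm f" by (simp add: g_def u norm_mult_one_sub)
  moreover have "disc_fun f z = blaschke_factor a z * disc_fun g z" if "norm z < 1" for z
    using one_minus_cnj_mult_nonzero[OF a, of z] that
    by (simp add: u g_def disc_fun_mult_sub disc_fun_mult_one_sub blaschke_factor_def)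
  moreover have "vanishes g a l" if "vanishes f a (Suc l)" for l
  proof (rule g[OF a], unfold vanishes_def, safe)
    fix j assume "j < l"
    with that have "cinner f (szego a (Suc j)) = 0" by (simp add: vanishes_def)
    then show "cinner u (szego a j) = 0" by (simp add: u cinner_mult_sub_szego[OF a])
  qed
  moreover have "vanishes g b l" if b: "norm b < 1" "b \<noteq> a" and f: "vanishes f b l" for b l
  proof (rule g[OF b(1)])
    have "j < l \<Longrightarrow> cinner u (szego b j) = 0" for j
    proof (induction j)
      case 0
      with f have "cinner f (szego b 0) = 0" by (simp add: vanishes_def)
      with b(2) show ?case by (simp add: u cinner_mult_sub_szego[OF b(1)])
    next
      case (Suc j)
      from Suc.prems f have "cinner f (szego b (Suc j)) = 0" by (simp add: vanishes_def)
      with b(2) Suc show ?case by (simp add: u cinner_mult_sub_szego[OF b(1)])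
    qed
    then show "vanishes u b l" by (simp add: vanishes_def)
  qed
  ultimately show ?thesis by blast
qed

lemma blaschke_factor_power_dvd:
  assumes a: "norm a < 1" and orth: "vanishes f a l"
  shows "\<exists>g. norm g = norm f \<and> (\<forall>z. norm z < 1 \<longrightarrow> disc_fun f z = blaschke_factor a z ^ l * disc_fun g z) \<and>
    (\<forall>b l. norm b < 1 \<longrightarrow> b \<noteq> a \<longrightarrow> vanishes f b l \<longrightarrow> vanishes g b l)"
  using orth
proof (induction l arbitrary: f)
  case 0
  show ?case by (rule exI[of _ f]) simp
next
  case (Suc l)
  have "cinner f (szego a 0) = 0" using Suc.prems by (simp add: vanishes_def)
  from blaschke_factor_dvd[OF a this] obtain g where g: "norm g = norm f"
    "\<And>z. norm z < 1 \<Longrightarrow> disc_fun f z = blaschke_factor a z * disc_fun g z"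
    "\<And>l. vanishes f a (Suc l) \<Longrightarrow> vanishes g a l"
    "\<And>b l. norm b < 1 \<Longrightarrow> b \<noteq> a \<Longrightarrow> vanishes f b l \<Longrightarrow> vanishes g b l"
    by blast
  from Suc.IH[OF g(3)[OF Suc.prems]] obtain h where h: "norm h = norm g"
    "\<And>z. norm z < 1 \<Longrightarrow> disc_fun g z = blaschke_factor a z ^ l * disc_fun h z"
    "\<And>b l. norm b < 1 \<Longrightarrow> b \<noteq> a \<Longrightarrow> vanishes g b l \<Longrightarrow> vanishes h b l"
    by blast
  show ?case
  proof (intro exI[of _ h] conjI allI impI)
    show "norm h = norm f" using g h by simp
    show "disc_fun f z = blaschke_factor a z ^ Suc l * disc_fun h z" if "norm z < 1" for z
      using g(2)[OF that] h(2)[OF that] by simp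
    show "vanishes h b l" if "norm b < 1" "b \<noteq> a" "vanishes f b l" for b l
      using g(4) h(3) that by blast
  qed
qed

lemma blaschke_prod_dvd:
  assumes F: "finite F" "F \<subseteq> M" and inj: "inj_on \<alpha> M" and \<alpha>: "\<And>m. m \<in> M \<Longrightarrow> norm (\<alpha> m) < 1"
    and orth: "\<And>m. m \<in> M \<Longrightarrow> vanishes f (\<alpha> m) (l m)"
  shows "\<exists>g. norm g = norm f \<and>
    (\<forall>z. norm z < 1 \<longrightarrow> disc_fun f z = (\<Prod>m\<in>F. blaschke_factor (\<alpha> m) z ^ l m) * disc_fun g z) \<and>
    (\<forall>m\<in>M - F. vanishes g (\<alpha> m) (l m))"
  using F
proof (induction F rule: finite_induct)
  case empty
  show ?case by (rule exI[of _ f]) (simp add: orth)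
next
  case (insert n F)
  then obtain g where g: "norm g = norm f"
    "\<And>z. norm z < 1 \<Longrightarrow> disc_fun f z = (\<Prod>m\<in>F. blaschke_factor (\<alpha> m) z ^ l m) * disc_fun g z"
    "\<And>m. m \<in> M - F \<Longrightarrow> vanishes g (\<alpha> m) (l m)"
    by auto
  from insert have n: "n \<in> M" by simp
  with insert.hyps have "vanishes g (\<alpha> n) (l n)" by (intro g(3)) simp
  from blaschke_factor_power_dvd[OF \<alpha>[OF n] this] obtain h where h: "norm h = norm g"
    "\<And>z. norm z < 1 \<Longrightarrow> disc_fun g z = blaschke_factor (\<alpha> n) z ^ l n * disc_fun h z"
    "\<And>b l. norm b < 1 \<Longrightarrow> b \<noteq> \<alpha> n \<Longrightarrow> vanishes g b l \<Longrightarrow> vanishes h b l"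
    by blast
  show ?case
  proof (intro exI[of _ h] conjI allI impI ballI)
    show "norm h = norm f" using g h by simp
    show "disc_fun f z = (\<Prod>m\<in>insert n F. blaschke_factor (\<alpha> m) z ^ l m) * disc_fun h z" if "norm z < 1" for z
      using g(2)[OF that] h(2)[OF that] insert.hyps by simp
    show "vanishes h (\<alpha> m) (l m)" if m: "m \<in> M - insert n F" for m
    proof -
      have "\<alpha> m \<noteq> \<alpha> n" using m n inj by (auto dest: inj_onD)
      with h(3)[of "\<alpha> m" "l m"] g(3)[of m] \<alpha>[of m] m show ?thesis by blast
    qed
  qed
qed

section \<open>Bounded holomorphic functions\<close>

lemma roots_of_unity_mean_square:
  fixes c :: "nat \<Rightarrow> complex"
  assumes N: "N > 0"
  defines "e \<equiv> \<lambda>k. cis (2 * pi * real k / real N)"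
  shows "(\<Sum>k<N. (norm (\<Sum>n<N. c n * e k ^ n))\<^sup>2) = real N * (\<Sum>n<N. (norm (c n))\<^sup>2)"
proof -
  have swap: "e k ^ n = e n ^ k" for k n
  proof -
    have "real n * (2 * pi * real k / real N) = real k * (2 * pi * real n / real N)" by simp
    then show ?thesis by (simp only: e_def Complex.DeMoivre)
  qed
  have orth: "(\<Sum>k<N. e n ^ k * cnj (e m ^ k)) = (if n = m then of_nat N else 0)"
    if "n < N" "m < N" for n m
  proof -
    define q where "q = e n * cnj (e m)"
    have unit: "e m * cnj (e m) = 1" for m by (simp add: e_def cis_cnj cis_mult)
    have pow: "e m ^ N = 1" for m
    proof -
      have "real N * (2 * pi * real m / real N) = 2 * pi * real m" using N by simp
      then show ?thesis by (simp only: e_def Complex.DeMoivre) simp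
    qed
    have "q ^ N = 1" by (simp add: q_def power_mult_distrib pow flip: complex_cnj_power)
    moreover have "q = 1 \<longleftrightarrow> n = m"
    proof
      assume "q = 1"
      then have "e n * cnj (e m) * e m = e m" by (simp add: q_def)
      then have "e n = e m" using unit[of m] by (simp add: mult.assoc mult.commute[of "cnj (e m)"])
      then show "n = m"
        using Complex.bij_betw_roots_unity[OF N] that unfolding bij_betw_def e_def by (auto dest: inj_onD)
    qed (simp add: q_def unit)
    moreover have "(\<Sum>k<N. e n ^ k * cnj (e m ^ k)) = (\<Sum>k<N. q ^ k)"
      by (simp add: q_def power_mult_distrib)
    ultimately show ?thesis by (simp add: sum_gp_strict)
  qed
  have "complex_of_real (\<Sum>k<N. (norm (\<Sum>n<N. c n * e k ^ n))\<^sup>2) =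
      (\<Sum>k<N. \<Sum>n<N. \<Sum>m<N. (c n * cnj (c m)) * (e n ^ k * cnj (e m ^ k)))"
    by (simp only: of_real_sum complex_norm_square cnj_sum sum_product swap complex_cnj_mult mult_ac)
  also have "\<dots> = (\<Sum>n<N. \<Sum>k<N. \<Sum>m<N. (c n * cnj (c m)) * (e n ^ k * cnj (e m ^ k)))"
    by (rule sum.swap)
  also have "\<dots> = (\<Sum>n<N. \<Sum>m<N. \<Sum>k<N. (c n * cnj (c m)) * (e n ^ k * cnj (e m ^ k)))"
    by (intro sum.cong refl sum.swap)
  also have "\<dots> = (\<Sum>n<N. \<Sum>m<N. (c n * cnj (c m)) * (if n = m then of_nat N else 0))"
    by (intro sum.cong refl) (simp only: sum_distrib_left[symmetric] orth lessThan_iff)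
  also have "\<dots> = (\<Sum>n<N. of_nat N * (c n * cnj (c n)))"
    by (intro sum.cong refl) (simp add: if_distrib sum.delta cong: if_cong)
  also have "\<dots> = complex_of_real (real N * (\<Sum>n<N. (norm (c n))\<^sup>2))"
    by (simp add: sum_distrib_left complex_norm_square del: of_real_power)
  finally show ?thesis using of_real_eq_iff by blast
qed

lemma sum_coeff_bounded_le:
  assumes sums: "\<And>z. norm z < 1 \<Longrightarrow> (\<lambda>n. a n * z ^ n) sums f z"
    and C: "\<And>z. norm z < 1 \<Longrightarrow> norm (f z :: complex) \<le> C" and \<rho>: "0 \<le> \<rho>" "\<rho> < 1"
  shows "(\<Sum>n<K. (norm (a n))\<^sup>2 * \<rho> ^ (2 * n)) \<le> C\<^sup>2"
proof -
  define S where "S = suminf (\<lambda>n. norm (a n) * \<rho> ^ n)"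
  have "summable (\<lambda>n. norm (a n * of_real \<rho> ^ n))"
  proof (rule powser_insidea)
    show "summable (\<lambda>n. a n * of_real ((1 + \<rho>) / 2) ^ n)"
      using sums[of "of_real ((1 + \<rho>) / 2)"] \<rho> sums_summable by (force simp del: of_real_divide of_real_add)
    show "norm (complex_of_real \<rho>) < norm (complex_of_real ((1 + \<rho>) / 2))"
      using \<rho> by (simp del: of_real_divide of_real_add)
  qed
  then have sm: "summable (\<lambda>n. norm (a n) * \<rho> ^ n)"
    using \<rho> by (simp add: norm_mult norm_power)
  define s where "s N = (\<Sum>n<N. norm (a n) * \<rho> ^ n)" for N
  have s: "s \<longlonglongrightarrow> S" unfolding s_def S_def by (rule summable_LIMSEQ[OF sm])
  have p: "norm (\<Sum>n<N. a n * z ^ n) \<le> C + (S - s N)" if z: "norm z = \<rho>" for z N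
  proof -
    have z1: "norm z < 1" using z \<rho> by simp
    have "summable (\<lambda>n. norm (a n * z ^ n))" using sm by (simp add: norm_mult norm_power z)
    then have sm': "summable (\<lambda>n. norm (a (n + N) * z ^ (n + N)))"
      using summable_ignore_initial_segment by blast
    have "f z = suminf (\<lambda>n. a n * z ^ n)" "summable (\<lambda>n. a n * z ^ n)"
      using sums[OF z1] by (auto simp: sums_iff)
    then have "f z - (\<Sum>n<N. a n * z ^ n) = suminf (\<lambda>n. a (n + N) * z ^ (n + N))"
      by (simp only: suminf_minus_initial_segment[of "\<lambda>n. a n * z ^ n"])
    then have "norm (f z - (\<Sum>n<N. a n * z ^ n)) \<le> suminf (\<lambda>n. norm (a (n + N) * z ^ (n + N)))"
      using summable_norm[OF sm'] by simp
    also have "\<dots> = suminf (\<lambda>n. norm (a (n + N)) * \<rho> ^ (n + N))"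
      by (simp add: norm_mult norm_power z)
    also have "\<dots> = S - s N"
      unfolding S_def s_def by (rule suminf_minus_initial_segment[OF sm])
    finally have "norm (f z - (\<Sum>n<N. a n * z ^ n)) \<le> S - s N" .
    moreover have "norm (\<Sum>n<N. a n * z ^ n) \<le> norm (f z) + norm (f z - (\<Sum>n<N. a n * z ^ n))"
      by (metis add_diff_cancel_left' diff_diff_eq2 norm_triangle_ineq4)
    ultimately show ?thesis using C[OF z1] by linarith
  qed
  have bound: "(\<Sum>n<K. (norm (a n))\<^sup>2 * \<rho> ^ (2 * n)) \<le> (C + (S - s N))\<^sup>2" if N: "N \<ge> K" "N > 0" for N
  proof -
    define e where "e = (\<lambda>k. cis (2 * pi * real k / real N))"
    have sq: "(norm (\<Sum>n<N. (a n * of_real \<rho> ^ n) * e k ^ n))\<^sup>2 \<le> (C + (S - s N))\<^sup>2" for k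
    proof (rule power_mono)
      have "norm (of_real \<rho> * e k) = \<rho>" using \<rho> by (simp add: norm_mult e_def)
      from p[OF this, of N] show "norm (\<Sum>n<N. (a n * of_real \<rho> ^ n) * e k ^ n) \<le> C + (S - s N)"
        by (simp add: power_mult_distrib mult_ac)
    qed simp
    have "real N * (\<Sum>n<N. (norm (a n * of_real \<rho> ^ n))\<^sup>2) =
        (\<Sum>k<N. (norm (\<Sum>n<N. (a n * of_real \<rho> ^ n) * e k ^ n))\<^sup>2)"
      unfolding e_def by (rule roots_of_unity_mean_square[OF N(2), symmetric])
    also have "\<dots> \<le> (\<Sum>k<N. (C + (S - s N))\<^sup>2)" by (intro sum_mono sq)
    also have "\<dots> = real N * (C + (S - s N))\<^sup>2" by simp
    finally have "(\<Sum>n<N. (norm (a n * of_real \<rho> ^ n))\<^sup>2) \<le> (C + (S - s N))\<^sup>2"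
      using N by simp
    moreover have "(norm (a n * of_real \<rho> ^ n))\<^sup>2 = (norm (a n))\<^sup>2 * \<rho> ^ (2 * n)" for n
      using \<rho> by (simp add: norm_mult norm_power power_mult_distrib mult.commute flip: power_mult)
    moreover have "(\<Sum>n<K. (norm (a n))\<^sup>2 * \<rho> ^ (2 * n)) \<le> (\<Sum>n<N. (norm (a n))\<^sup>2 * \<rho> ^ (2 * n))"
      using N \<rho> by (intro sum_mono2) auto
    ultimately show ?thesis by simp
  qed
  show ?thesis
  proof (rule tendsto_lowerbound)
    have "(\<lambda>N. (C + (S - s N))\<^sup>2) \<longlonglongrightarrow> (C + (S - S))\<^sup>2" by (intro tendsto_intros s)
    then show "(\<lambda>N. (C + (S - s N))\<^sup>2) \<longlonglongrightarrow> C\<^sup>2" by simp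
    show "\<forall>\<^sub>F N in sequentially. (\<Sum>n<K. (norm (a n))\<^sup>2 * \<rho> ^ (2 * n)) \<le> (C + (S - s N))\<^sup>2"
      unfolding eventually_sequentially by (rule exI[of _ "Suc K"]) (auto intro: bound)
  qed simp
qed

lemma ex_disc_fun_bounded:
  assumes hol: "f holomorphic_on ball 0 1" and C: "\<And>z. norm z < 1 \<Longrightarrow> norm (f z) \<le> C"
  shows "\<exists>g. \<forall>z. norm z < 1 \<longrightarrow> disc_fun g z = f z"
proof -
  define a where "a n = (deriv ^^ n) f 0 / fact n" for n
  have sums: "(\<lambda>n. a n * z ^ n) sums f z" if "norm z < 1" for z
    using holomorphic_power_series[OF hol, of z] that by (simp add: a_def)
  have le: "(\<Sum>n<K. (norm (a n))\<^sup>2) \<le> C\<^sup>2" for K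
  proof (rule tendsto_upperbound)
    show "((\<lambda>\<rho>. \<Sum>n<K. (norm (a n))\<^sup>2 * \<rho> ^ (2 * n)) \<longlongrightarrow> (\<Sum>n<K. (norm (a n))\<^sup>2)) (at_left 1)"
      by (rule tendsto_eq_intros refl)+ simp
    have "\<forall>\<^sub>F \<rho> in at_left (1::real). \<rho> \<in> {0<..<1}"
      by (rule eventually_at_left_real) simp
    then show "\<forall>\<^sub>F \<rho> in at_left (1::real). (\<Sum>n<K. (norm (a n))\<^sup>2 * \<rho> ^ (2 * n)) \<le> C\<^sup>2"
      by eventually_elim (intro sum_coeff_bounded_le[OF sums C], auto)
  qed simp
  have "square_summable a"
  proof (rule square_summableI)
    fix F :: "nat set" assume "finite F"
    then have "F \<subseteq> {..<Suc (Max F)}" by (auto simp: less_Suc_eq_le)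
    then have "(\<Sum>n\<in>F. (norm (a n))\<^sup>2) \<le> (\<Sum>n<Suc (Max F). (norm (a n))\<^sup>2)"
      by (intro sum_mono2) auto
    with le show "(\<Sum>n\<in>F. (norm (a n))\<^sup>2) \<le> C\<^sup>2" using order_trans by blast
  qed
  then obtain g where g: "disc_coeff g = a" using ex_disc_coeff by blast
  have "disc_fun g z = f z" if "norm z < 1" for z
    using has_sum_imp_sums[OF disc_fun_has_sum[OF that, of g]] sums[OF that] sums_unique2
    by (simp add: g) blast
  then show ?thesis by blast
qed

lemma disc_coeff_eq_deriv: "(deriv ^^ n) (disc_fun f) 0 / fact n = disc_coeff f n"
proof -
  have "(deriv ^^ n) (disc_fun f) 0 / fact n - disc_coeff f n = 0"
  proof (rule power_series_zero_imp_coeff_zero)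
    fix t :: complex assume t: "norm t < 1"
    have "(\<lambda>n. (deriv ^^ n) (disc_fun f) 0 / fact n * t ^ n) sums disc_fun f t"
      using holomorphic_power_series[OF disc_fun_holomorphic, of t f] t by simp
    from sums_diff[OF this has_sum_imp_sums[OF disc_fun_has_sum[OF t, of f]]]
    show "(\<lambda>n. ((deriv ^^ n) (disc_fun f) 0 / fact n - disc_coeff f n) * t ^ n) sums 0"
      by (simp add: left_diff_distrib)
  qed
  then show ?thesis by simp
qed

lemma norm_disc_fun_le:
  assumes z: "norm z < 1"
  shows "norm (disc_fun f z) \<le> norm f * (1 / (1 - norm z))"
proof -
  have le: "norm (disc_coeff f n * z ^ n) \<le> norm f * norm z ^ n" for n
    unfolding norm_mult norm_power
    by (intro mult_right_mono) (simp_all add: disc_coeff_def coeff_le_norm)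
  have "(\<lambda>n. norm z ^ n) sums (1 / (1 - norm z))" using z by (intro geometric_sums) simp
  from sums_mult[OF this, of "norm f"]
  have "(\<lambda>n. norm f * norm z ^ n) sums (norm f * (1 / (1 - norm z)))" .
  from norm_suminf_le[OF le sums_summable[OF this]] this
  have "norm (suminf (\<lambda>n. disc_coeff f n * z ^ n)) \<le> norm f * (1 / (1 - norm z))"
    by (simp add: sums_iff)
  then show ?thesis using has_sum_imp_sums[OF disc_fun_has_sum[OF z, of f]] by (simp add: sums_iff)
qed

lemma norm_bounded_subsequence:
  assumes C: "\<And>N. norm (g N) \<le> C"
  shows "\<exists>u r. strict_mono (r :: nat \<Rightarrow> nat) \<and>
    (\<forall>z. norm z < 1 \<longrightarrow> (\<lambda>N. disc_fun (g (r N)) z) \<longlonglongrightarrow> disc_fun u z)"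
proof -
  have bdd: "\<exists>B. \<forall>h\<in>range (\<lambda>N. disc_fun (g N)). \<forall>z\<in>K. norm (h z) \<le> B"
    if K: "compact K" "K \<subseteq> ball 0 1" for K
  proof (cases "K = {}")
    case False
    have "continuous_on K (norm :: complex \<Rightarrow> real)" by (intro continuous_intros)
    from continuous_attains_sup[OF K(1) False this] obtain w where
      w: "w \<in> K" "\<And>z. z \<in> K \<Longrightarrow> norm z \<le> norm w" by blast
    have w1: "norm w < 1" using w K by auto
    have "norm (disc_fun (g N) z) \<le> C * (1 / (1 - norm w))" if "z \<in> K" for z N
    proof -
      have "norm (disc_fun (g N) z) \<le> norm (g N) * (1 / (1 - norm z))"
        using that K by (intro norm_disc_fun_le) auto
      also have "\<dots> \<le> C * (1 / (1 - norm w))"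
        using w that w1 C[of N] order_trans[OF norm_ge_zero C[of N]]
        by (intro mult_mono divide_left_mono mult_pos_pos) (force dest: w(2))+
      finally show ?thesis .
    qed
    then show ?thesis by blast
  qed simp
  obtain G r where G: "G holomorphic_on ball 0 1" "strict_mono (r :: nat \<Rightarrow> nat)"
    "\<And>z. z \<in> ball 0 1 \<Longrightarrow> (\<lambda>n. disc_fun (g (r n)) z) \<longlonglongrightarrow> G z"
    "\<And>K. compact K \<Longrightarrow> K \<subseteq> ball 0 1 \<Longrightarrow> uniform_limit K ((\<lambda>N. disc_fun (g N)) \<circ> r) G sequentially"
    by (rule Montel[of "ball 0 1" "range (\<lambda>N. disc_fun (g N))" "\<lambda>N. disc_fun (g N)"])
      (use bdd disc_fun_holomorphic in auto)
  define a where "a n = (deriv ^^ n) G 0 / fact n" for n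
  have lim: "(\<lambda>N. disc_coeff (g (r N)) n) \<longlonglongrightarrow> a n" for n
  proof -
    have "uniform_limit (ball 0 (1/2)) ((\<lambda>N. disc_fun (g N)) \<circ> r) G sequentially"
      by (rule uniform_limit_on_subset[OF G(4)[of "cball 0 (1/2)"]]) auto
    moreover have "\<forall>\<^sub>F N in sequentially. ((\<lambda>N. disc_fun (g N)) \<circ> r) N holomorphic_on ball 0 (1/2)"
      by (intro always_eventually allI) (auto intro!: holomorphic_on_subset[OF disc_fun_holomorphic])
    ultimately have "(\<lambda>N. (deriv ^^ n) (((\<lambda>N. disc_fun (g N)) \<circ> r) N) 0) \<longlonglongrightarrow> (deriv ^^ n) G 0"
      by (rule higher_deriv_complex_uniform_limit) auto
    then have "(\<lambda>N. (deriv ^^ n) (disc_fun (g (r N))) 0) \<longlonglongrightarrow> (deriv ^^ n) G 0"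
      by (simp only: o_def)
    then have "(\<lambda>N. (deriv ^^ n) (disc_fun (g (r N))) 0 / fact n) \<longlonglongrightarrow> a n"
      unfolding a_def by (intro tendsto_intros) auto
    then show ?thesis by (simp only: disc_coeff_eq_deriv)
  qed
  have "square_summable a"
  proof (rule square_summableI)
    fix F :: "nat set" assume F: "finite F"
    show "(\<Sum>n\<in>F. (norm (a n))\<^sup>2) \<le> C\<^sup>2"
    proof (rule tendsto_upperbound)
      show "(\<lambda>N. \<Sum>n\<in>F. (norm (disc_coeff (g (r N)) n))\<^sup>2) \<longlonglongrightarrow> (\<Sum>n\<in>F. (norm (a n))\<^sup>2)"
        by (intro tendsto_intros lim)
      have "(\<Sum>n\<in>F. (norm (disc_coeff (g (r N)) n))\<^sup>2) \<le> C\<^sup>2" for N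
      proof -
        have "(\<Sum>n\<in>F. (norm (disc_coeff (g (r N)) n))\<^sup>2) =
            (\<Sum>k\<in>(\<lambda>n _. n) ` F. (norm (hardy_coeff (g (r N)) k))\<^sup>2)"
          by (subst sum.reindex)
            (auto simp: disc_coeff_def intro: inj_on_subset[OF bij_is_inj[OF bij_const_num1]])
        also have "\<dots> \<le> (norm (g (r N)))\<^sup>2" using F by (intro sum_coeff_le_norm) auto
        also have "\<dots> \<le> C\<^sup>2" using C by (intro power_mono) auto
        finally show ?thesis .
      qed
      then show "\<forall>\<^sub>F N in sequentially. (\<Sum>n\<in>F. (norm (disc_coeff (g (r N)) n))\<^sup>2) \<le> C\<^sup>2" by simp
    qed simp
  qed
  then obtain u where u: "disc_coeff u = a" using ex_disc_coeff by blast
  have "disc_fun u z = G z" if "norm z < 1" for z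
  proof (rule sums_unique2)
    show "(\<lambda>n. a n * z ^ n) sums disc_fun u z"
      using has_sum_imp_sums[OF disc_fun_has_sum[OF that, of u]] by (simp add: u)
    show "(\<lambda>n. a n * z ^ n) sums G z"
      using holomorphic_power_series[OF G(1), of z] that by (simp add: a_def)
  qed
  then show ?thesis using G(2,3) by (intro exI[of _ u] exI[of _ r]) auto
qed

lemma bounded_pointwise_limit_holomorphic:
  fixes F :: "nat \<Rightarrow> complex \<Rightarrow> complex"
  assumes "\<And>N. F N holomorphic_on ball 0 1" "\<And>N z. norm z < 1 \<Longrightarrow> norm (F N z) \<le> C"
    and lim: "\<And>z. norm z < 1 \<Longrightarrow> (\<lambda>N. F N z) \<longlonglongrightarrow> \<theta> z"
  shows "\<theta> holomorphic_on ball 0 1"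
proof -
  have bdd: "\<exists>B. \<forall>h\<in>range F. \<forall>z\<in>K. norm (h z) \<le> B" if "K \<subseteq> ball 0 1" for K
    using assms(2) that by (intro exI[of _ C]) auto
  obtain G r where G: "G holomorphic_on ball 0 1" "strict_mono (r :: nat \<Rightarrow> nat)"
    "\<And>z. z \<in> ball 0 1 \<Longrightarrow> (\<lambda>n. F (r n) z) \<longlonglongrightarrow> G z"
    by (rule Montel[of "ball 0 1" "range F" F]) (use bdd assms(1) in auto)
  have "\<theta> z = G z" if "z \<in> ball 0 1" for z
    using LIMSEQ_subseq_LIMSEQ[OF lim G(2), of z] G(3)[OF that] that
    by (intro LIMSEQ_unique[of "\<lambda>n. F (r n) z"]) (auto simp: o_def)
  with G(1) show ?thesis using holomorphic_transform by metis
qed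

section \<open>Blaschke products and their model spaces\<close>

lemma blaschke_factor_eq_0_iff:
  "norm a < 1 \<Longrightarrow> norm z < 1 \<Longrightarrow> blaschke_factor a z = 0 \<longleftrightarrow> z = a"
  using one_minus_cnj_mult_nonzero[of a z] by (simp add: blaschke_factor_def)

lemma blaschke_factor_inject:
  assumes "norm a < 1" "norm b < 1" "blaschke_factor a = blaschke_factor b"
  shows "a = b"
proof -
  have "blaschke_factor b a = 0" using assms(1) blaschke_factor_eq_0_iff[of a a] by (simp flip: assms(3))
  then show ?thesis using assms blaschke_factor_eq_0_iff by blast
qed

lemma blaschke_factor_holomorphic:
  assumes "norm a < 1"
  shows "blaschke_factor a holomorphic_on ball 0 1"
  unfolding blaschke_factor_def
  by (intro holomorphic_intros) (use one_minus_cnj_mult_nonzero[OF assms] in auto)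

lemma ord_at_blaschke_factor:
  assumes "norm a < 1"
  shows "ord_at \<phi> (blaschke_factor a) = nat (zorder \<phi> a)"
proof -
  have "(THE \<alpha>. norm \<alpha> < 1 \<and> blaschke_factor a = blaschke_factor \<alpha>) = a"
    by (rule the_equality) (use assms blaschke_factor_inject in auto)
  then show ?thesis by (simp add: ord_at_def)
qed

lemma ord_at_eqI:
  assumes "norm a < 1" "\<theta> holomorphic_on ball 0 1" "\<theta> a \<noteq> 0"
    and "\<And>z. norm z < 1 \<Longrightarrow> \<phi> z = (z - a) ^ l * \<theta> z"
  shows "ord_at \<phi> (blaschke_factor a) = l"
proof -
  have "zorder \<phi> a = int l"
    by (rule zorder_eqI[of "ball 0 1" a \<theta>]) (use assms in auto)
  then show ?thesis by (simp add: ord_at_blaschke_factor assms)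
qed

definition blaschke_term :: "nat set \<Rightarrow> (nat \<Rightarrow> complex) \<Rightarrow> (nat \<Rightarrow> nat) \<Rightarrow> (nat \<Rightarrow> complex) \<Rightarrow> complex \<Rightarrow> nat \<Rightarrow> complex" where
  "blaschke_term M \<alpha> l c z m = (if m \<in> M then c m * blaschke_factor (\<alpha> m) z ^ l m else 1)"

lemma blaschke_formE:
  assumes "blaschke_form \<phi> M \<alpha> l"
  obtains c where "inj_on \<alpha> M" "\<And>m. m \<in> M \<Longrightarrow> norm (\<alpha> m) < 1" "\<And>m. m \<in> M \<Longrightarrow> l m \<ge> 1"
    "\<And>m. m \<in> M \<Longrightarrow> norm (c m) = 1" "\<And>z. norm z < 1 \<Longrightarrow> blaschke_term M \<alpha> l c z has_prod \<phi> z"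
proof -
  from assms obtain c where "\<forall>m\<in>M. norm (c m) = 1" "\<forall>z\<in>ball 0 1. blaschke_term M \<alpha> l c z has_prod \<phi> z"
    unfolding blaschke_form_def blaschke_term_def[abs_def] by blast
  with assms show thesis by (intro that[of c]) (auto simp: blaschke_form_def)
qed

lemma norm_blaschke_term_le:
  assumes "\<And>m. m \<in> M \<Longrightarrow> norm (\<alpha> m) < 1" "\<And>m. m \<in> M \<Longrightarrow> norm (c m) = 1" "norm z < 1"
  shows "norm (blaschke_term M \<alpha> l c z m) \<le> 1"
  using assms norm_blaschke_factor(2)[of "\<alpha> m" z]
  by (auto simp: blaschke_term_def norm_mult norm_power intro!: power_le_one)

lemma blaschke_form_nonzero:
  assumes "blaschke_form \<phi> M \<alpha> l" "norm z < 1" "z \<notin> \<alpha> ` M"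
  shows "\<phi> z \<noteq> 0"
proof
  assume 0: "\<phi> z = 0"
  from assms(1) obtain c where c: "\<And>m. m \<in> M \<Longrightarrow> norm (\<alpha> m) < 1" "\<And>m. m \<in> M \<Longrightarrow> norm (c m) = 1"
    "\<And>z. norm z < 1 \<Longrightarrow> blaschke_term M \<alpha> l c z has_prod \<phi> z" by (rule blaschke_formE) blast
  from c(3)[OF assms(2)] 0 obtain m where "blaschke_term M \<alpha> l c z m = 0"
    by (metis has_prod_0D imageE)
  then have "m \<in> M" "c m = 0 \<or> blaschke_factor (\<alpha> m) z = 0"
    by (auto simp: blaschke_term_def split: if_splits)
  with c(1,2)[of m] assms(2,3) show False by (auto simp: blaschke_factor_eq_0_iff)
qed

text \<open>Deleting the \<open>m\<close>-th factor leaves a pointwise convergent product whose partial products are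
  bounded by \<open>1\<close>, so its limit is holomorphic.\<close>

lemma blaschke_form_factor:
  assumes "blaschke_form \<phi> M \<alpha> l" and m: "m \<in> M"
  shows "\<exists>\<theta>. \<theta> holomorphic_on ball 0 1 \<and> \<theta> (\<alpha> m) \<noteq> 0 \<and>
    (\<forall>z. norm z < 1 \<longrightarrow> \<phi> z = (z - \<alpha> m) ^ l m * \<theta> z)"
proof -
  obtain c where c: "inj_on \<alpha> M" "\<And>m. m \<in> M \<Longrightarrow> norm (\<alpha> m) < 1" "\<And>m. m \<in> M \<Longrightarrow> l m \<ge> 1"
    "\<And>m. m \<in> M \<Longrightarrow> norm (c m) = 1" "\<And>z. norm z < 1 \<Longrightarrow> blaschke_term M \<alpha> l c z has_prod \<phi> z"
    using blaschke_formE[OF assms(1)] by metis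
  define h where "h = blaschke_term M \<alpha> l c"
  define h' where "h' z n = (if n = m then 1 else h z n)" for z n
  define Q where "Q N z = (\<Prod>n\<le>N. h' z n)" for N z
  have a: "norm (\<alpha> m) < 1" using c(2) m by blast
  have split: "(\<Prod>n\<le>N. h z n) = h z m * Q N z" if "N \<ge> m" for N z
  proof -
    have "Q N z = (\<Prod>n\<in>{..N} - {m}. h z n)"
      unfolding Q_def h'_def using that by (subst prod.remove[of _ m]) (auto intro!: prod.cong)
    then show ?thesis using that by (subst prod.remove[of _ m]) auto
  qed
  have lim_off: "(\<lambda>N. Q N z) \<longlonglongrightarrow> \<phi> z / h z m" if z: "norm z < 1" "z \<noteq> \<alpha> m" for z
  proof -
    have nz: "h z m \<noteq> 0"
      using c(4)[OF m] m z a by (auto simp: h_def blaschke_term_def blaschke_factor_eq_0_iff)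
    have "(\<lambda>N. (\<Prod>n\<le>N. h z n) / h z m) \<longlonglongrightarrow> \<phi> z / h z m"
      using has_prod_imp_tendsto[OF c(5)[OF z(1)]] nz unfolding h_def by (intro tendsto_divide) auto
    moreover have "\<forall>\<^sub>F N in sequentially. (\<Prod>n\<le>N. h z n) / h z m = Q N z"
      unfolding eventually_sequentially by (rule exI[of _ m]) (auto simp: split nz)
    ultimately show ?thesis by (rule Lim_transform_eventually)
  qed
  have "\<exists>q. q \<noteq> 0 \<and> (\<lambda>N. Q N (\<alpha> m)) \<longlonglongrightarrow> q"
  proof -
    have nz: "h (\<alpha> m) n \<noteq> 0" if "n \<noteq> m" for n
      using that c(1,2,4) m a
      by (auto simp: h_def blaschke_term_def blaschke_factor_eq_0_iff dest: inj_onD) (metis norm_zero zero_neq_one)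
    have z: "h (\<alpha> m) m = 0"
      using m a c(3)[OF m] by (simp add: h_def blaschke_term_def blaschke_factor_def)
    from c(5)[OF a] consider "raw_has_prod (h (\<alpha> m)) 0 (\<phi> (\<alpha> m))"
      | i q where "h (\<alpha> m) i = 0" "raw_has_prod (h (\<alpha> m)) (Suc i) q"
      unfolding has_prod_def h_def by blast
    then obtain q where "raw_has_prod (h (\<alpha> m)) (Suc m) q"
    proof cases
      case 1
      from raw_has_prod_eq_0[OF this z] 1 show ?thesis by (simp add: raw_has_prod_def)
    next
      case 2
      with nz have "i = m" by blast
      with 2 that show ?thesis by blast
    qed
    then have q: "(\<lambda>k. \<Prod>i\<le>k. h (\<alpha> m) (i + Suc m)) \<longlonglongrightarrow> q" "q \<noteq> 0"
      by (auto simp: raw_has_prod_def)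
    define C where "C = (\<Prod>n\<le>m. h' (\<alpha> m) n)"
    have "C \<noteq> 0" using nz by (auto simp: C_def h'_def)
    have "Q (k + Suc m) (\<alpha> m) = C * (\<Prod>i\<le>k. h (\<alpha> m) (i + Suc m))" for k
      by (induction k) (simp_all add: Q_def C_def h'_def)
    then have "(\<lambda>k. Q (k + Suc m) (\<alpha> m)) \<longlonglongrightarrow> C * q"
      using tendsto_mult[OF tendsto_const[of C] q(1)] by simp
    then have "(\<lambda>N. Q N (\<alpha> m)) \<longlonglongrightarrow> C * q" by (rule LIMSEQ_offset)
    with \<open>C \<noteq> 0\<close> q(2) show ?thesis by (intro exI[of _ "C * q"]) simp
  qed
  then obtain q where q: "q \<noteq> 0" "(\<lambda>N. Q N (\<alpha> m)) \<longlonglongrightarrow> q" by blast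
  define \<theta>0 where "\<theta>0 z = (if z = \<alpha> m then q else \<phi> z / h z m)" for z
  have lim: "(\<lambda>N. Q N z) \<longlonglongrightarrow> \<theta>0 z" if "norm z < 1" for z
    using that q(2) lim_off by (auto simp: \<theta>0_def)
  have "\<theta>0 holomorphic_on ball 0 1"
  proof (rule bounded_pointwise_limit_holomorphic[OF _ _ lim])
    show "Q N holomorphic_on ball 0 1" for N
      unfolding Q_def
    proof (rule holomorphic_on_prod)
      show "(\<lambda>z. h' z n) holomorphic_on ball 0 1" for n
        using c(2) unfolding h'_def h_def blaschke_term_def
        by (cases "n = m"; cases "n \<in> M") (auto intro!: holomorphic_intros blaschke_factor_holomorphic)
    qed
    show "norm (Q N z) \<le> 1" if "norm z < 1" for N z
      unfolding Q_def prod_norm[symmetric]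
    proof (rule prod_le_1)
      show "0 \<le> norm (h' z n) \<and> norm (h' z n) \<le> 1" for n
        using norm_blaschke_term_le[OF c(2,4) that] by (simp add: h'_def h_def)
    qed
  qed
  define \<theta> where "\<theta> z = c m / (1 - cnj (\<alpha> m) * z) ^ l m * \<theta>0 z" for z
  show ?thesis
  proof (intro exI[of _ \<theta>] conjI allI impI)
    show "\<theta> holomorphic_on ball 0 1"
      unfolding \<theta>_def using one_minus_cnj_mult_nonzero[OF a]
      by (intro holomorphic_intros \<open>\<theta>0 holomorphic_on ball 0 1\<close>) auto
    have "c m \<noteq> 0" using c(4)[OF m] by auto
    then show "\<theta> (\<alpha> m) \<noteq> 0"
      using q(1) one_minus_cnj_mult_nonzero[OF a, of "\<alpha> m"] a by (simp add: \<theta>_def \<theta>0_def)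
    fix z :: complex assume z: "norm z < 1"
    have hz: "h z m = c m * ((z - \<alpha> m) / (1 - cnj (\<alpha> m) * z)) ^ l m"
      using m by (simp add: h_def blaschke_term_def blaschke_factor_def)
    have "\<phi> z = h z m * \<theta>0 z"
    proof (rule LIMSEQ_unique)
      show "(\<lambda>N. \<Prod>n\<le>N. h z n) \<longlonglongrightarrow> \<phi> z" using has_prod_imp_tendsto[OF c(5)[OF z]] by (simp add: h_def)
      have "\<forall>\<^sub>F N in sequentially. h z m * Q N z = (\<Prod>n\<le>N. h z n)"
        unfolding eventually_sequentially by (rule exI[of _ m]) (simp add: split)
      then show "(\<lambda>N. \<Prod>n\<le>N. h z n) \<longlonglongrightarrow> h z m * \<theta>0 z"
        by (rule Lim_transform_eventually[OF tendsto_mult[OF tendsto_const lim[OF z]]])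
    qed
    then show "\<phi> z = (z - \<alpha> m) ^ l m * \<theta> z"
      unfolding \<theta>_def hz by (simp add: power_divide)
  qed
qed

lemma blaschke_form_ord:
  assumes "blaschke_form \<phi> M \<alpha> l" "m \<in> M"
  shows "ord_at \<phi> (blaschke_factor (\<alpha> m)) = l m"
proof -
  have "norm (\<alpha> m) < 1" using assms by (auto simp: blaschke_form_def)
  with blaschke_form_factor[OF assms] show ?thesis using ord_at_eqI by blast
qed

lemma blaschke_form_ord_0:
  assumes "blaschke_form \<phi> M \<alpha> l" "\<phi> holomorphic_on ball 0 1" "norm a < 1" "a \<notin> \<alpha> ` M"
  shows "ord_at \<phi> (blaschke_factor a) = 0"
  by (rule ord_at_eqI[OF assms(3,2)]) (use blaschke_form_nonzero[OF assms(1,3,4)] in auto)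

lemma blaschke_factorization:
  assumes "blaschke_product \<phi>" "norm a < 1"
  shows "\<exists>\<theta>. \<theta> holomorphic_on ball 0 1 \<and> \<theta> a \<noteq> 0 \<and>
    (\<forall>z. norm z < 1 \<longrightarrow> \<phi> z = (z - a) ^ ord_at \<phi> (blaschke_factor a) * \<theta> z)"
proof -
  from assms(1) obtain M \<alpha> l where \<phi>: "blaschke_form \<phi> M \<alpha> l" "\<phi> holomorphic_on ball 0 1"
    by (auto simp: blaschke_product_def inner_function_def)
  show ?thesis
  proof (cases "a \<in> \<alpha> ` M")
    case True
    then show ?thesis using blaschke_form_factor[OF \<phi>(1)] blaschke_form_ord[OF \<phi>(1)] by auto
  next
    case False
    then show ?thesis
      using blaschke_form_ord_0[OF \<phi> assms(2)] blaschke_form_nonzero[OF \<phi>(1) assms(2)] \<phi>(2) by auto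
  qed
qed

lemma closed_subspace_model_space: "closed_subspace (model_space \<phi>)"
proof -
  define H where "H = {h :: hardy_disc. \<exists>g :: hardy_disc. \<forall>z\<in>ball 0 1. hardy_fun h (vec z) = \<phi> z * hardy_fun g (vec z)}"
  have eq: "model_space \<phi> = (\<Inter>h\<in>H. {f. cinner f h = 0})"
    unfolding model_space_def H_def by blast
  show ?thesis
    unfolding eq by (intro closed_subspaceI closed_INT ballI closed_subspaceD(1)[OF closed_subspace_orthogonal])
      (auto simp: cinner_add_left cinner_cscale_left)
qed

lemma model_space_iff:
  "f \<in> model_space \<phi> \<longleftrightarrow> (\<forall>g h. (\<forall>z. norm z < 1 \<longrightarrow> disc_fun h z = \<phi> z * disc_fun g z) \<longrightarrow> cinner f h = 0)"
  by (simp add: model_space_def disc_fun_def Ball_def)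

lemma model_space_blaschke_form:
  assumes form: "blaschke_form \<phi> M \<alpha> l" and hol: "\<phi> holomorphic_on ball 0 1"
  shows "model_space \<phi> = closed_span {szego a j | a j. norm a < 1 \<and> j < ord_at \<phi> (blaschke_factor a)}"
    (is "_ = closed_span ?X")
proof -
  obtain c where c: "inj_on \<alpha> M" "\<And>m. m \<in> M \<Longrightarrow> norm (\<alpha> m) < 1" "\<And>m. m \<in> M \<Longrightarrow> l m \<ge> 1"
    "\<And>m. m \<in> M \<Longrightarrow> norm (c m) = 1" "\<And>z. norm z < 1 \<Longrightarrow> blaschke_term M \<alpha> l c z has_prod \<phi> z"
    using blaschke_formE[OF form] by metis
  show ?thesis
  proof (rule closed_subspace_dense)
    show "closed_span ?X \<subseteq> model_space \<phi>"
    proof (rule closed_span_minimal[OF _ closed_subspace_model_space], safe)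
      fix a :: complex and j assume a: "norm a < 1" and j: "j < ord_at \<phi> (blaschke_factor a)"
      have "a \<in> \<alpha> ` M" using blaschke_form_ord_0[OF form hol a] j by (cases "a \<in> \<alpha> ` M") auto
      then obtain m where m: "m \<in> M" "a = \<alpha> m" by blast
      with j have j: "j < l m" using blaschke_form_ord[OF form] by simp
      obtain \<theta> where \<theta>: "\<theta> holomorphic_on ball 0 1"
        "\<And>z. norm z < 1 \<Longrightarrow> \<phi> z = (z - a) ^ l m * \<theta> z"
        using blaschke_form_factor[OF form m(1)] m(2) by blast
      show "szego a j \<in> model_space \<phi>"
        unfolding model_space_iff
      proof (intro allI impI)
        fix g h assume gh: "\<forall>z. norm z < 1 \<longrightarrow> disc_fun h z = \<phi> z * disc_fun g z"
        have "\<exists>u. h = (mult_sub a ^^ l m) u \<and> (\<forall>z. norm z < 1 \<longrightarrow> disc_fun u z = \<theta> z * disc_fun g z)"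
        proof (rule mult_sub_funpow_dvd[OF a])
          show "continuous_on (ball 0 1) (\<lambda>z. \<theta> z * disc_fun g z)"
            by (intro continuous_intros holomorphic_on_imp_continuous_on[OF disc_fun_holomorphic]
                holomorphic_on_imp_continuous_on[OF \<theta>(1)])
        qed (use gh \<theta>(2) in \<open>simp add: mult.assoc\<close>)
        then obtain u where "h = (mult_sub a ^^ l m) u" by blast
        then have "cinner h (szego a j) = 0"
          using j by (simp add: cinner_mult_sub_funpow_szego[OF a])
        then show "cinner (szego a j) h = 0" by (subst cinner_commute) simp
      qed
    qed
    fix f assume f: "f \<in> model_space \<phi>" and orth: "\<And>v. v \<in> closed_span ?X \<Longrightarrow> cinner f v = 0"
    have ker: "cinner f (szego (\<alpha> m) j) = 0" if "m \<in> M" "j < l m" for m j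
    proof (rule orth, rule subsetD[OF closed_span_superset], rule CollectI, intro exI conjI)
      show "norm (\<alpha> m) < 1" using c(2) that by blast
      show "j < ord_at \<phi> (blaschke_factor (\<alpha> m))" using blaschke_form_ord[OF form] that by simp
    qed simp
    have "\<exists>g. norm g \<le> norm f \<and> (\<forall>z. norm z < 1 \<longrightarrow> disc_fun f z = (\<Prod>n\<le>N. blaschke_term M \<alpha> l c z n) * disc_fun g z)"
      for N
    proof -
      define F where "F = M \<inter> {..N}"
      obtain g where g: "norm g = norm f"
        "\<And>z. norm z < 1 \<Longrightarrow> disc_fun f z = (\<Prod>m\<in>F. blaschke_factor (\<alpha> m) z ^ l m) * disc_fun g z"
        using blaschke_prod_dvd[of F M \<alpha> f l] c(1,2) ker by (auto simp: F_def vanishes_def)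
      define C where "C = (\<Prod>m\<in>F. c m)"
      have C: "norm C = 1" unfolding C_def prod_norm[symmetric] using c(4) by (simp add: F_def)
      have eq: "(\<Prod>n\<le>N. blaschke_term M \<alpha> l c z n) = C * (\<Prod>m\<in>F. blaschke_factor (\<alpha> m) z ^ l m)" for z
        unfolding C_def F_def blaschke_term_def prod.distrib[symmetric]
        by (subst Int_commute, subst prod.inter_restrict) (auto intro!: prod.cong)
      have "C \<noteq> 0" using C by auto
      then show ?thesis
        using g by (intro exI[of _ "cscale (1 / C) g"]) (auto simp: norm_cscale norm_divide C eq disc_fun_simps)
    qed
    then obtain g where g: "\<And>N. norm (g N) \<le> norm f"
      "\<And>N z. norm z < 1 \<Longrightarrow> disc_fun f z = (\<Prod>n\<le>N. blaschke_term M \<alpha> l c z n) * disc_fun (g N) z"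
      by metis
    obtain u r where u: "strict_mono (r :: nat \<Rightarrow> nat)"
      "\<And>z. norm z < 1 \<Longrightarrow> (\<lambda>N. disc_fun (g (r N)) z) \<longlonglongrightarrow> disc_fun u z"
      using norm_bounded_subsequence[of g, OF g(1)] by blast
    have "disc_fun f z = \<phi> z * disc_fun u z" if z: "norm z < 1" for z
    proof (rule LIMSEQ_unique)
      have "(\<lambda>N. \<Prod>n\<le>r N. blaschke_term M \<alpha> l c z n) \<longlonglongrightarrow> \<phi> z"
        using LIMSEQ_subseq_LIMSEQ[OF has_prod_imp_tendsto[OF c(5)[OF z]] u(1)] by (simp add: o_def)
      from tendsto_mult[OF this u(2)[OF z]]
      show "(\<lambda>N. disc_fun f z) \<longlonglongrightarrow> \<phi> z * disc_fun u z" by (simp flip: g(2)[OF z])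
    qed simp
    with f have "cinner f f = 0" unfolding model_space_iff by blast
    then show "f = 0" by (simp add: cinner_self)
  qed (rule closed_subspace_closed_span closed_subspace_model_space)+
qed

lemma model_space_blaschke_product:
  assumes "blaschke_product \<phi>"
  shows "model_space \<phi> = closed_span {szego a j | a j. norm a < 1 \<and> j < ord_at \<phi> (blaschke_factor a)}"
  using assms model_space_blaschke_form by (auto simp: blaschke_product_def inner_function_def)

lemma model_space_blaschke_power:
  assumes a: "norm a < 1"
  shows "model_space (\<lambda>z. blaschke_factor a z ^ l) = closed_span {szego a j | j. j < l}"
proof -
  define \<phi> where "\<phi> = (\<lambda>z. blaschke_factor a z ^ l)"
  define M where "M = (if l = 0 then {} else {0::nat})"
  have form: "blaschke_form \<phi> M (\<lambda>_. a) (\<lambda>_. l)"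
    unfolding blaschke_form_def
  proof (intro conjI exI[of _ "\<lambda>_. 1"] ballI)
    fix z :: complex
    have "finite M" by (simp add: M_def)
    then have "(\<lambda>m. if m \<in> M then 1 * blaschke_factor a z ^ l else 1) has_prod
        (\<Prod>m\<in>M. if m \<in> M then 1 * blaschke_factor a z ^ l else 1)"
      by (rule has_prod_finite) simp
    then show "(\<lambda>m. if m \<in> M then 1 * blaschke_factor a z ^ l else 1) has_prod \<phi> z"
      by (simp add: M_def \<phi>_def split: if_splits)
  qed (use a in \<open>auto simp: M_def split: if_splits\<close>)
  have hol: "\<phi> holomorphic_on ball 0 1"
    unfolding \<phi>_def by (intro holomorphic_intros blaschke_factor_holomorphic a)
  have "ord_at \<phi> (blaschke_factor b) = (if b = a then l else 0)" if "norm b < 1" for b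
  proof (cases "b = a \<and> l \<noteq> 0")
    case True
    then show ?thesis using blaschke_form_ord[OF form, of 0] by (simp add: M_def)
  next
    case False
    then have "b \<notin> (\<lambda>_. a) ` M" by (auto simp: M_def)
    with blaschke_form_ord_0[OF form hol that] False show ?thesis by auto
  qed
  then have "{szego b j | b j. norm b < 1 \<and> j < ord_at \<phi> (blaschke_factor b)} = {szego a j | j. j < l}"
    using a by (auto split: if_splits) (metis less_nat_zero_code)
  then show ?thesis using model_space_blaschke_form[OF form hol] by (simp add: \<phi>_def)
qed

section \<open>Divisibility and orders of zeros\<close>

lemma ball_iff: "z \<in> ball 0 1 \<longleftrightarrow> norm (z::complex) < 1"
  by simp

definition unimodular_limit :: "(complex \<Rightarrow> complex) \<Rightarrow> real \<Rightarrow> bool" where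
  "unimodular_limit \<phi> t \<longleftrightarrow> (\<exists>l. ((\<lambda>r. \<phi> (complex_of_real r * cis t)) \<longlongrightarrow> l) (at_left 1) \<and> norm l = 1)"

lemma inner_function_iff:
  "inner_function \<phi> \<longleftrightarrow> \<phi> holomorphic_on ball 0 1 \<and> bounded (\<phi> ` ball 0 1) \<and>
    (AE t in lborel. t \<in> {0..2 * pi} \<longrightarrow> unimodular_limit \<phi> t)"
  unfolding inner_function_def unimodular_limit_def ..

lemma unimodular_limit_mult:
  assumes "unimodular_limit \<phi> t" "unimodular_limit \<psi> t"
  shows "unimodular_limit (\<lambda>z. \<phi> z * \<psi> z) t"
proof -
  from assms obtain l m where "((\<lambda>r. \<phi> (complex_of_real r * cis t)) \<longlongrightarrow> l) (at_left 1)" "norm l = 1"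
    "((\<lambda>r. \<psi> (complex_of_real r * cis t)) \<longlongrightarrow> m) (at_left 1)" "norm m = 1"
    unfolding unimodular_limit_def by blast
  then show ?thesis
    unfolding unimodular_limit_def by (intro exI[of _ "l * m"] conjI tendsto_mult) (auto simp: norm_mult)
qed

lemma inner_function_mult:
  assumes "inner_function \<phi>" "inner_function \<psi>"
  shows "inner_function (\<lambda>z. \<phi> z * \<psi> z)"
  unfolding inner_function_iff
proof (intro conjI)
  show "(\<lambda>z. \<phi> z * \<psi> z) holomorphic_on ball 0 1"
    using assms by (auto simp: inner_function_def intro!: holomorphic_intros)
  obtain C D where "\<And>z. z \<in> ball 0 1 \<Longrightarrow> norm (\<phi> z) \<le> C" "\<And>z. z \<in> ball 0 1 \<Longrightarrow> norm (\<psi> z) \<le> D"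
    using assms unfolding inner_function_def bounded_iff by blast
  then have "norm (\<phi> z * \<psi> z) \<le> C * D" if "z \<in> ball 0 1" for z
    unfolding norm_mult using that by (intro mult_mono) (auto intro: order_trans[OF norm_ge_zero])
  then show "bounded ((\<lambda>z. \<phi> z * \<psi> z) ` ball 0 1)" unfolding bounded_iff by blast
  have "AE t in lborel. t \<in> {0..2 * pi} \<longrightarrow> unimodular_limit \<phi> t"
    "AE t in lborel. t \<in> {0..2 * pi} \<longrightarrow> unimodular_limit \<psi> t"
    using assms by (simp_all add: inner_function_iff)
  then show "AE t in lborel. t \<in> {0..2 * pi} \<longrightarrow> unimodular_limit (\<lambda>z. \<phi> z * \<psi> z) t"
    by eventually_elim (simp add: unimodular_limit_mult)
qed

lemma inner_dvd_refl: "inner_dvd \<phi> \<phi>"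
proof -
  have "inner_function (\<lambda>_. 1)"
    unfolding inner_function_def by (auto intro!: exI[of _ 1] simp: image_constant_conv)
  then show ?thesis unfolding inner_dvd_def by (intro exI[of _ "\<lambda>_. 1"]) simp
qed

lemma inner_dvd_trans:
  assumes "inner_dvd \<phi> \<psi>" "inner_dvd \<psi> \<omega>"
  shows "inner_dvd \<phi> \<omega>"
proof -
  from assms obtain \<theta> \<eta> where "inner_function \<theta>" "inner_function \<eta>"
    "\<forall>z\<in>ball 0 1. \<psi> z = \<phi> z * \<theta> z" "\<forall>z\<in>ball 0 1. \<omega> z = \<psi> z * \<eta> z"
    unfolding inner_dvd_def by blast
  then show ?thesis unfolding inner_dvd_def
    by (intro exI[of _ "\<lambda>z. \<theta> z * \<eta> z"]) (simp add: inner_function_mult mult.assoc)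
qed

lemma increasing_seq_dvd:
  assumes "increasing_seq \<phi>" "k \<le> k'"
  shows "inner_dvd (\<phi> k) (\<phi> k')"
  using assms(2)
proof (induction rule: int_ge_induct)
  case (step i)
  with assms(1) show ?case unfolding increasing_seq_def using inner_dvd_trans by blast
qed (rule inner_dvd_refl)

lemma decreasing_seq_dvd:
  assumes "decreasing_seq \<phi>" "k \<le> k'"
  shows "inner_dvd (\<phi> k') (\<phi> k)"
  using assms(2)
proof (induction rule: int_ge_induct)
  case (step i)
  with assms(1) show ?case unfolding decreasing_seq_def using inner_dvd_trans by blast
qed (rule inner_dvd_refl)

abbreviation zord :: "(complex \<Rightarrow> complex) \<Rightarrow> complex \<Rightarrow> nat" where
  "zord \<phi> a \<equiv> ord_at \<phi> (blaschke_factor a)"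

lemma power_factor_le:
  fixes f g :: "complex \<Rightarrow> complex"
  assumes "norm a < 1" "continuous_on (ball 0 1) f" "continuous_on (ball 0 1) g" "f a \<noteq> 0"
    and eq: "\<And>z. norm z < 1 \<Longrightarrow> (z - a) ^ m * f z = (z - a) ^ n * g z"
  shows "n \<le> m"
proof (rule ccontr)
  assume "\<not> n \<le> m"
  then obtain d where n: "n = m + Suc d" using less_imp_Suc_add by (metis add_Suc_right not_le)
  have "f a = (a - a) ^ Suc d * g a"
  proof (rule continuous_eq_at_point[where f = f and g = "\<lambda>z. (z - a) ^ Suc d * g z" and a = a])
    show "continuous_on (ball 0 1) f" "norm a < 1" by (rule assms)+
    show "continuous_on (ball 0 1) (\<lambda>z. (z - a) ^ Suc d * g z)" by (intro continuous_intros assms)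
    show "f z = (z - a) ^ Suc d * g z" if "norm z < 1" "z \<noteq> a" for z
      using eq[OF that(1)] that(2) by (simp add: n power_add)
  qed
  with assms(4) show False by simp
qed

lemma inner_function_continuous: "inner_function \<phi> \<Longrightarrow> continuous_on (ball 0 1) \<phi>"
  unfolding inner_function_def using holomorphic_on_imp_continuous_on by blast

lemma inner_dvd_ord_le:
  assumes \<psi>: "blaschke_product \<psi>" and \<phi>: "blaschke_product \<phi>" and dvd: "inner_dvd \<psi> \<phi>" and a: "norm a < 1"
  shows "zord \<psi> a \<le> zord \<phi> a"
proof -
  obtain f where f: "f holomorphic_on ball 0 1" "f a \<noteq> 0" "\<And>z. norm z < 1 \<Longrightarrow> \<phi> z = (z - a) ^ zord \<phi> a * f z"
    using blaschke_factorization[OF \<phi> a] by blast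
  obtain g where g: "g holomorphic_on ball 0 1" "\<And>z. norm z < 1 \<Longrightarrow> \<psi> z = (z - a) ^ zord \<psi> a * g z"
    using blaschke_factorization[OF \<psi> a] by blast
  obtain \<theta> where \<theta>: "inner_function \<theta>" "\<And>z. norm z < 1 \<Longrightarrow> \<phi> z = \<psi> z * \<theta> z"
    using dvd by (auto simp: inner_dvd_def)
  show ?thesis
  proof (rule power_factor_le[where f = f, OF a _ _ f(2)])
    show "continuous_on (ball 0 1) f" using f(1) by (rule holomorphic_on_imp_continuous_on)
    show "continuous_on (ball 0 1) (\<lambda>z. g z * \<theta> z)"
      using holomorphic_on_imp_continuous_on[OF g(1)] inner_function_continuous[OF \<theta>(1)] by (rule continuous_on_mult)
    show "(z - a) ^ zord \<phi> a * f z = (z - a) ^ zord \<psi> a * (g z * \<theta> z)" if "norm z < 1" for z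
      using f(3)[OF that] g(2)[OF that] \<theta>(2)[OF that] by (simp only: mult.assoc)
  qed
qed

lemma ex_disc_fun_inner:
  assumes "inner_function \<theta>"
  shows "\<exists>u. \<forall>z. norm z < 1 \<longrightarrow> disc_fun u z = \<theta> z"
proof -
  obtain C where "\<And>z. z \<in> ball 0 1 \<Longrightarrow> norm (\<theta> z) \<le> C"
    using assms unfolding inner_function_def bounded_iff by blast
  with assms show ?thesis by (intro ex_disc_fun_bounded[of \<theta> C]) (auto simp: inner_function_def)
qed

lemma inner_dvd_hardy:
  assumes "inner_dvd \<psi> \<phi>"
  shows "\<exists>u. \<forall>z. norm z < 1 \<longrightarrow> \<phi> z = \<psi> z * disc_fun u z"
proof -
  obtain \<theta> where \<theta>: "inner_function \<theta>" "\<And>z. norm z < 1 \<Longrightarrow> \<phi> z = \<psi> z * \<theta> z"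
    using assms by (auto simp: inner_dvd_def)
  obtain u where "\<forall>z. norm z < 1 \<longrightarrow> disc_fun u z = \<theta> z"
    using ex_disc_fun_inner[OF \<theta>(1)] by blast
  with \<theta>(2) show ?thesis by (intro exI[of _ u]) simp
qed

lemma inner_dvd_ord_less:
  assumes \<psi>: "blaschke_product \<psi>" and \<phi>: "blaschke_product \<phi>" and dvd: "inner_dvd \<psi> \<phi>" and a: "norm a < 1"
    and less: "zord \<psi> a < zord \<phi> a"
  shows "\<exists>u. \<forall>z. norm z < 1 \<longrightarrow> \<phi> z = \<psi> z * ((z - a) * disc_fun u z)"
proof -
  obtain f where f: "f holomorphic_on ball 0 1" "\<And>z. norm z < 1 \<Longrightarrow> \<phi> z = (z - a) ^ zord \<phi> a * f z"
    using blaschke_factorization[OF \<phi> a] by blast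
  obtain g where g: "g holomorphic_on ball 0 1" "g a \<noteq> 0" "\<And>z. norm z < 1 \<Longrightarrow> \<psi> z = (z - a) ^ zord \<psi> a * g z"
    using blaschke_factorization[OF \<psi> a] by blast
  obtain v where v: "\<And>z. norm z < 1 \<Longrightarrow> \<phi> z = \<psi> z * disc_fun v z"
    using inner_dvd_hardy[OF dvd] by blast
  have "disc_fun v a = 0"
  proof (rule ccontr)
    assume nz: "disc_fun v a \<noteq> 0"
    have "zord \<phi> a \<le> zord \<psi> a"
    proof (rule power_factor_le[OF a])
      show "continuous_on (ball 0 1) (\<lambda>z. g z * disc_fun v z)"
        using holomorphic_on_imp_continuous_on[OF g(1)] holomorphic_on_imp_continuous_on[OF disc_fun_holomorphic]
        by (rule continuous_on_mult)
      show "continuous_on (ball 0 1) f" using f(1) by (rule holomorphic_on_imp_continuous_on)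
      show "g a * disc_fun v a \<noteq> 0" using g(2) nz by simp
      show "(z - a) ^ zord \<psi> a * (g z * disc_fun v z) = (z - a) ^ zord \<phi> a * f z" if "norm z < 1" for z
        using f(2)[OF that] g(3)[OF that] v[OF that] by (simp only: mult.assoc)
    qed
    with less show False by simp
  qed
  from mult_sub_dvd[OF a this] obtain u where "v = mult_sub a u" by blast
  with v show ?thesis by (intro exI[of _ u]) (simp add: disc_fun_mult_sub)
qed

lemma blaschke_product_quotient:
  assumes \<phi>: "blaschke_product \<phi>" and a: "norm a < 1" and n: "zord \<phi> a = Suc n"
  shows "\<exists>h u. h = (mult_sub a ^^ n) u \<and> disc_fun u a \<noteq> 0 \<and> (\<forall>z. norm z < 1 \<longrightarrow> \<phi> z = (z - a) * disc_fun h z)"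
proof -
  obtain g where g: "\<And>z. norm z < 1 \<Longrightarrow> disc_fun g z = \<phi> z"
    using ex_disc_fun_inner[of \<phi>] \<phi> by (auto simp: blaschke_product_def)
  obtain \<theta> where \<theta>: "\<theta> holomorphic_on ball 0 1" "\<theta> a \<noteq> 0" "\<And>z. norm z < 1 \<Longrightarrow> \<phi> z = (z - a) ^ Suc n * \<theta> z"
    using blaschke_factorization[OF \<phi> a] n by auto
  obtain u where u: "g = (mult_sub a ^^ Suc n) u" "\<And>z. norm z < 1 \<Longrightarrow> disc_fun u z = \<theta> z"
    using mult_sub_funpow_dvd[OF a holomorphic_on_imp_continuous_on[OF \<theta>(1)], of g "Suc n"] g \<theta>(3) by auto
  show ?thesis
    by (rule exI[of _ "(mult_sub a ^^ n) u"], rule exI[of _ u])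
      (use u a \<theta>(2) in \<open>simp add: disc_fun_mult_sub flip: g\<close>)
qed

lemma blaschke_factor_radial_limit:
  assumes "norm a < 1"
  shows "((\<lambda>r. blaschke_factor a (complex_of_real r * cis t)) \<longlongrightarrow> blaschke_factor a (cis t)) (at_left 1)"
proof -
  have "((\<lambda>r. complex_of_real r * cis t) \<longlongrightarrow> complex_of_real 1 * cis t) (at_left 1)"
    by (intro tendsto_intros)
  then have "((\<lambda>r. complex_of_real r * cis t) \<longlongrightarrow> cis t) (at_left 1)" by simp
  then show ?thesis
    unfolding blaschke_factor_def
    by (intro tendsto_intros) (use one_minus_cnj_mult_nonzero[OF assms, of "cis t"] in auto)
qed

lemma inner_function_blaschke_factor:
  assumes "norm a < 1"
  shows "inner_function (blaschke_factor a)"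
  unfolding inner_function_iff
proof (intro conjI)
  show "blaschke_factor a holomorphic_on ball 0 1" by (rule blaschke_factor_holomorphic[OF assms])
  show "bounded (blaschke_factor a ` ball 0 1)"
    unfolding bounded_iff using norm_blaschke_factor(2)[OF assms] by (intro exI[of _ 1]) (auto intro: less_imp_le)
  have "unimodular_limit (blaschke_factor a) t" for t
    unfolding unimodular_limit_def
    using blaschke_factor_radial_limit[OF assms] norm_blaschke_factor(1)[OF assms, of "cis t"] by auto
  then show "AE t in lborel. t \<in> {0..2 * pi} \<longrightarrow> unimodular_limit (blaschke_factor a) t" by simp
qed

lemma blaschke_factor_inner_dvd:
  assumes \<phi>: "blaschke_product \<phi>" and a: "norm a < 1" and n: "zord \<phi> a \<ge> 1"
  shows "inner_dvd (blaschke_factor a) \<phi>"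
proof -
  have in\<phi>: "inner_function \<phi>" using \<phi> by (simp add: blaschke_product_def)
  obtain n where n: "zord \<phi> a = Suc n" using n by (cases "zord \<phi> a") auto
  obtain f where f: "f holomorphic_on ball 0 1" "\<And>z. norm z < 1 \<Longrightarrow> \<phi> z = (z - a) ^ Suc n * f z"
    using blaschke_factorization[OF \<phi> a] n by auto
  define \<theta> where "\<theta> z = (1 - cnj a * z) * ((z - a) ^ n * f z)" for z
  have eq: "\<phi> z = blaschke_factor a z * \<theta> z" if "norm z < 1" for z
    using one_minus_cnj_mult_nonzero[OF a, of z] that f(2)[OF that]
    by (simp add: blaschke_factor_def \<theta>_def)
  have hol: "\<theta> holomorphic_on ball 0 1" unfolding \<theta>_def by (intro holomorphic_intros f)
  have "inner_function \<theta>"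
    unfolding inner_function_iff
  proof (intro conjI hol)
    define \<rho> where "\<rho> = (1 + norm a) / 2"
    have \<rho>: "norm a < \<rho>" "\<rho> < 1" using a by (auto simp: \<rho>_def)
    obtain C where C: "\<And>z. norm z < 1 \<Longrightarrow> norm (\<phi> z) \<le> C"
      using in\<phi> unfolding inner_function_def bounded_iff ball_simps ball_iff[symmetric] by blast
    have "bounded (\<theta> ` cball 0 \<rho>)"
      using \<rho> by (intro compact_imp_bounded compact_continuous_image
          continuous_on_subset[OF holomorphic_on_imp_continuous_on[OF hol]]) auto
    moreover have "norm (\<theta> z) \<le> C * (2 / (\<rho> - norm a))" if z: "norm z < 1" "\<not> norm z \<le> \<rho>" for z
    proof -
      have nz: "1 - cnj a * z \<noteq> 0" using one_minus_cnj_mult_nonzero[OF a, of z] z by simp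
      have za: "norm (z - a) \<ge> \<rho> - norm a" using norm_triangle_ineq2[of z a] z by linarith
      have "norm (1 - cnj a * z) \<le> norm (1::complex) + norm (cnj a * z)" by (rule norm_triangle_ineq4)
      also have "norm (cnj a * z) \<le> 1 * 1" unfolding norm_mult using z a by (intro mult_mono) auto
      finally have "norm (1 - cnj a * z) \<le> 2" by simp
      then have "norm (1 - cnj a * z) / norm (z - a) \<le> 2 / (\<rho> - norm a)"
        using za \<rho> by (intro frac_le) auto
      moreover have "C \<ge> 0" using C[OF z(1)] order_trans[OF norm_ge_zero] by blast
      ultimately have "norm (\<phi> z) * (norm (1 - cnj a * z) / norm (z - a)) \<le> C * (2 / (\<rho> - norm a))"
        using C[OF z(1)] by (intro mult_mono) auto
      moreover have "z \<noteq> a" using z \<rho> by auto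
      then have "norm (\<theta> z) = norm (\<phi> z) * (norm (1 - cnj a * z) / norm (z - a))"
        using nz by (simp add: eq[OF z(1)] blaschke_factor_def norm_mult norm_divide)
      ultimately show ?thesis by simp
    qed
    then have "bounded (\<theta> ` {z. norm z < 1 \<and> \<not> norm z \<le> \<rho>})" unfolding bounded_iff by blast
    ultimately have "bounded (\<theta> ` cball 0 \<rho> \<union> \<theta> ` {z. norm z < 1 \<and> \<not> norm z \<le> \<rho>})" by simp
    then show "bounded (\<theta> ` ball 0 1)" by (rule bounded_subset) auto
    have "AE t in lborel. t \<in> {0..2 * pi} \<longrightarrow> unimodular_limit \<phi> t"
      using in\<phi> by (simp add: inner_function_iff)
    then show "AE t in lborel. t \<in> {0..2 * pi} \<longrightarrow> unimodular_limit \<theta> t"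
    proof eventually_elim
      case (elim t)
      have b1: "norm (blaschke_factor a (cis t)) = 1" using norm_blaschke_factor(1)[OF a] by simp
      show ?case
      proof
        assume "t \<in> {0..2 * pi}"
        with elim obtain l where l: "((\<lambda>r. \<phi> (complex_of_real r * cis t)) \<longlongrightarrow> l) (at_left 1)" "norm l = 1"
          unfolding unimodular_limit_def by blast
        have "((\<lambda>r. \<phi> (complex_of_real r * cis t) / blaschke_factor a (complex_of_real r * cis t))
            \<longlongrightarrow> l / blaschke_factor a (cis t)) (at_left 1)"
          using b1 by (intro tendsto_divide l blaschke_factor_radial_limit[OF a]) auto
        moreover have "\<forall>\<^sub>F r in at_left (1::real). r \<in> {norm a<..<1}"
          by (rule eventually_at_left_real[OF a])
        then have "\<forall>\<^sub>F r in at_left (1::real). \<phi> (complex_of_real r * cis t) / blaschke_factor a (complex_of_real r * cis t)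
            = \<theta> (complex_of_real r * cis t)"
        proof eventually_elim
          case (elim r)
          then have r: "norm (complex_of_real r * cis t) = r" using norm_ge_zero[of a]
            by (simp add: norm_mult del: norm_ge_zero)
          then have "complex_of_real r * cis t \<noteq> a" "norm (complex_of_real r * cis t) < 1" using elim by auto
          then show ?case using a by (simp add: eq blaschke_factor_eq_0_iff)
        qed
        ultimately have "((\<lambda>r. \<theta> (complex_of_real r * cis t)) \<longlongrightarrow> l / blaschke_factor a (cis t)) (at_left 1)"
          by (rule Lim_transform_eventually)
        then show "unimodular_limit \<theta> t"
          unfolding unimodular_limit_def using l(2) b1
          by (intro exI[of _ "l / blaschke_factor a (cis t)"]) (simp add: norm_divide)
      qed
    qed
  qed
  then show ?thesis unfolding inner_dvd_def using eq by auto
qed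

lemma blaschke_factor_inner_dvd_iff:
  assumes \<phi>: "blaschke_product \<phi>" and a: "norm a < 1"
  shows "inner_dvd (blaschke_factor a) \<phi> \<longleftrightarrow> zord \<phi> a \<ge> 1"
proof
  assume "inner_dvd (blaschke_factor a) \<phi>"
  then have "\<phi> a = 0" using a by (auto simp: inner_dvd_def blaschke_factor_def)
  moreover obtain f where "f a \<noteq> 0" "\<phi> a = (a - a) ^ zord \<phi> a * f a"
    using blaschke_factorization[OF assms] a by blast
  ultimately show "zord \<phi> a \<ge> 1" by (cases "zord \<phi> a") auto
qed (rule blaschke_factor_inner_dvd[OF assms])

lemma ex_zord_eq_0:
  assumes "no_common_inner_factor \<phi>" "\<And>k. blaschke_product (\<phi> k)" and a: "norm a < 1"
  shows "\<exists>k. zord (\<phi> k) a = 0"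
proof (rule ccontr)
  assume "\<not> ?thesis"
  then have "zord (\<phi> k) a \<ge> 1" for k by (simp add: Suc_leI)
  then have "\<forall>k. inner_dvd (blaschke_factor a) (\<phi> k)"
    using blaschke_factor_inner_dvd assms(2) a by blast
  with assms(1) inner_function_blaschke_factor[OF a]
  have "blaschke_factor a constant_on ball 0 1" unfolding no_common_inner_factor_def by blast
  then obtain y where y: "\<And>z. norm z < 1 \<Longrightarrow> blaschke_factor a z = y"
    unfolding constant_on_def by auto
  define b :: complex where "b = (if a = 0 then 1/2 else 0)"
  have "norm b < 1" "b \<noteq> a" by (auto simp: b_def)
  then have "blaschke_factor a b \<noteq> 0" "blaschke_factor a b = blaschke_factor a a"
    using a y by (auto simp: blaschke_factor_eq_0_iff)
  then show False using a by (simp add: blaschke_factor_eq_0_iff)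
qed

section \<open>Generated subspaces\<close>

lemma funpow_commute_funpow:
  assumes "\<And>x. S (T x) = T (S x)"
  shows "(S ^^ m) ((T ^^ n) x) = (T ^^ n) ((S ^^ m) x)"
proof -
  have 1: "S ((T ^^ n) x) = (T ^^ n) (S x)" for x
    by (induction n) (simp_all add: assms)
  show ?thesis by (induction m) (simp_all add: 1)
qed

definition commuting :: "('n \<Rightarrow> 'a \<Rightarrow> 'a) \<Rightarrow> bool" where
  "commuting T \<longleftrightarrow> (\<forall>i j x. T i (T j x) = T j (T i x))"

lemma comp_fun_commute_funpow:
  assumes "commuting T"
  shows "comp_fun_commute (\<lambda>i. T i ^^ m i)"
proof
  have "(T j ^^ m j) ((T i ^^ m i) x) = (T i ^^ m i) ((T j ^^ m j) x)" for i j x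
    by (rule funpow_commute_funpow) (use assms in \<open>simp add: commuting_def\<close>)
  then show "T j ^^ m j \<circ> T i ^^ m i = T i ^^ m i \<circ> T j ^^ m j" for i j
    by (simp add: fun_eq_iff)
qed

lemma fold_funpow_Suc:
  fixes T :: "'n::finite \<Rightarrow> 'a \<Rightarrow> 'a"
  assumes "commuting T"
  shows "T i (Finite_Set.fold (\<lambda>i. T i ^^ m i) h UNIV) =
    Finite_Set.fold (\<lambda>j. T j ^^ (m(i := Suc (m i))) j) h UNIV"
proof -
  interpret F: comp_fun_commute "\<lambda>i. T i ^^ m i" by (rule comp_fun_commute_funpow[OF assms])
  interpret G: comp_fun_commute "\<lambda>j. T j ^^ (m(i := Suc (m i))) j" by (rule comp_fun_commute_funpow[OF assms])
  have "Finite_Set.fold (\<lambda>i. T i ^^ m i) h (UNIV - {i}) =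
      Finite_Set.fold (\<lambda>j. T j ^^ (m(i := Suc (m i))) j) h (UNIV - {i})"
    by (rule Finite_Set.fold_cong[OF F.comp_fun_commute_on_axioms G.comp_fun_commute_on_axioms]) auto
  then show ?thesis
    using F.fold_rec[of UNIV i h] G.fold_rec[of UNIV i h] by simp
qed

lemma fold_funpow_mem:
  fixes T :: "'n::finite \<Rightarrow> 'a \<Rightarrow> 'a"
  assumes "commuting T" and T: "\<And>i x. x \<in> V \<Longrightarrow> T i x \<in> V" and h: "h \<in> V"
  shows "Finite_Set.fold (\<lambda>i. T i ^^ m i) h UNIV \<in> V"
proof -
  interpret F: comp_fun_commute "\<lambda>i. T i ^^ m i" by (rule comp_fun_commute_funpow[OF assms(1)])
  have pow: "x \<in> V \<Longrightarrow> (T i ^^ n) x \<in> V" for i n x by (induction n) (auto intro: T)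
  have "finite A \<Longrightarrow> Finite_Set.fold (\<lambda>i. T i ^^ m i) h A \<in> V" for A
    by (induction A rule: finite_induct) (auto simp: h F.fold_insert pow)
  then show ?thesis by simp
qed

lemma poly_apply_single:
  "poly_apply (Poly_Mapping.single m 1) T h =
    Finite_Set.fold (\<lambda>i. T i ^^ Poly_Mapping.lookup m i) h UNIV"
  by (simp add: poly_apply_def)

lemma closed_subspace_generated: "closed_subspace (generated T S)"
  unfolding generated_def by (rule closed_subspace_closed_span)

lemma generated_superset:
  assumes "commuting T"
  shows "S \<subseteq> generated T S"
proof
  fix h assume "h \<in> S"
  define g where "g i = T i ^^ (\<lambda>_. 0) i" for i
  interpret F: comp_fun_commute g unfolding g_def by (rule comp_fun_commute_funpow[OF assms])
  have "finite A \<Longrightarrow> Finite_Set.fold g h A = h" for A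
    by (induction A rule: finite_induct) (simp_all add: F.fold_insert, simp add: g_def)
  moreover have "g = (\<lambda>i. T i ^^ Poly_Mapping.lookup 0 i)" by (simp add: g_def fun_eq_iff)
  ultimately have "Finite_Set.fold (\<lambda>i. T i ^^ Poly_Mapping.lookup 0 i) h UNIV = h" by force
  then have "poly_apply (Poly_Mapping.single 0 1) T h = h" by (simp only: poly_apply_single)
  then have "h = poly_apply (Poly_Mapping.single 0 1) T h" by (rule sym)
  with \<open>h \<in> S\<close> have "h \<in> {poly_apply p T h | p h. h \<in> S}" by blast
  then show "h \<in> generated T S" unfolding generated_def by (rule subsetD[OF closed_span_superset])
qed

lemma generated_invariant:
  assumes comm: "commuting T" and T: "\<And>i. bounded_clinear (T i)"
    and x: "x \<in> generated T S"
  shows "T i x \<in> generated T S"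
  using x unfolding generated_def
proof (rule closed_span_image_subset[OF T closed_subspace_closed_span, rotated])
  fix y assume "y \<in> {poly_apply p T h |p h. h \<in> S}"
  then obtain p h where y: "y = poly_apply p T h" and h: "h \<in> S" by blast
  have Ty: "T i y = (\<Sum>m\<in>Poly_Mapping.keys p. cscale (Poly_Mapping.lookup p m)
      (T i (Finite_Set.fold (\<lambda>i. T i ^^ Poly_Mapping.lookup m i) h UNIV)))"
    unfolding y poly_apply_def bounded_clinearD(3,6)[OF T] ..
  show "T i y \<in> closed_span {poly_apply p T h |p h. h \<in> S}"
    unfolding Ty
  proof (intro closed_subspaceD(4,6)[OF closed_subspace_closed_span])
    fix m :: "_ \<Rightarrow>\<^sub>0 nat"
    define m' where "m' = m + Poly_Mapping.single i 1"
    have "(Poly_Mapping.lookup m)(i := Suc (Poly_Mapping.lookup m i)) = Poly_Mapping.lookup m'"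
      by (auto simp: m'_def lookup_add lookup_single when_def fun_eq_iff)
    then have "T i (Finite_Set.fold (\<lambda>i. T i ^^ Poly_Mapping.lookup m i) h UNIV) =
        poly_apply (Poly_Mapping.single m' 1) T h"
      by (simp add: poly_apply_single fold_funpow_Suc[OF comm])
    then show "T i (Finite_Set.fold (\<lambda>i. T i ^^ Poly_Mapping.lookup m i) h UNIV)
        \<in> closed_span {poly_apply p T h |p h. h \<in> S}"
      using h by (intro subsetD[OF closed_span_superset]) blast
  qed
qed

lemma generated_minimal:
  assumes comm: "commuting T" and V: "closed_subspace V"
    and T: "\<And>i x. x \<in> V \<Longrightarrow> T i x \<in> V" and "S \<subseteq> V"
  shows "generated T S \<subseteq> V"
  unfolding generated_def
proof (rule closed_span_minimal[OF _ V], safe)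
  fix p h assume "h \<in> S"
  then show "poly_apply p T h \<in> V"
    unfolding poly_apply_def using assms(4)
    by (intro closed_subspaceD(4,6)[OF V] fold_funpow_mem[OF comm] T) auto
qed

inductive op_alg :: "('n::finite \<Rightarrow> 'm::finite hardy \<Rightarrow> 'm hardy) \<Rightarrow> ('m hardy \<Rightarrow> 'm hardy) \<Rightarrow> bool"
  for T where
  op_alg_id: "op_alg T (\<lambda>x. x)"
| op_alg_gen: "op_alg T (T i)"
| op_alg_diff: "op_alg T D \<Longrightarrow> op_alg T E \<Longrightarrow> op_alg T (\<lambda>x. D x - E x)"
| op_alg_scale: "op_alg T D \<Longrightarrow> op_alg T (\<lambda>x. cscale c (D x))"
| op_alg_comp: "op_alg T D \<Longrightarrow> op_alg T E \<Longrightarrow> op_alg T (\<lambda>x. D (E x))"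

lemma op_alg_funpow: "op_alg T D \<Longrightarrow> op_alg T (\<lambda>x. (D ^^ n) x)"
proof (induction n)
  case (Suc n)
  then show ?case using op_alg_comp[of T D "\<lambda>x. (D ^^ n) x"] by simp
qed (simp add: op_alg_id id_def)

lemma op_alg_bounded_clinear:
  assumes "op_alg T D" "\<And>i. bounded_clinear (T i)"
  shows "bounded_clinear D"
  using assms
proof (induction rule: op_alg.induct)
  case op_alg_id
  then show ?case by (intro bounded_clinearI[where K = 1]) auto
next
  case (op_alg_diff D E)
  then have "bounded_clinear D" "bounded_clinear E" by auto
  then show ?case
    unfolding bounded_clinear_def by (auto intro!: bounded_linear_sub simp: hardy.scale_right_diff_distrib)
next
  case (op_alg_scale D c)
  then have "bounded_clinear D" by auto
  then show ?case
    using bounded_linear_compose[OF bounded_clinearD(1)[OF bounded_clinear_cscale[of c]], of D]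
    by (auto simp: bounded_clinear_def mult.commute)
next
  case (op_alg_comp D E)
  then have "bounded_clinear D" "bounded_clinear E" by auto
  then show ?case
    using bounded_linear_compose[of D E] by (auto simp: bounded_clinear_def)
qed auto

lemma op_alg_mem:
  assumes "op_alg T D" "closed_subspace V" "\<And>i x. x \<in> V \<Longrightarrow> T i x \<in> V" "x \<in> V"
  shows "D x \<in> V"
  using assms(1,4)
  by (induction arbitrary: x rule: op_alg.induct) (auto intro: closed_subspaceD[OF assms(2)] assms(3))

text \<open>The weights \<open>c m\<close> decay so fast that applying the operator which isolates \<open>y m j\<close> among the
  first \<open>N\<close> terms leaves a remainder of norm at most \<open>2\<^sup>-\<^sup>N\<close>.\<close>

lemma ex_common_generators:
  fixes y :: "nat \<Rightarrow> nat \<Rightarrow> 'm::finite hardy" and T :: "'n::finite \<Rightarrow> 'm hardy \<Rightarrow> 'm hardy"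
  assumes T: "\<And>i. bounded_clinear (T i)"
    and sep: "\<And>m N. \<exists>D. op_alg T D \<and> (\<forall>j<r. D (y m j) = y m j \<and> (\<forall>k\<le>N. k \<noteq> m \<longrightarrow> D (y k j) = 0))"
  shows "\<exists>h. (\<forall>j<r. h j \<in> closed_span (\<Union>m. {y m j})) \<and>
    (\<forall>V. closed_subspace V \<longrightarrow> (\<forall>i. \<forall>x\<in>V. T i x \<in> V) \<longrightarrow> (\<forall>j<r. h j \<in> V) \<longrightarrow> (\<forall>m. \<forall>j<r. y m j \<in> V))"
proof -
  obtain D where D: "\<And>m N. op_alg T (D m N)" "\<And>m N j. j < r \<Longrightarrow> D m N (y m j) = y m j"
    "\<And>m N j k. j < r \<Longrightarrow> k \<le> N \<Longrightarrow> k \<noteq> m \<Longrightarrow> D m N (y k j) = 0"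
    using sep by metis
  have lin: "bounded_clinear (D m N)" for m N using op_alg_bounded_clinear[OF D(1) T] .
  have "\<exists>K>0. \<forall>x. norm (D m N x) \<le> norm x * K" for m N
    using bounded_linear.pos_bounded[OF bounded_clinearD(1)[OF lin]] .
  then obtain K where K: "\<And>m N. K m N > 0" "\<And>m N x. norm (D m N x) \<le> norm x * K m N" by metis
  define s where "s n = 1 + (\<Sum>m<n. \<Sum>N<n. K m N)" for n
  define t where "t n = 1 + (\<Sum>j<r. norm (y n j))" for n
  have s1: "s n \<ge> 1" for n using K(1) by (simp add: s_def sum_nonneg less_imp_le)
  have t1: "t n \<ge> 1" for n by (simp add: t_def sum_nonneg)
  have Ks: "K m N \<le> s n" if "m < n" "N < n" for m N n
  proof -
    have "K m N \<le> (\<Sum>N<n. K m N)" using that K(1) by (intro member_le_sum) (auto simp: less_imp_le)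
    also have "\<dots> \<le> (\<Sum>m<n. \<Sum>N<n. K m N)"
      using that K(1) by (intro member_le_sum[of m _ "\<lambda>m. \<Sum>N<n. K m N"]) (auto simp: less_imp_le intro!: sum_nonneg)
    finally show ?thesis by (simp add: s_def)
  qed
  have yt: "norm (y n j) \<le> t n" if "j < r" for n j
  proof -
    have "norm (y n j) \<le> (\<Sum>j<r. norm (y n j))" using that by (intro member_le_sum) auto
    then show ?thesis by (simp add: t_def)
  qed
  define c where "c n = (1 / 2) ^ n / (s n * t n)" for n
  have c0: "c n > 0" for n using s1[of n] t1[of n] by (simp add: c_def)
  define z where "z j n = c n *\<^sub>R y n j" for j n
  have zs: "norm (z j n) * s n \<le> (1 / 2) ^ n" if "j < r" for j n
  proof -
    have "norm (z j n) * s n = c n * s n * norm (y n j)" using c0[of n] by (simp add: z_def)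
    also have "\<dots> \<le> c n * s n * t n" using yt[OF that] c0[of n] s1[of n] by (intro mult_left_mono) auto
    also have "\<dots> = (1 / 2) ^ n" using s1[of n] t1[of n] by (simp add: c_def)
    finally show ?thesis .
  qed
  have z: "norm (z j n) \<le> (1 / 2) ^ n" if "j < r" for j n
  proof -
    have "norm (z j n) * 1 \<le> norm (z j n) * s n" using s1 by (intro mult_left_mono) auto
    with zs[OF that, of n] show ?thesis by simp
  qed
  have sm: "summable (z j)" if "j < r" for j
    by (rule summable_comparison_test'[of "\<lambda>n. (1 / 2) ^ n" 0]) (use z[OF that] in \<open>simp_all add: summable_geometric\<close>)
  define h where "h j = suminf (z j)" for j
  have "h j \<in> closed_span (\<Union>m. {y m j})" if "j < r" for j
  proof (rule closed_sequentially[OF closed_subspaceD(1)[OF closed_subspace_closed_span]])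
    show "(\<lambda>n. \<Sum>i<n. z j i) \<longlonglongrightarrow> h j" unfolding h_def using sm[OF that] by (rule summable_LIMSEQ)
    show "(\<Sum>i<n. z j i) \<in> closed_span (\<Union>m. {y m j})" for n
      unfolding z_def scaleR_eq_cscale
      by (intro closed_subspaceD(4,6)[OF closed_subspace_closed_span] subsetD[OF closed_span_superset]) blast
  qed
  moreover have "y m j \<in> V"
    if V: "closed_subspace V" and inv: "\<forall>i. \<forall>x\<in>V. T i x \<in> V" and hV: "\<forall>j<r. h j \<in> V" and j: "j < r" for V m j
  proof -
    have est: "norm (D m N (h j) - z j m) \<le> (1 / 2) ^ N" if N: "N \<ge> m" for N
    proof -
      have DL: "bounded_linear (D m N)" using lin by (rule bounded_clinearD(1))
      have Dz: "summable (\<lambda>n. D m N (z j n))" "D m N (h j) = suminf (\<lambda>n. D m N (z j n))"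
        unfolding h_def using bounded_linear.summable[OF DL sm[OF j]] bounded_linear.suminf[OF DL sm[OF j]] by auto
      have small: "D m N (z j k) = (if k = m then z j m else 0)" if "k < Suc N" for k
        using D(2,3)[OF j] that by (auto simp: z_def linear_cmul[OF bounded_linear.linear[OF DL]] less_Suc_eq_le)
      have "(\<Sum>k<Suc N. D m N (z j k)) = (\<Sum>k<Suc N. if k = m then z j m else 0)"
        by (intro sum.cong refl small) simp
      also have "\<dots> = z j m" using N by (simp add: less_Suc_eq_le del: sum.lessThan_Suc)
      finally have "D m N (h j) - z j m = suminf (\<lambda>k. D m N (z j (k + Suc N)))"
        using suminf_minus_initial_segment[OF Dz(1), of "Suc N"] Dz(2) by simp
      also have "norm \<dots> \<le> suminf (\<lambda>k. (1 / 2) ^ Suc N * (1 / 2) ^ k)"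
      proof (rule norm_suminf_le)
        show "summable (\<lambda>k. (1 / 2 :: real) ^ Suc N * (1 / 2) ^ k)"
          by (intro summable_mult summable_geometric) simp
        fix k
        have "norm (D m N (z j (k + Suc N))) \<le> norm (z j (k + Suc N)) * K m N" by (rule K(2))
        also have "\<dots> \<le> norm (z j (k + Suc N)) * s (k + Suc N)"
          using N by (intro mult_left_mono Ks) auto
        also have "\<dots> \<le> (1 / 2) ^ (k + Suc N)" by (rule zs[OF j])
        finally show "norm (D m N (z j (k + Suc N))) \<le> (1 / 2) ^ Suc N * (1 / 2) ^ k"
          by (simp add: power_add mult_ac)
      qed
      also have "\<dots> = (1 / 2) ^ Suc N * 2"
        using suminf_geometric[of "1/2 :: real"] by (subst suminf_mult) (auto simp: summable_geometric)
      finally show ?thesis by simp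
    qed
    have "(\<lambda>N. D m N (h j)) \<longlonglongrightarrow> z j m"
    proof (rule Lim_transform_bound[where g = "\<lambda>N. (1/2::real) ^ N", THEN LIM_zero_cancel])
      show "\<forall>\<^sub>F N in sequentially. norm (D m N (h j) - z j m) \<le> norm ((1 / 2::real) ^ N)"
        unfolding eventually_sequentially using est by (intro exI[of _ m]) (auto simp: norm_power)
      show "(\<lambda>N. (1 / 2::real) ^ N) \<longlonglongrightarrow> 0" by (rule LIMSEQ_power_zero) simp
    qed
    moreover have "D m N (h j) \<in> V" for N
      using op_alg_mem[OF D(1) V] inv hV j by blast
    ultimately have "z j m \<in> V"
      using closed_sequentially[OF closed_subspaceD(1)[OF V], of "\<lambda>N. D m N (h j)" "z j m"] by simp
    then have "cscale (complex_of_real (1 / c m)) (z j m) \<in> V" by (rule closed_subspaceD(4)[OF V])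
    then show ?thesis using c0[of m] by (simp add: z_def scaleR_eq_cscale flip: of_real_mult)
  qed
  ultimately show ?thesis by blast
qed

section \<open>Tensors of kernel functions\<close>

lemma backward_shift_tensor:
  "backward_shift i (tensor f) = tensor (f(i := backward_shift 1 (f i)))"
proof (rule hardy_eqI)
  fix k
  have "hardy_coeff (tensor f) (k(i := Suc (k i))) =
      disc_coeff (f i) (Suc (k i)) * (\<Prod>j\<in>UNIV - {i}. disc_coeff (f j) (k j))"
    using hardy_coeff_tensor_upd[of f i "f i" "k(i := Suc (k i))"] by simp
  then show "hardy_coeff (backward_shift i (tensor f)) k = hardy_coeff (tensor (f(i := backward_shift 1 (f i)))) k"
    by (simp only: hardy_coeff_backward_shift hardy_coeff_tensor_upd disc_coeff_backward_shift)
qed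

lemma Mz_tensor: "Mz i (tensor f) = tensor (f(i := Mz 1 (f i)))"
proof (rule hardy_eqI)
  fix k
  have "hardy_coeff (tensor f) (k(i := k i - 1)) =
      disc_coeff (f i) (k i - 1) * (\<Prod>j\<in>UNIV - {i}. disc_coeff (f j) (k j))"
    using hardy_coeff_tensor_upd[of f i "f i" "k(i := k i - 1)"] by simp
  then show "hardy_coeff (Mz i (tensor f)) k = hardy_coeff (tensor (f(i := Mz 1 (f i)))) k"
    by (simp only: hardy_coeff_Mz hardy_coeff_tensor_upd disc_coeff_Mz) simp
qed

definition ktensor :: "('n::finite \<Rightarrow> complex) \<Rightarrow> ('n \<Rightarrow> nat) \<Rightarrow> 'n hardy" where
  "ktensor p j = tensor (\<lambda>i. szego (p i) (j i))"

definition shift_sub :: "'n::finite \<Rightarrow> complex \<Rightarrow> 'n hardy \<Rightarrow> 'n hardy" where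
  "shift_sub i a x = backward_shift i x - cscale (cnj a) x"

lemma shift_sub_ktensor:
  assumes p: "norm (p i) < 1"
  shows "shift_sub i (p i) (ktensor p j) = (if j i = 0 then 0 else ktensor p (j(i := j i - 1)))"
proof -
  define f where "f = (\<lambda>i. szego (p i) (j i))"
  note lin = bounded_clinearD[OF bounded_clinear_tensor_upd[of f i]]
  have "cscale (cnj (p i)) (tensor f) = tensor (f(i := cscale (cnj (p i)) (f i)))"
    using lin(3)[of "cnj (p i)" "f i"] by simp
  then have "shift_sub i (p i) (tensor f) = tensor (f(i := backward_shift 1 (f i) - cscale (cnj (p i)) (f i)))"
    by (simp only: shift_sub_def backward_shift_tensor lin(4))
  also have "\<dots> = (if j i = 0 then 0 else tensor (f(i := szego (p i) (j i - 1))))"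
    using lin(5) by (cases "j i") (simp_all add: f_def backward_shift_szego_0[OF p] backward_shift_szego_Suc[OF p])
  also have "f(i := szego (p i) (j i - 1)) = (\<lambda>l. szego (p l) ((j(i := j i - 1)) l))"
    by (simp add: f_def fun_eq_iff)
  finally show ?thesis by (simp add: ktensor_def f_def)
qed

lemma backward_shift_ktensor:
  assumes "norm (p i) < 1"
  shows "backward_shift i (ktensor p j) =
    cscale (cnj (p i)) (ktensor p j) + (if j i = 0 then 0 else ktensor p (j(i := j i - 1)))"
  using shift_sub_ktensor[of p i j, OF assms] unfolding shift_sub_def by (simp only: diff_eq_eq add.commute)

lemma commuting_backward_shift: "commuting backward_shift"
  unfolding commuting_def using backward_shift_commute by blast

lemma op_alg_shift_sub: "op_alg backward_shift (shift_sub i a)"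
  unfolding shift_sub_def[abs_def] by (intro op_alg.intros)

lemma op_alg_commute:
  assumes D: "op_alg T D" and E: "op_alg T E" and comm: "commuting T" and T: "\<And>i. bounded_clinear (T i)"
  shows "D (E x) = E (D x)"
proof -
  have gen: "D (T i x) = T i (D x)" if "op_alg T D" for D i x
    using that
  proof (induction arbitrary: x rule: op_alg.induct)
    case (op_alg_gen k)
    then show ?case using comm by (simp add: commuting_def)
  qed (simp_all add: bounded_clinearD[OF T])
  note lin = bounded_clinearD[OF op_alg_bounded_clinear[OF D T]]
  show ?thesis using E
  proof (induction arbitrary: x rule: op_alg.induct)
    case (op_alg_gen k)
    then show ?case by (rule gen[OF D])
  qed (simp_all add: lin)
qed

lemma nilpotent_chain:
  fixes A :: "'n::finite hardy \<Rightarrow> 'n hardy"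
  assumes A: "\<And>t x. x \<in> G (Suc t) \<Longrightarrow> A x \<in> G t" "G 0 = {0}" "A 0 = 0"
  shows "x \<in> G t \<Longrightarrow> t \<le> n \<Longrightarrow> (A ^^ n) x = 0"
proof (induction n arbitrary: t x)
  case 0
  then show ?case using A(2) by simp
next
  case (Suc n)
  have "(A ^^ n) (A x) = 0"
  proof (cases t)
    case 0
    then show ?thesis using Suc.IH[of "A x" 0] Suc.prems A by simp
  next
    case (Suc t')
    then show ?thesis using Suc.IH[of "A x" t'] Suc.prems A by simp
  qed
  then show ?case by (simp add: funpow_Suc_right del: funpow.simps)
qed

text \<open>With \<open>u\<close> nilpotent at \<open>q\<close> and unipotent at \<open>p\<close>, the operator \<open>1 - (1 - u\<^sup>L)\<^sup>L\<close> vanishes at \<open>q\<close> and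
  is the identity at \<open>p\<close>.\<close>

lemma ex_separating_operator:
  fixes p q :: "'n::finite \<Rightarrow> complex"
  assumes p: "\<And>i. norm (p i) < 1" and q: "\<And>i. norm (q i) < 1" and "p \<noteq> q"
  shows "\<exists>w. op_alg backward_shift w \<and>
    (\<forall>j. (\<forall>i. j i < L) \<longrightarrow> w (ktensor p j) = ktensor p j \<and> w (ktensor q j) = 0)"
proof -
  obtain i where i: "p i \<noteq> q i" using \<open>p \<noteq> q\<close> by blast
  define c where "c = 1 / (cnj (p i) - cnj (q i))"
  have c: "c * (cnj (p i) - cnj (q i)) = 1" using i by (simp add: c_def)
  define u where "u = (\<lambda>x. cscale c (shift_sub i (q i) x))"
  define A where "A = (\<lambda>x. x - (u ^^ L) x)"
  define w where "w = (\<lambda>x. x - (A ^^ L) x)"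
  have ou: "op_alg backward_shift u" unfolding u_def by (intro op_alg_scale op_alg_shift_sub)
  have oA: "op_alg backward_shift A" unfolding A_def by (intro op_alg_diff op_alg_id op_alg_funpow ou)
  have ow: "op_alg backward_shift w" unfolding w_def by (intro op_alg_diff op_alg_id op_alg_funpow oA)
  note lin_u = bounded_clinearD[OF op_alg_bounded_clinear[OF ou bounded_clinear_backward_shift]]
  note lin_A = bounded_clinearD[OF op_alg_bounded_clinear[OF oA bounded_clinear_backward_shift]]
  have "w (ktensor p j) = ktensor p j \<and> w (ktensor q j) = 0" if j: "\<forall>i. j i < L" for j
  proof
    define G where "G r t = hardy.span {ktensor r (j(i := s)) | s. s < t}" for r t
    have G0: "G r 0 = {0}" for r by (simp add: G_def hardy.span_empty)
    have jG: "ktensor r j \<in> G r (Suc (j i))" for r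
      unfolding G_def by (rule hardy.span_base) (auto intro!: exI[of _ "j i"])
    have mono: "G r t \<subseteq> G r (Suc t)" for r t
      unfolding G_def by (intro hardy.span_mono) auto
    have low: "(if s = 0 then 0 else ktensor r (j(i := s - 1))) \<in> G r t" if "s < Suc t" for r s t
      using that unfolding G_def by (auto intro!: hardy.span_zero hardy.span_base)
    have sub_r: "shift_sub i (r i) x \<in> G r t" if "\<And>i. norm (r i) < 1" "x \<in> G r (Suc t)" for r x t
      using that(2) unfolding G_def[of r "Suc t"]
    proof (induction rule: hardy.span_induct_alt)
      case base
      show ?case unfolding G_def
        by (simp add: shift_sub_def hardy.span_zero bounded_clinearD(5)[OF bounded_clinear_backward_shift])
    next
      case (step d x y)
      then obtain s where s: "x = ktensor r (j(i := s))" "s < Suc t" by blast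
      have "shift_sub i (r i) x \<in> G r t"
        using shift_sub_ktensor[of r i "j(i := s)"] that(1) low[OF s(2), of r] by (cases s) (simp_all add: s(1))
      moreover have "shift_sub i (r i) (cscale d x + y) = cscale d (shift_sub i (r i) x) + shift_sub i (r i) y"
        unfolding shift_sub_def bounded_clinearD(2,3)[OF bounded_clinear_backward_shift]
        by (simp add: hardy.scale_right_distrib hardy.scale_right_diff_distrib hardy.scale_left_commute)
      ultimately show ?case using step.IH unfolding G_def by (auto intro: hardy.span_add hardy.span_scale)
    qed
    have "(u ^^ L) (ktensor q j) = 0"
    proof (rule nilpotent_chain[of "G q" u])
      show "u x \<in> G q t" if "x \<in> G q (Suc t)" for t x
        using sub_r[OF q that] unfolding u_def G_def by (rule hardy.span_scale)
      show "ktensor q j \<in> G q (Suc (j i))" "Suc (j i) \<le> L" using jG j by (auto simp: Suc_le_eq)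
    qed (simp_all add: G0 lin_u)
    then have "A (ktensor q j) = ktensor q j" by (simp add: A_def)
    then have "(A ^^ n) (ktensor q j) = ktensor q j" for n by (induction n) auto
    then show "w (ktensor q j) = 0" by (simp add: w_def)
    have u1: "u x - x \<in> G p t" if x: "x \<in> G p (Suc t)" for x t
    proof -
      have "shift_sub i (q i) x = shift_sub i (p i) x + cscale (cnj (p i) - cnj (q i)) x"
        by (simp add: shift_sub_def hardy.scale_left_diff_distrib)
      then have "u x = cscale c (shift_sub i (p i) x) + x"
        by (simp add: u_def hardy.scale_right_distrib c)
      then have "u x - x = cscale c (shift_sub i (p i) x)" by simp
      then show ?thesis using sub_r[OF p x] unfolding G_def by (simp add: hardy.span_scale)
    qed
    have un: "(u ^^ n) x - x \<in> G p t" if x: "x \<in> G p (Suc t)" for n x t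
    proof (induction n)
      case 0
      show ?case by (simp add: G_def hardy.span_zero)
    next
      case (Suc n)
      have "(u ^^ n) x - x \<in> G p (Suc t)" using Suc.IH mono by blast
      then have "(u ^^ n) x - x + x \<in> G p (Suc t)" using x unfolding G_def by (rule hardy.span_add)
      then have "u ((u ^^ n) x) - (u ^^ n) x \<in> G p t" using u1 by simp
      then have "u ((u ^^ n) x) - (u ^^ n) x + ((u ^^ n) x - x) \<in> G p t"
        using Suc.IH unfolding G_def by (rule hardy.span_add)
      then show ?case by simp
    qed
    have "(A ^^ L) (ktensor p j) = 0"
    proof (rule nilpotent_chain[of "G p" A])
      show "A x \<in> G p t" if "x \<in> G p (Suc t)" for t x
      proof -
        have "- ((u ^^ L) x - x) \<in> G p t" using un[OF that] unfolding G_def by (rule hardy.span_neg)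
        then show ?thesis by (simp add: A_def)
      qed
      show "ktensor p j \<in> G p (Suc (j i))" "Suc (j i) \<le> L" using jG j by (auto simp: Suc_le_eq)
    qed (simp_all add: G0 lin_A)
    then show "w (ktensor p j) = ktensor p j" by (simp add: w_def)
  qed
  with ow show ?thesis by blast
qed

lemma ex_isolating_operator:
  fixes p :: "'n::finite \<Rightarrow> complex"
  assumes "finite F" and p: "\<And>i. norm (p i) < 1" and F: "\<And>q i. q \<in> F \<Longrightarrow> norm (q i) < 1" and "p \<notin> F"
  shows "\<exists>D. op_alg backward_shift D \<and> (\<forall>j. (\<forall>i. j i < L) \<longrightarrow>
    D (ktensor p j) = ktensor p j \<and> (\<forall>q\<in>F. D (ktensor q j) = 0))"
  using assms(1) F \<open>p \<notin> F\<close>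
proof (induction F rule: finite_induct)
  case empty
  show ?case by (rule exI[of _ "\<lambda>x. x"]) (simp add: op_alg_id)
next
  case (insert q F)
  then obtain D where D: "op_alg backward_shift D"
    "\<And>j. \<forall>i. j i < L \<Longrightarrow> D (ktensor p j) = ktensor p j \<and> (\<forall>q\<in>F. D (ktensor q j) = 0)"
    by auto
  obtain w where w: "op_alg backward_shift w"
    "\<And>j. \<forall>i. j i < L \<Longrightarrow> w (ktensor p j) = ktensor p j \<and> w (ktensor q j) = 0"
    using ex_separating_operator[of p q L] p insert.prems by auto
  have comm: "D (w x) = w (D x)" for x
    by (rule op_alg_commute[OF D(1) w(1) commuting_backward_shift bounded_clinear_backward_shift])
  have 0: "D 0 = 0" "w 0 = 0"
    by (simp_all add: bounded_clinearD(5)[OF op_alg_bounded_clinear[OF D(1) bounded_clinear_backward_shift]]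
        bounded_clinearD(5)[OF op_alg_bounded_clinear[OF w(1) bounded_clinear_backward_shift]])
  show ?case
  proof (intro exI[of _ "\<lambda>x. D (w x)"] conjI allI impI ballI)
    show "op_alg backward_shift (\<lambda>x. D (w x))" using D(1) w(1) by (rule op_alg_comp)
    fix j :: "'n \<Rightarrow> nat" assume j: "\<forall>i. j i < L"
    then show "D (w (ktensor p j)) = ktensor p j" using D(2) w(2) by simp
    show "D (w (ktensor q' j)) = 0" if "q' \<in> insert q F" for q'
    proof (cases "q' = q")
      case True
      then show ?thesis using w(2)[OF j] 0 by simp
    next
      case False
      then show ?thesis using that D(2)[OF j] 0 by (simp add: comm)
    qed
  qed
qed

lemma ktensor_downward:
  assumes V: "closed_subspace V" "\<And>i x. x \<in> V \<Longrightarrow> backward_shift i x \<in> V"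
    and p: "\<And>i. norm (p i) < 1" and J: "ktensor p J \<in> V" and le: "\<And>i. j i \<le> J i"
  shows "ktensor p j \<in> V"
  using J le
proof (induction "\<Sum>i\<in>UNIV. J i" arbitrary: J rule: less_induct)
  case less
  show ?case
  proof (cases "j = J")
    case False
    then obtain i where "j i \<noteq> J i" by blast
    with less.prems(2)[of i] have i: "j i < J i" by simp
    define J' where "J' = J(i := J i - 1)"
    have "(\<Sum>l\<in>UNIV. J' l) < (\<Sum>l\<in>UNIV. J l)"
      by (rule sum_strict_mono_ex1) (use i in \<open>auto simp: J'_def intro!: exI[of _ i]\<close>)
    moreover have "ktensor p J' \<in> V"
    proof -
      have "shift_sub i (p i) (ktensor p J) \<in> V"
        unfolding shift_sub_def using less.prems(1) V by (auto intro: closed_subspaceD)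
      then show ?thesis using shift_sub_ktensor[of p i J] p i by (simp add: J'_def)
    qed
    moreover have "j l \<le> J' l" for l using less.prems(2)[of l] i by (auto simp: J'_def)
    ultimately show ?thesis by (rule less.hyps)
  qed (use less in simp)
qed

section \<open>The spaces in terms of kernel tensors\<close>

lemma Q_Phi_eq:
  fixes \<phi> :: "'n::finite \<Rightarrow> int \<Rightarrow> complex \<Rightarrow> complex"
  assumes "\<And>i k. blaschke_product (\<phi> i k)"
  shows "Q_Phi \<phi> = closed_span {ktensor p j | p j. (\<forall>i. norm (p i) < 1) \<and> (\<exists>k. \<forall>i. j i < zord (\<phi> i k) (p i))}"
    (is "_ = closed_span ?K")
proof -
  define X where "X i k = {szego a j | a j. norm a < 1 \<and> j < zord (\<phi> i k) a}" for i k
  have "Q_Phi \<phi> = closed_span (\<Union>k. {tensor f | f. \<forall>i. f i \<in> X i k})"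
    unfolding Q_Phi_def model_space_blaschke_product[OF assms] hardy_tensor_closed_span
      closed_span_UN_closed_span X_def ..
  also have "(\<Union>k. {tensor f | f. \<forall>i. f i \<in> X i k}) =
      ?K"
  proof (intro equalityI subsetI)
    fix x assume "x \<in> (\<Union>k. {tensor f | f. \<forall>i. f i \<in> X i k})"
    then obtain k f where x: "x = tensor f" and f: "\<forall>i. f i \<in> X i k" by blast
    from f have "\<forall>i. \<exists>a j. f i = szego a j \<and> norm a < 1 \<and> j < zord (\<phi> i k) a" by (auto simp: X_def)
    then obtain p j where "\<And>i. f i = szego (p i) (j i) \<and> norm (p i) < 1 \<and> j i < zord (\<phi> i k) (p i)"
      by metis
    moreover from this have "f = (\<lambda>i. szego (p i) (j i))" by blast
    then have "x = ktensor p j" by (simp add: x ktensor_def)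
    ultimately show "x \<in> ?K"
      by blast
  next
    fix x assume "x \<in> ?K"
    then obtain p j k where "x = ktensor p j" "\<forall>i. norm (p i) < 1" "\<forall>i. j i < zord (\<phi> i k) (p i)" by blast
    then have "x = tensor (\<lambda>i. szego (p i) (j i))" "\<forall>i. szego (p i) (j i) \<in> X i k"
      by (auto simp: ktensor_def X_def)
    then show "x \<in> (\<Union>k. {tensor f | f. \<forall>i. f i \<in> X i k})" by blast
  qed
  finally show ?thesis .
qed

lemma prime_part_blaschke_power:
  assumes "norm a < 1" "l \<ge> 1"
  shows "prime_part (\<lambda>z. blaschke_factor a z ^ l) = blaschke_factor a"
  unfolding prime_part_def
proof (rule the_equality)
  show "\<exists>\<alpha> l'. norm \<alpha> < 1 \<and> l' \<ge> 1 \<and> blaschke_factor a = blaschke_factor \<alpha> \<and>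
      (\<lambda>z. blaschke_factor a z ^ l) = (\<lambda>z. blaschke_factor \<alpha> z ^ l')"
    using assms by blast
  fix b assume "\<exists>\<alpha> l'. norm \<alpha> < 1 \<and> l' \<ge> 1 \<and> b = blaschke_factor \<alpha> \<and>
      (\<lambda>z. blaschke_factor a z ^ l) = (\<lambda>z. blaschke_factor \<alpha> z ^ l')"
  then obtain \<alpha> l' where \<alpha>: "norm \<alpha> < 1" "l' \<ge> (1::nat)" "b = blaschke_factor \<alpha>"
    "(\<lambda>z. blaschke_factor a z ^ l) = (\<lambda>z. blaschke_factor \<alpha> z ^ l')" by blast
  have "blaschke_factor a a = 0" by (simp add: blaschke_factor_def)
  then have "blaschke_factor a a ^ l = 0" using assms(2) by simp
  then have "blaschke_factor \<alpha> a ^ l' = 0" by (simp only: fun_cong[OF \<alpha>(4), of a])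
  then have "a = \<alpha>" using \<alpha>(1,2) assms(1) by (simp add: blaschke_factor_eq_0_iff)
  then show "b = blaschke_factor a" using \<alpha>(3) by simp
qed

definition zero_indices :: "('n \<Rightarrow> int \<Rightarrow> complex \<Rightarrow> complex) \<Rightarrow> ('n \<Rightarrow> complex) \<Rightarrow> int set" where
  "zero_indices \<phi> p = {k. \<forall>i. zord (\<phi> i k) (p i) \<ge> 1}"

definition local_kernels ::
    "('n::finite \<Rightarrow> int \<Rightarrow> complex \<Rightarrow> complex) \<Rightarrow> ('n \<Rightarrow> complex) \<Rightarrow> int set \<Rightarrow> 'n hardy set" where
  "local_kernels \<phi> p Y = {ktensor p j | j. \<exists>k\<in>Y. \<forall>i. j i < zord (\<phi> i k) (p i)}"

definition parts_at :: "('n \<Rightarrow> int \<Rightarrow> complex \<Rightarrow> complex) \<Rightarrow> ('n \<Rightarrow> complex) \<Rightarrow> int \<Rightarrow> 'n \<Rightarrow> complex \<Rightarrow> complex" where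
  "parts_at \<phi> p k i = (\<lambda>z. blaschke_factor (p i) z ^ zord (\<phi> i k) (p i))"

lemma blaschke_parts_eq:
  assumes "blaschke_product \<phi>"
  shows "blaschke_parts \<phi> = {\<lambda>z. blaschke_factor a z ^ zord \<phi> a | a. norm a < 1 \<and> zord \<phi> a \<ge> 1}" (is "_ = ?R")
proof (intro equalityI subsetI)
  fix \<xi> assume "\<xi> \<in> blaschke_parts \<phi>"
  then obtain M \<alpha> l m where \<xi>: "\<xi> = (\<lambda>z. blaschke_factor (\<alpha> m) z ^ l m)" and f: "blaschke_form \<phi> M \<alpha> l" "m \<in> M"
    by (auto simp: blaschke_parts_def)
  moreover from f have "norm (\<alpha> m) < 1" "l m \<ge> 1" by (auto simp: blaschke_form_def)
  ultimately show "\<xi> \<in> ?R"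
    using blaschke_form_ord[OF f] by (intro CollectI exI[of _ "\<alpha> m"]) simp
next
  fix \<xi> assume "\<xi> \<in> ?R"
  then obtain a where a: "\<xi> = (\<lambda>z. blaschke_factor a z ^ zord \<phi> a)" "norm a < 1" "zord \<phi> a \<ge> 1" by blast
  obtain M \<alpha> l where f: "blaschke_form \<phi> M \<alpha> l" and hol: "\<phi> holomorphic_on ball 0 1"
    using assms by (auto simp: blaschke_product_def inner_function_def)
  have "a \<in> \<alpha> ` M" using blaschke_form_ord_0[OF f hol a(2)] a(3) by (cases "a \<in> \<alpha> ` M") auto
  then obtain m where m: "m \<in> M" "a = \<alpha> m" by blast
  with a have "\<xi> = (\<lambda>z. blaschke_factor (\<alpha> m) z ^ l m)" using blaschke_form_ord[OF f] by simp
  with f m(1) show "\<xi> \<in> blaschke_parts \<phi>" unfolding blaschke_parts_def by blast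
qed

lemma Lambda_eq:
  assumes "\<And>i k. blaschke_product (\<phi> i k)"
  shows "Lambda \<phi> = {parts_at \<phi> p k | p k. \<forall>i. norm (p i) < 1 \<and> zord (\<phi> i k) (p i) \<ge> 1}" (is "_ = ?R")
proof (intro equalityI subsetI)
  fix \<xi> assume "\<xi> \<in> Lambda \<phi>"
  then obtain k where "\<forall>i. \<exists>a. \<xi> i = (\<lambda>z. blaschke_factor a z ^ zord (\<phi> i k) a) \<and> norm a < 1 \<and> zord (\<phi> i k) a \<ge> 1"
    unfolding Lambda_def blaschke_parts_eq[OF assms] by blast
  then obtain p where "\<And>i. \<xi> i = (\<lambda>z. blaschke_factor (p i) z ^ zord (\<phi> i k) (p i)) \<and> norm (p i) < 1 \<and> zord (\<phi> i k) (p i) \<ge> 1"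
    by metis
  then have "\<xi> = parts_at \<phi> p k \<and> (\<forall>i. norm (p i) < 1 \<and> zord (\<phi> i k) (p i) \<ge> 1)"
    by (auto simp: parts_at_def fun_eq_iff)
  then show "\<xi> \<in> ?R" by blast
next
  fix \<xi> assume "\<xi> \<in> ?R"
  then show "\<xi> \<in> Lambda \<phi>"
    unfolding Lambda_def blaschke_parts_eq[OF assms] parts_at_def by blast
qed

context
  fixes \<phi> :: "'n::finite \<Rightarrow> int \<Rightarrow> complex \<Rightarrow> complex" and p :: "'n \<Rightarrow> complex" and k0 :: int
  assumes p: "\<And>i. norm (p i) < 1" "\<And>i. zord (\<phi> i k0) (p i) \<ge> 1" and \<phi>: "\<And>i k. blaschke_product (\<phi> i k)"
begin

lemma prime_part_parts_at: "prime_part (parts_at \<phi> p k0 i) = blaschke_factor (p i)"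
  unfolding parts_at_def using p by (intro prime_part_blaschke_power) auto

lemma Z_set_parts_at: "Z_set \<phi> (parts_at \<phi> p k0) = zero_indices \<phi> p"
  unfolding Z_set_def zero_indices_def prime_part_parts_at blaschke_factor_inner_dvd_iff[OF \<phi> p(1)] ..

lemma Q_local_parts_at:
  "Q_local \<phi> (parts_at \<phi> p k0) Y = closed_span (local_kernels \<phi> p Y)"
proof -
  define X where "X i k = {szego (p i) j | j. j < zord (\<phi> i k) (p i)}" for i k
  have "Q_local \<phi> (parts_at \<phi> p k0) Y = closed_span (\<Union>k\<in>Y. {tensor f | f. \<forall>i. f i \<in> X i k})"
    unfolding Q_local_def prime_part_parts_at model_space_blaschke_power[OF p(1)] hardy_tensor_closed_span
      closed_span_UN_closed_span X_def ..
  also have "(\<Union>k\<in>Y. {tensor f | f. \<forall>i. f i \<in> X i k}) = local_kernels \<phi> p Y"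
  proof (intro equalityI subsetI)
    fix x assume "x \<in> (\<Union>k\<in>Y. {tensor f | f. \<forall>i. f i \<in> X i k})"
    then obtain k f where x: "x = tensor f" "k \<in> Y" and f: "\<forall>i. \<exists>j. f i = szego (p i) j \<and> j < zord (\<phi> i k) (p i)"
      by (auto simp: X_def)
    from f obtain j where j: "\<And>i. f i = szego (p i) (j i) \<and> j i < zord (\<phi> i k) (p i)" by metis
    then have "f = (\<lambda>i. szego (p i) (j i))" by blast
    with x j show "x \<in> local_kernels \<phi> p Y"
      unfolding local_kernels_def by (intro CollectI exI[of _ j]) (auto simp: ktensor_def intro!: bexI[of _ k])
  qed (auto simp: ktensor_def X_def local_kernels_def)
  finally show ?thesis .
qed

end

lemma Z_tilde_props:
  "Z_tilde \<phi> \<xi> \<subseteq> Z_set \<phi> \<xi>" "Q_local \<phi> \<xi> (Z_tilde \<phi> \<xi>) = Q_local \<phi> \<xi> (Z_set \<phi> \<xi>)"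
  "Y \<subseteq> Z_set \<phi> \<xi> \<Longrightarrow> Q_local \<phi> \<xi> Y = Q_local \<phi> \<xi> (Z_set \<phi> \<xi>) \<Longrightarrow> ecard (Z_tilde \<phi> \<xi>) \<le> ecard Y"
proof -
  define P where "P Y \<longleftrightarrow> Y \<subseteq> Z_set \<phi> \<xi> \<and> Q_local \<phi> \<xi> Y = Q_local \<phi> \<xi> (Z_set \<phi> \<xi>)" for Y
  have "\<exists>n Y. P Y \<and> ecard Y = n" by (auto simp: P_def)
  then obtain Y0 where "P Y0" "\<And>m. m < ecard Y0 \<Longrightarrow> \<not> (\<exists>Y. P Y \<and> ecard Y = m)"
    using exists_least_iff[of "\<lambda>n. \<exists>Y. P Y \<and> ecard Y = n"] by auto
  then have "is_arg_min ecard P Y0" by (auto simp: is_arg_min_def)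
  then have "is_arg_min ecard P (Z_tilde \<phi> \<xi>)"
    unfolding Z_tilde_def P_def[symmetric] arg_min_def by (rule someI[of "is_arg_min ecard P"])
  then have "P (Z_tilde \<phi> \<xi>)" "\<And>Y. P Y \<Longrightarrow> ecard (Z_tilde \<phi> \<xi>) \<le> ecard Y"
    by (auto simp: is_arg_min_def not_less)
  then show "Z_tilde \<phi> \<xi> \<subseteq> Z_set \<phi> \<xi>" "Q_local \<phi> \<xi> (Z_tilde \<phi> \<xi>) = Q_local \<phi> \<xi> (Z_set \<phi> \<xi>)"
    "Y \<subseteq> Z_set \<phi> \<xi> \<Longrightarrow> Q_local \<phi> \<xi> Y = Q_local \<phi> \<xi> (Z_set \<phi> \<xi>) \<Longrightarrow> ecard (Z_tilde \<phi> \<xi>) \<le> ecard Y"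
    by (auto simp: P_def)
qed

section \<open>The upper bound\<close>

lemma countable_zeros:
  assumes "blaschke_product \<phi>"
  shows "countable {a. norm a < 1 \<and> zord \<phi> a \<ge> 1}"
proof -
  obtain M \<alpha> l where f: "blaschke_form \<phi> M \<alpha> l" and hol: "\<phi> holomorphic_on ball 0 1"
    using assms by (auto simp: blaschke_product_def inner_function_def)
  have "{a. norm a < 1 \<and> zord \<phi> a \<ge> 1} \<subseteq> \<alpha> ` M"
    using blaschke_form_ord_0[OF f hol] by force
  then show ?thesis by (rule countable_subset) simp
qed

lemma co_rank_le:
  fixes \<phi> :: "'n::finite \<Rightarrow> int \<Rightarrow> complex \<Rightarrow> complex"
  assumes \<phi>: "\<And>i k. blaschke_product (\<phi> i k)"
    and le: "\<And>\<xi>. \<xi> \<in> Lambda \<phi> \<Longrightarrow> ecard (Z_tilde \<phi> \<xi>) \<le> enat r"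
  shows "co_rank (Q_Phi \<phi>) \<le> enat r"
proof -
  define P where "P = {p :: 'n \<Rightarrow> complex. \<exists>k. \<forall>i. norm (p i) < 1 \<and> zord (\<phi> i k) (p i) \<ge> 1}"
  have "P \<subseteq> (\<Union>k. PiE UNIV (\<lambda>i. {a. norm a < 1 \<and> zord (\<phi> i k) a \<ge> 1}))" by (auto simp: P_def)
  moreover have "countable (\<Union>k. PiE UNIV (\<lambda>i. {a. norm a < 1 \<and> zord (\<phi> i k) a \<ge> 1}))"
    by (intro countable_UN countable_PiE countable_zeros \<phi>) auto
  ultimately have cP: "countable P" by (rule countable_subset)
  have Pn: "norm (p i) < 1" if "p \<in> P" for p i using that by (auto simp: P_def)
  define \<kappa> where "\<kappa> p = (SOME k. \<forall>i. zord (\<phi> i k) (p i) \<ge> 1)" for p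
  have \<kappa>: "zord (\<phi> i (\<kappa> p)) (p i) \<ge> 1" if "p \<in> P" for p i
  proof -
    have "\<exists>k. \<forall>i. zord (\<phi> i k) (p i) \<ge> 1" using that by (auto simp: P_def)
    from someI_ex[OF this] show ?thesis by (simp add: \<kappa>_def)
  qed
  define \<xi> where "\<xi> p = parts_at \<phi> p (\<kappa> p)" for p
  have \<xi>L: "\<xi> p \<in> Lambda \<phi>" if "p \<in> P" for p
    unfolding Lambda_eq[OF \<phi>] \<xi>_def using \<kappa>[OF that] Pn[OF that] by blast
  define Z where "Z p = Z_tilde \<phi> (\<xi> p)" for p
  have Zfin: "finite (Z p)" "card (Z p) \<le> r" if "p \<in> P" for p
    using le[OF \<xi>L[OF that]] by (auto simp: ecard_def Z_def split: if_splits)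
  have Zset: "Z_set \<phi> (\<xi> p) = zero_indices \<phi> p" if "p \<in> P" for p
    unfolding \<xi>_def by (rule Z_set_parts_at) (use Pn[OF that] \<kappa>[OF that] \<phi> in auto)
  have loc: "Q_local \<phi> (\<xi> p) Y = closed_span (local_kernels \<phi> p Y)"
    if "p \<in> P" for p Y
    unfolding \<xi>_def by (rule Q_local_parts_at) (use Pn[OF that] \<kappa>[OF that] \<phi> in auto)
  have "\<forall>p\<in>P. \<exists>e. bij_betw e {..<card (Z p)} (Z p)"
    using ex_bij_betw_nat_finite[OF Zfin(1)] by (simp add: atLeast0LessThan)
  from bchoice[OF this] obtain e where e: "\<And>p. p \<in> P \<Longrightarrow> bij_betw (e p) {..<card (Z p)} (Z p)" by blast
  define top where "top p k = (\<lambda>i. zord (\<phi> i k) (p i) - 1)" for p k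
  define idx where "idx = to_nat_on P"
  have inj: "inj_on idx P" unfolding idx_def using cP by (rule inj_on_to_nat_on)
  define pt where "pt = inv_into P idx"
  define valid where "valid m j \<longleftrightarrow> m \<in> idx ` P \<and> j < card (Z (pt m))" for m j
  define y where "y m j = (if valid m j then ktensor (pt m) (top (pt m) (e (pt m) j)) else 0)" for m j
  have ptP: "pt m \<in> P" "idx (pt m) = m" if "m \<in> idx ` P" for m
    using that inv_into_into[of m idx P] f_inv_into_f[of m idx P] by (auto simp: pt_def)
  define Q where "Q = Q_Phi \<phi>"
  have Q: "Q = closed_span {ktensor p j | p j. (\<forall>i. norm (p i) < 1) \<and> (\<exists>k. \<forall>i. j i < zord (\<phi> i k) (p i))}"
    unfolding Q_def by (rule Q_Phi_eq[OF \<phi>])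
  have cQ: "closed_subspace Q" unfolding Q by (rule closed_subspace_closed_span)
  have kQ: "ktensor p j \<in> Q" if "\<And>i. norm (p i) < 1" "\<And>i. j i < zord (\<phi> i k) (p i)" for p j k
    unfolding Q using that by (intro subsetD[OF closed_span_superset]) blast
  have invQ: "backward_shift i x \<in> Q" if "x \<in> Q" for i x
  proof (rule closed_span_image_subset[OF bounded_clinear_backward_shift cQ _ that[unfolded Q]], clarify)
    fix p j k assume p: "\<forall>i. norm (p i) < 1" and j: "\<forall>i. j i < zord (\<phi> i k) (p i)"
    have "ktensor p j \<in> Q" using p j by (intro kQ[of p j k]) auto
    moreover have "ktensor p (j(i := j i - 1)) \<in> Q"
      using p j less_imp_diff_less by (intro kQ[of p _ k]) auto
    ultimately show "backward_shift i (ktensor p j) \<in> Q"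
      using p closed_subspaceD(2)[OF cQ]
      by (subst backward_shift_ktensor) (auto intro!: closed_subspaceD(3)[OF cQ] closed_subspaceD(4)[OF cQ])
  qed
  have eZ: "e p j \<in> Z p" if "p \<in> P" "j < card (Z p)" for p j
    using e[OF that(1)] that(2) by (auto simp: bij_betw_def)
  have topless: "top p k i < zord (\<phi> i k) (p i)" if "p \<in> P" "k \<in> Z p" for p k i
  proof -
    have "k \<in> Z_set \<phi> (\<xi> p)" using Z_tilde_props(1) that(2) by (auto simp: Z_def)
    then have "zord (\<phi> i k) (p i) \<ge> 1" using Zset[OF that(1)] by (simp add: zero_indices_def)
    then show ?thesis by (simp add: top_def)
  qed
  have yQ: "y m j \<in> Q" for m j
  proof (cases "valid m j")
    case True
    then have "pt m \<in> P" "e (pt m) j \<in> Z (pt m)" using ptP eZ by (auto simp: valid_def)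
    then have "ktensor (pt m) (top (pt m) (e (pt m) j)) \<in> Q" using Pn topless by (intro kQ) auto
    then show ?thesis using True by (simp add: y_def)
  qed (simp add: y_def closed_subspaceD(2)[OF cQ])
  have sep: "\<exists>D. op_alg backward_shift D \<and> (\<forall>j<r. D (y m j) = y m j \<and> (\<forall>k\<le>N. k \<noteq> m \<longrightarrow> D (y k j) = 0))" for m N
  proof -
    define F where "F = pt ` ({k\<in>idx ` P. k \<le> N \<and> k \<noteq> m})"
    define L where "L = Suc (\<Sum>k\<in>insert m {..N}. \<Sum>j<r. \<Sum>i\<in>UNIV. top (pt k) (e (pt k) j) i)"
    have L: "top (pt k) (e (pt k) j) i < L" if "k \<in> insert m {..N}" "j < r" for k j i
    proof -
      have "top (pt k) (e (pt k) j) i \<le> (\<Sum>i\<in>UNIV. top (pt k) (e (pt k) j) i)" by (rule member_le_sum) auto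
      also have "\<dots> \<le> (\<Sum>j<r. \<Sum>i\<in>UNIV. top (pt k) (e (pt k) j) i)"
        using that by (intro member_le_sum[of j _ "\<lambda>j. \<Sum>i\<in>UNIV. top (pt k) (e (pt k) j) i"]) auto
      also have "\<dots> \<le> (\<Sum>k\<in>insert m {..N}. \<Sum>j<r. \<Sum>i\<in>UNIV. top (pt k) (e (pt k) j) i)"
        by (rule member_le_sum[OF that(1), of "\<lambda>k. \<Sum>j<r. \<Sum>i\<in>UNIV. top (pt k) (e (pt k) j) i"]) auto
      finally show ?thesis by (simp add: L_def)
    qed
    have finF: "finite F" by (simp add: F_def)
    have Fn: "norm (q i) < 1" if "q \<in> F" for q i using that ptP Pn by (auto simp: F_def)
    have "\<exists>D. op_alg backward_shift D \<and>
      (m \<in> idx ` P \<longrightarrow> (\<forall>j. (\<forall>i. j i < L) \<longrightarrow> D (ktensor (pt m) j) = ktensor (pt m) j \<and> (\<forall>q\<in>F. D (ktensor q j) = 0))) \<and>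
      (m \<notin> idx ` P \<longrightarrow> (\<forall>x. D x = 0))"
    proof (cases "m \<in> idx ` P")
      case True
      have "pt m \<notin> F"
      proof
        assume "pt m \<in> F"
        then obtain k where "k \<in> idx ` P" "k \<noteq> m" "pt m = pt k" by (auto simp: F_def)
        then have "k = m" using ptP(2)[OF True] ptP(2)[of k] by simp
        then show False using \<open>k \<noteq> m\<close> by simp
      qed
      have "\<exists>D. op_alg backward_shift D \<and> (\<forall>j. (\<forall>i. j i < L) \<longrightarrow>
          D (ktensor (pt m) j) = ktensor (pt m) j \<and> (\<forall>q\<in>F. D (ktensor q j) = 0))"
        by (rule ex_isolating_operator) (fact finF Pn[OF ptP(1)[OF True]] Fn \<open>pt m \<notin> F\<close>)+
      with True show ?thesis by blast
    next
      case False
      have "op_alg backward_shift (\<lambda>x. x - x)" by (intro op_alg_diff op_alg_id)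
      with False show ?thesis by (intro exI[of _ "\<lambda>x. x - x"]) simp
    qed
    then obtain D where D: "op_alg backward_shift D"
      "\<And>j. m \<in> idx ` P \<Longrightarrow> \<forall>i. j i < L \<Longrightarrow> D (ktensor (pt m) j) = ktensor (pt m) j \<and> (\<forall>q\<in>F. D (ktensor q j) = 0)"
      "\<And>x. m \<notin> idx ` P \<Longrightarrow> D x = 0" by blast
    have D0: "D 0 = 0"
      by (rule bounded_clinearD(5)[OF op_alg_bounded_clinear[OF D(1) bounded_clinear_backward_shift]])
    show ?thesis
    proof (intro exI[of _ D] conjI allI impI D(1))
      fix j assume j: "j < r"
      show "D (y m j) = y m j"
        using D(2)[of "top (pt m) (e (pt m) j)"] L[of m j] j D0 by (auto simp: y_def valid_def)
      fix k assume k: "k \<le> N" "k \<noteq> m"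
      show "D (y k j) = 0"
      proof (cases "m \<in> idx ` P \<and> valid k j")
        case True
        then have "pt k \<in> F" using k by (auto simp: F_def valid_def)
        with D(2)[of "top (pt k) (e (pt k) j)"] L[of k j] j k True show ?thesis by (auto simp: y_def)
      qed (use D(3) D0 in \<open>auto simp: y_def\<close>)
    qed
  qed
  have "\<exists>h. (\<forall>j<r. h j \<in> closed_span (\<Union>m. {y m j})) \<and>
      (\<forall>V. closed_subspace V \<longrightarrow> (\<forall>i. \<forall>x\<in>V. backward_shift i x \<in> V) \<longrightarrow> (\<forall>j<r. h j \<in> V) \<longrightarrow>
        (\<forall>m. \<forall>j<r. y m j \<in> V))"
    by (rule ex_common_generators[OF bounded_clinear_backward_shift sep])
  then obtain h where h1: "\<forall>j<r. h j \<in> closed_span (\<Union>m. {y m j})"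
    and h2: "\<forall>V. closed_subspace V \<longrightarrow> (\<forall>i. \<forall>x\<in>V. backward_shift i x \<in> V) \<longrightarrow> (\<forall>j<r. h j \<in> V) \<longrightarrow>
        (\<forall>m. \<forall>j<r. y m j \<in> V)"
    by (elim exE conjE)
  define S where "S = h ` {..<r}"
  have SQ: "S \<subseteq> Q"
  proof
    fix x assume "x \<in> S"
    then obtain j where "j < r" "x = h j" by (auto simp: S_def)
    moreover have "closed_span (\<Union>m. {y m j}) \<subseteq> Q" using yQ by (intro closed_span_minimal[OF _ cQ]) auto
    ultimately show "x \<in> Q" using h1 by auto
  qed
  have "generated backward_shift S = Q"
  proof
    show "generated backward_shift S \<subseteq> Q"
      by (rule generated_minimal[OF commuting_backward_shift cQ invQ SQ])
    define V where "V = generated backward_shift S"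
    have cV: "closed_subspace V" unfolding V_def by (rule closed_subspace_generated)
    have invV: "backward_shift i x \<in> V" if "x \<in> V" for i x
      using that unfolding V_def by (rule generated_invariant[OF commuting_backward_shift bounded_clinear_backward_shift])
    have "S \<subseteq> V" unfolding V_def by (rule generated_superset[OF commuting_backward_shift])
    then have "\<forall>j<r. h j \<in> V" by (auto simp: S_def)
    moreover have "\<forall>i. \<forall>x\<in>V. backward_shift i x \<in> V" using invV by simp
    ultimately have yV: "y m j \<in> V" if "j < r" for m j
      using h2[THEN spec[of _ V]] cV that by simp
    have topV: "ktensor p (top p k) \<in> V" if p: "p \<in> P" and k: "k \<in> Z p" for p k
    proof -
      have "k \<in> e p ` {..<card (Z p)}" using bij_betw_imp_surj_on[OF e[OF p]] k by simp
      then obtain j where j: "j < card (Z p)" "e p j = k" by auto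
      have pt: "pt (idx p) = p" unfolding pt_def using inj p by (rule inv_into_f_f)
      have "j < r" using j(1) Zfin(2)[OF p] by simp
      from yV[OF this, of "idx p"] show ?thesis using p j by (simp add: y_def valid_def pt)
    qed
    have "ktensor p j \<in> V" if "\<And>i. norm (p i) < 1" "\<And>i. j i < zord (\<phi> i k) (p i)" for p j k
    proof -
      have z1: "zord (\<phi> i k) (p i) \<ge> 1" for i using that(2)[of i] by simp
      have p: "p \<in> P" using that(1) z1 by (auto simp: P_def)
      have "Q_local \<phi> (\<xi> p) (Z p) \<subseteq> V"
        unfolding loc[OF p] local_kernels_def
      proof (rule closed_span_minimal[OF _ cV], clarify)
        fix j' k' assume "k' \<in> Z p" "\<forall>i. j' i < zord (\<phi> i k') (p i)"
        then have low: "ktensor p (top p k') \<in> V" "j' i \<le> top p k' i" for i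
          using topV[OF p] by (auto simp: top_def less_eq_Suc_le dest!: spec[of _ i])
        show "ktensor p j' \<in> V"
          by (rule ktensor_downward[where V = V and J = "top p k'"]) (fact cV invV that(1) low)+
      qed
      moreover have "ktensor p j \<in> Q_local \<phi> (\<xi> p) (Z_set \<phi> (\<xi> p))"
        unfolding loc[OF p] Zset[OF p] local_kernels_def zero_indices_def using z1 that(2) by (intro subsetD[OF closed_span_superset]) blast
      ultimately show ?thesis using Z_tilde_props(2)[of \<phi> "\<xi> p"] by (auto simp: Z_def)
    qed
    then show "Q \<subseteq> V" unfolding Q by (intro closed_span_minimal[OF _ cV]) blast
  qed
  then have "co_rank Q \<le> ecard S"
    unfolding co_rank_def adjoint_Mz rank_on_def using SQ by (intro Inf_lower) blast
  also have "ecard S \<le> enat r" using card_image_le[of "{..<r}" h] by (simp add: S_def ecard_def)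
  finally show ?thesis by (simp add: Q_def)
qed

section \<open>The lower bound\<close>

lemma ex_nontrivial_solution:
  fixes a :: "'k \<Rightarrow> 's \<Rightarrow> complex"
  assumes "finite S" "finite Y" "card S < card Y"
  shows "\<exists>c. (\<exists>k\<in>Y. c k \<noteq> 0) \<and> (\<forall>s\<in>S. (\<Sum>k\<in>Y. c k * a k s) = 0)"
  using assms
proof (induction S arbitrary: Y a rule: finite_induct)
  case empty
  then have "Y \<noteq> {}" by auto
  then show ?case by (intro exI[of _ "\<lambda>_. 1"]) auto
next
  case (insert s S)
  show ?case
  proof (cases "\<forall>k\<in>Y. a k s = 0")
    case True
    have "card S < card Y" using insert by simp
    with insert.IH[OF insert.prems(1), of a] obtain c where
      "\<exists>k\<in>Y. c k \<noteq> 0" "\<forall>s\<in>S. (\<Sum>k\<in>Y. c k * a k s) = 0" by blast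
    with True show ?thesis by (intro exI[of _ c]) simp
  next
    case False
    then obtain k0 where k0: "k0 \<in> Y" "a k0 s \<noteq> 0" by blast
    define Y' where "Y' = Y - {k0}"
    have fin: "finite Y'" and card: "card S < card Y'"
      using insert k0 by (simp_all add: Y'_def)
    define a' where "a' k t = a k t - a k s / a k0 s * a k0 t" for k t
    obtain c' where c': "\<exists>k\<in>Y'. c' k \<noteq> 0" "\<And>t. t \<in> S \<Longrightarrow> (\<Sum>k\<in>Y'. c' k * a' k t) = 0"
      using insert.IH[OF fin card, of a'] by blast
    define b where "b = - (\<Sum>k\<in>Y'. c' k * a k s / a k0 s)"
    define c where "c k = (if k = k0 then b else c' k)" for k
    have sum: "(\<Sum>k\<in>Y. c k * a k t) = (\<Sum>k\<in>Y'. c' k * a' k t)" for t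
    proof -
      have "(\<Sum>k\<in>Y. c k * a k t) = b * a k0 t + (\<Sum>k\<in>Y'. c' k * a k t)"
        using insert.prems(1) k0(1) unfolding Y'_def
        by (subst sum.remove[of _ k0]) (auto simp: c_def intro!: sum.cong)
      also have "\<dots> = (\<Sum>k\<in>Y'. c' k * a' k t)"
        by (simp add: a'_def b_def sum_distrib_right sum_subtractf right_diff_distrib mult.assoc)
      finally show ?thesis .
    qed
    have "(\<Sum>k\<in>Y'. c' k * a' k s) = 0" using k0(2) by (simp add: a'_def)
    with c' sum show ?thesis
      by (intro exI[of _ c]) (auto simp: c_def Y'_def)
  qed
qed

text \<open>An index \<open>k\<close> stands for the box \<open>\<Prod>\<^sub>i {..<l i k}\<close>; among equal maximal boxes the first one is kept.\<close>

definition maximal_indices :: "('n \<Rightarrow> int \<Rightarrow> nat) \<Rightarrow> int set" where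
  "maximal_indices l = {k. (\<forall>i. l i k \<ge> 1) \<and> (\<forall>k'. (\<forall>i. l i k \<le> l i k') \<longrightarrow> (\<forall>i. l i k' = l i k) \<and> k \<le> k')}"

lemma ex_maximal_index:
  fixes l :: "'n::finite \<Rightarrow> int \<Rightarrow> nat"
  assumes fin: "finite {k. \<forall>i. l i k \<ge> 1}"
    and k: "\<forall>i. l i k \<ge> 1"
  shows "\<exists>k'\<in>maximal_indices l. \<forall>i. l i k \<le> l i k'"
proof -
  define X where "X = {k'. \<forall>i. l i k \<le> l i k'}"
  have X: "finite X" "X \<noteq> {}"
    using finite_subset[OF _ fin, of X] k by (auto simp: X_def intro: order_trans)
  define m where "m k = (\<Sum>i\<in>UNIV. l i k)" for k
  have "Max (m ` X) \<in> m ` X" using X by (intro Max_in) auto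
  then obtain k1 where k1: "k1 \<in> X" "m k1 = Max (m ` X)" by auto
  have max: "m k' \<le> m k1" if "k' \<in> X" for k'
    unfolding k1(2) using X(1) that by (intro Max_ge) auto
  have eq: "l i k' = l i k1" if "\<forall>i. l i k1 \<le> l i k'" for k' i
  proof (rule ccontr)
    assume "l i k' \<noteq> l i k1"
    then have "l i k1 < l i k'" using that by (simp add: le_neq_implies_less)
    then have "m k1 < m k'" unfolding m_def by (intro sum_strict_mono_ex1) (use that in auto)
    moreover have "k' \<in> X" using k1(1) that by (auto simp: X_def intro: order_trans)
    ultimately show False using max[of k'] by simp
  qed
  define W where "W = {k'. \<forall>i. l i k1 \<le> l i k'}"
  have "W \<subseteq> X" using k1(1) by (auto simp: W_def X_def intro: order_trans)
  then have W: "finite W" "W \<noteq> {}" using X finite_subset by (auto simp: W_def)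
  define k2 where "k2 = Min W"
  have k2: "k2 \<in> W" unfolding k2_def using W by (rule Min_in)
  then have k2e: "l i k2 = l i k1" for i using eq[of k2] by (simp add: W_def)
  have "k2 \<in> maximal_indices l"
    unfolding maximal_indices_def
  proof (intro CollectI conjI allI impI)
    show "l i k2 \<ge> 1" for i using k1(1) k k2e[of i] by (auto simp: X_def intro: order_trans)
    fix k' assume *: "\<forall>i. l i k2 \<le> l i k'"
    then have kW: "k' \<in> W" by (simp add: W_def k2e)
    then show "l i k' = l i k2" for i using eq[of k' i] k2e by (simp add: W_def)
    show "k2 \<le> k'" unfolding k2_def using W(1) kW by (rule Min_le)
  qed
  moreover have "l i k \<le> l i k2" for i using k1(1) k2e by (simp add: X_def)
  ultimately show ?thesis by blast
qed

lemma model_space_orthogonal: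
  assumes "f \<in> model_space \<phi>" "\<And>z. norm z < 1 \<Longrightarrow> disc_fun h z = \<phi> z * disc_fun g z"
  shows "cinner f h = 0"
  using assms unfolding model_space_iff by blast

text \<open>For a maximal box with index range \<open>a..b\<close>, the tensor of the functions \<open>\<phi>\<^sub>i\<^sub>,\<^sub>b / (z\<^sub>i - p\<^sub>i)\<close>, \<open>i \<in> A\<close>, and
  \<open>\<phi>\<^sub>i\<^sub>,\<^sub>a / (z\<^sub>i - p\<^sub>i)\<close>, \<open>i \<notin> A\<close>, is an eigenvector of the compressions of all \<open>M\<^sub>z\<close> to the quotient module.\<close>

lemma card_le_generators:
  fixes \<phi> :: "'n::finite \<Rightarrow> int \<Rightarrow> complex \<Rightarrow> complex" and p :: "'n \<Rightarrow> complex"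
  assumes \<phi>: "\<And>i k. blaschke_product (\<phi> i k)"
    and inc: "\<And>i. i \<in> A \<Longrightarrow> increasing_seq (\<phi> i)" and dec: "\<And>i. i \<notin> A \<Longrightarrow> decreasing_seq (\<phi> i)"
    and p: "\<And>i. norm (p i) < 1"
    and fin: "finite (zero_indices \<phi> p)"
    and Y: "Y = maximal_indices (\<lambda>i k. zord (\<phi> i k) (p i))"
    and S: "finite S" "generated backward_shift S = Q_Phi \<phi>"
  shows "card Y \<le> card S"
proof -
  define l where "l i k = zord (\<phi> i k) (p i)" for i k
  have Y_iff: "k \<in> Y \<longleftrightarrow> (\<forall>i. l i k \<ge> 1) \<and> (\<forall>k'. (\<forall>i. l i k \<le> l i k') \<longrightarrow> (\<forall>i. l i k' = l i k) \<and> k \<le> k')" for k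
    unfolding Y l_def maximal_indices_def by simp
  have Y1: "l i k \<ge> 1" if "k \<in> Y" for i k
    using that Y_iff by blast
  have Ymax: "l i k' = l i k" "k \<le> k'" if "k \<in> Y" "\<And>i. l i k \<le> l i k'" for i k k'
    using that Y_iff[of k] by blast+
  have finY: "finite Y" by (rule finite_subset[OF _ fin]) (use Y1 in \<open>auto simp: l_def zero_indices_def\<close>)
  have dvd: "inner_dvd (\<phi> i k) (\<phi> i k')" if "if i \<in> A then k \<le> k' else k' \<le> k" for i k k'
    using increasing_seq_dvd[OF inc] decreasing_seq_dvd[OF dec] that by (cases "i \<in> A") auto
  have mono: "l i k \<le> l i k'" if "if i \<in> A then k \<le> k' else k' \<le> k" for i k k'
    unfolding l_def by (rule inner_dvd_ord_le[OF \<phi> \<phi> dvd[OF that] p])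
  define E where "E k = {k'. \<forall>i. l i k' = l i k}" for k
  define b where "b k = Max (E k)" for k
  have E: "b k \<in> E k" "\<And>k'. k' \<in> E k \<Longrightarrow> k' \<le> b k" "k \<le> b k" if k: "k \<in> Y" for k
  proof -
    have "E k \<subseteq> {k. \<forall>i. l i k \<ge> 1}" using Y1[OF k] by (simp add: E_def subset_iff)
    then have f: "finite (E k)" by (rule finite_subset) (use fin in \<open>simp add: l_def zero_indices_def\<close>)
    moreover have kE: "k \<in> E k" by (simp add: E_def)
    ultimately show "b k \<in> E k" "k \<le> b k" unfolding b_def by (auto intro!: Max_in Max_ge)
    show "k' \<le> b k" if "k' \<in> E k" for k' unfolding b_def using f that by (rule Max_ge)
  qed
  define s where "s i k = (if i \<in> A then b k else k)" for i k
  have ls: "l i (s i k) = l i k" if "k \<in> Y" for i k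
    using E(1)[OF that] by (auto simp: s_def E_def)
  define R where "R i k h u \<longleftrightarrow> h = (mult_sub (p i) ^^ (l i k - 1)) u \<and> disc_fun u (p i) \<noteq> 0 \<and>
      (\<forall>z. norm z < 1 \<longrightarrow> \<phi> i (s i k) z = (z - p i) * disc_fun h z)" for i k h u
  have ex: "\<exists>h u. R i k h u" if "k \<in> Y" for i k
  proof -
    have "l i k \<ge> 1" using that by (rule Y1)
    then have "zord (\<phi> i (s i k)) (p i) = Suc (l i k - 1)" using ls[OF that, of i] by (simp add: l_def)
    then show ?thesis unfolding R_def by (rule blaschke_product_quotient[OF \<phi> p])
  qed
  define H where "H i k = (SOME h. \<exists>u. R i k h u)" for i k
  define U where "U i k = (SOME u. R i k (H i k) u)" for i k
  have "R i k (H i k) (U i k)" if "k \<in> Y" for i k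
  proof -
    have "\<exists>u. R i k (H i k) u" unfolding H_def by (rule someI_ex) (rule ex[OF that])
    then show ?thesis unfolding U_def by (rule someI_ex)
  qed
  then have HU: "H i k = (mult_sub (p i) ^^ (l i k - 1)) (U i k) \<and> disc_fun (U i k) (p i) \<noteq> 0 \<and>
      (\<forall>z. norm z < 1 \<longrightarrow> \<phi> i (s i k) z = (z - p i) * disc_fun (H i k) z)" if "k \<in> Y" for i k
    using that unfolding R_def by blast
  define g where "g k = tensor (\<lambda>i. H i k)" for k
  define top where "top k = (\<lambda>i. l i k - 1)" for k
  have pair: "cinner (g k) (ktensor p (top k')) = 0 \<longleftrightarrow> k \<noteq> k'" if k: "k \<in> Y" and k': "k' \<in> Y" for k k'
  proof -
    have f: "cinner (H i k) (szego (p i) (l i k' - 1)) =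
        (if l i k' - 1 < l i k - 1 then 0 else cinner (U i k) (szego (p i) (l i k' - 1 - (l i k - 1))))" for i
      using HU[OF k, of i] by (simp add: cinner_mult_sub_funpow_szego[OF p])
    have prod: "cinner (g k) (ktensor p (top k')) = (\<Prod>i\<in>UNIV. cinner (H i k) (szego (p i) (l i k' - 1)))"
      by (simp add: g_def ktensor_def top_def cinner_tensor)
    show ?thesis
    proof (cases "k = k'")
      case True
      then have "cinner (H i k) (szego (p i) (l i k' - 1)) \<noteq> 0" for i
        unfolding f using HU[OF k, of i] by (simp add: cinner_szego_0[OF p])
      then have "(\<Prod>i\<in>UNIV. cinner (H i k) (szego (p i) (l i k' - 1))) \<noteq> 0" by simp
      then show ?thesis using True prod by metis
    next
      case False
      have "\<exists>i. l i k' < l i k"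
      proof (rule ccontr)
        assume "\<not> ?thesis"
        then have le: "l i k \<le> l i k'" for i by (simp add: not_less)
        have eq: "l i k' = l i k" for i using k le by (rule Ymax(1))
        have "k \<le> k'" using k le by (rule Ymax(2))
        moreover have "k' \<le> k" by (rule Ymax(2)[OF k']) (simp add: eq)
        ultimately show False using False by simp
      qed
      then obtain i where "l i k' < l i k" by blast
      moreover have "l i k' \<ge> 1" using k' by (rule Y1)
      ultimately have "l i k' - 1 < l i k - 1" by linarith
      then have "cinner (H i k) (szego (p i) (l i k' - 1)) = 0" by (simp only: f if_True)
      then have "(\<Prod>i\<in>UNIV. cinner (H i k) (szego (p i) (l i k' - 1))) = 0" by (intro prod_zero) auto
      then show ?thesis using False prod by metis
    qed
  qed
  have orth: "cinner f (Mz i (g k) - cscale (p i) (g k)) = 0" if f: "f \<in> Q_Phi \<phi>" and k: "k \<in> Y" for f i k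
  proof -
    define F where "F = (\<lambda>i. H i k)"
    define G where "G = F(i := mult_sub (p i) (F i))"
    have "cscale (p i) (tensor F) = tensor (F(i := cscale (p i) (F i)))"
      using bounded_clinearD(3)[OF bounded_clinear_tensor_upd[of F i], of "p i" "F i"] by simp
    then have "Mz i (tensor F) - cscale (p i) (tensor F) = tensor G"
      unfolding G_def mult_sub_def Mz_tensor
      by (simp only: bounded_clinearD(4)[OF bounded_clinear_tensor_upd[of F i]])
    then have eq: "Mz i (g k) - cscale (p i) (g k) = tensor G" by (simp add: g_def F_def)
    have "\<exists>j v. \<forall>z. norm z < 1 \<longrightarrow> disc_fun (G j) z = \<phi> j k' z * disc_fun v z" for k'
    proof (cases "if i \<in> A then k' \<le> s i k else s i k \<le> k'")
      case True
      from inner_dvd_hardy[OF dvd[OF True]] obtain v where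
        "\<forall>z. norm z < 1 \<longrightarrow> \<phi> i (s i k) z = \<phi> i k' z * disc_fun v z" by blast
      then show ?thesis
        using HU[OF k, of i] by (intro exI[of _ i] exI[of _ v]) (simp add: G_def F_def disc_fun_mult_sub)
    next
      case False
      have "\<exists>j. j \<noteq> i \<and> (if j \<in> A then k' \<le> s j k else s j k \<le> k') \<and> l j k' < l j k"
      proof (rule ccontr)
        assume none: "\<not> ?thesis"
        have le: "l j k \<le> l j k'" for j
        proof (cases "(i \<in> A) = (j \<in> A)")
          case True
          with False have "if j \<in> A then s j k \<le> k' else k' \<le> s j k" by (auto simp: s_def split: if_splits)
          from mono[OF this] ls[OF k, of j] show ?thesis by simp
        next
          case neq: False
          then have "j \<noteq> i" by blast
          moreover have "if j \<in> A then k' \<le> s j k else s j k \<le> k'"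
            using False neq E(3)[OF k] by (auto simp: s_def split: if_splits)
          ultimately show ?thesis using none by (meson not_less)
        qed
        have "k \<le> k'" using k le by (rule Ymax(2))
        moreover have "k' \<in> E k" unfolding E_def using Ymax(1)[OF k le] by blast
        then have "k' \<le> b k" by (rule E(2)[OF k])
        ultimately have "k \<le> k'" "k' \<le> b k" by simp_all
        with False show False by (auto simp: s_def split: if_splits)
      qed
      then obtain j where j: "j \<noteq> i" "if j \<in> A then k' \<le> s j k else s j k \<le> k'" "l j k' < l j k" by blast
      have "zord (\<phi> j k') (p j) < zord (\<phi> j (s j k)) (p j)" using j(3) ls[OF k, of j] by (simp add: l_def)
      from inner_dvd_ord_less[OF \<phi> \<phi> dvd[OF j(2)] p this] obtain v where
        v: "\<And>z. norm z < 1 \<Longrightarrow> \<phi> j (s j k) z = \<phi> j k' z * ((z - p j) * disc_fun v z)" by blast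
      have off: "disc_fun (H j k) z = \<phi> j k' z * disc_fun v z" if z: "norm z < 1" "z \<noteq> p j" for z
      proof -
        have "(z - p j) * disc_fun (H j k) z = (z - p j) * (\<phi> j k' z * disc_fun v z)"
          using HU[OF k, of j] v[OF z(1)] z(1) by (simp add: mult_ac)
        then show ?thesis using z(2) by simp
      qed
      have cont: "continuous_on (ball 0 1) (\<lambda>z. \<phi> j k' z * disc_fun v z)"
        using \<phi>[of j k'] unfolding blaschke_product_def
        by (intro continuous_on_mult inner_function_continuous holomorphic_on_imp_continuous_on[OF disc_fun_holomorphic]) auto
      have "disc_fun (H j k) (p j) = \<phi> j k' (p j) * disc_fun v (p j)"
        by (rule continuous_eq_at_point[where f = "disc_fun (H j k)" and g = "\<lambda>z. \<phi> j k' z * disc_fun v z",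
              OF holomorphic_on_imp_continuous_on[OF disc_fun_holomorphic] cont p off])
      with off have "disc_fun (H j k) z = \<phi> j k' z * disc_fun v z" if "norm z < 1" for z
        using that by (cases "z = p j") auto
      then show ?thesis using j(1) by (intro exI[of _ j] exI[of _ v]) (simp add: G_def F_def)
    qed
    note factor = this
    have zero: "cinner (tensor f) (tensor G) = 0" if "\<forall>i. f i \<in> model_space (\<phi> i k')" for f k'
    proof -
      obtain j v where "\<forall>z. norm z < 1 \<longrightarrow> disc_fun (G j) z = \<phi> j k' z * disc_fun v z"
        using factor by blast
      then have "cinner (f j) (G j) = 0"
        using that by (intro model_space_orthogonal[of "f j" "\<phi> j k'" "G j" v]) auto
      then show ?thesis unfolding cinner_tensor by (intro prod_zero) auto
    qed
    have "Q_Phi \<phi> \<subseteq> {f. cinner f (tensor G) = 0}"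
      unfolding Q_Phi_def hardy_tensor_eq closed_span_UN_closed_span
      by (rule closed_span_minimal[OF _ closed_subspace_orthogonal]) (auto intro: zero)
    then show ?thesis using f eq by auto
  qed
  show ?thesis
  proof (rule ccontr)
    assume "\<not> card Y \<le> card S"
    then have "card S < card Y" by simp
    from ex_nontrivial_solution[OF S(1) finY this, of "\<lambda>k x. cinner x (g k)"]
    obtain c where c: "\<exists>k\<in>Y. c k \<noteq> 0" "\<And>x. x \<in> S \<Longrightarrow> (\<Sum>k\<in>Y. c k * cinner x (g k)) = 0" by blast
    define G where "G = (\<Sum>k\<in>Y. cscale (cnj (c k)) (g k))"
    have cG: "cinner x G = (\<Sum>k\<in>Y. c k * cinner x (g k))" for x
      by (simp add: G_def cinner_sum_right cinner_cscale_right)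
    define W where "W = Q_Phi \<phi> \<inter> {x. cinner x G = 0}"
    have cQ: "closed_subspace (Q_Phi \<phi>)" by (simp add: Q_Phi_def closed_subspace_closed_span)
    have cW: "closed_subspace W" unfolding W_def by (intro closed_subspace_Int cQ closed_subspace_orthogonal)
    have SQ: "S \<subseteq> Q_Phi \<phi>" using generated_superset[OF commuting_backward_shift, of S] S(2) by simp
    have SW: "S \<subseteq> W" using SQ c(2) by (auto simp: W_def cG)
    have invW: "backward_shift i x \<in> W" if x: "x \<in> W" for i x
    proof -
      have xQ: "x \<in> Q_Phi \<phi>" and x0: "cinner x G = 0" using x by (auto simp: W_def)
      have "backward_shift i x \<in> Q_Phi \<phi>"
        using generated_invariant[OF commuting_backward_shift bounded_clinear_backward_shift, of x S i] xQ S(2) by simp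
      moreover have "cinner (backward_shift i x) (g k) = cnj (p i) * cinner x (g k)" if "k \<in> Y" for k
        using orth[OF xQ that, of i] by (simp add: cinner_backward_shift cinner_diff_right cinner_cscale_right)
      then have "cinner (backward_shift i x) G = cnj (p i) * cinner x G"
        unfolding cG sum_distrib_left by (intro sum.cong) (simp_all add: mult_ac)
      ultimately show ?thesis using x0 by (simp add: W_def)
    qed
    have QW: "Q_Phi \<phi> \<subseteq> W"
      using generated_minimal[OF commuting_backward_shift cW invW SW] S(2) by simp
    from c(1) obtain k where k: "k \<in> Y" "c k \<noteq> 0" by blast
    have "ktensor p (top k) \<in> Q_Phi \<phi>"
      unfolding Q_Phi_eq[OF \<phi>]
    proof (intro subsetD[OF closed_span_superset] CollectI exI conjI allI)
      show "top k i < zord (\<phi> i k) (p i)" for i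
        using Y1[OF k(1), of i] by (simp add: top_def l_def)
    qed (rule refl p)+
    with QW have "(\<Sum>m\<in>Y. c m * cinner (ktensor p (top k)) (g m)) = 0" by (auto simp: W_def cG)
    moreover have "cinner (ktensor p (top k)) (g m) = 0" if "m \<in> Y" "m \<noteq> k" for m
      using pair[OF that(1) k(1)] that(2) by (subst cinner_commute) simp
    ultimately have "c k * cinner (ktensor p (top k)) (g k) = 0"
      using finY k(1) by (subst (asm) sum.remove[of _ k]) auto
    with k(2) have "cinner (ktensor p (top k)) (g k) = 0" by simp
    then have "cinner (g k) (ktensor p (top k)) = 0" by (subst cinner_commute) simp
    then show False using pair[OF k(1) k(1)] by simp
  qed
qed

theorem theorem5p2:
  fixes A :: "'n::finite set"
    and \<phi> :: "'n \<Rightarrow> int \<Rightarrow> complex \<Rightarrow> complex"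
  assumes "CARD('n) \<ge> 2"
    and "A \<noteq> {}" and "A \<noteq> UNIV"
    and "\<forall>i k. blaschke_product (\<phi> i k)"
    and "\<forall>i. no_common_inner_factor (\<phi> i)"
    and "\<forall>i\<in>A. increasing_seq (\<phi> i)"
    and "\<forall>i\<in>UNIV - A. decreasing_seq (\<phi> i)"
  shows "co_rank (Q_Phi \<phi>) = (SUP \<xi>\<in>Lambda \<phi>. ecard (Z_tilde \<phi> \<xi>))"
proof (rule antisym)
  have \<phi>: "blaschke_product (\<phi> i k)" for i k using assms(4) by blast
  have inc: "increasing_seq (\<phi> i)" if "i \<in> A" for i using assms(6) that by blast
  have dec: "decreasing_seq (\<phi> i)" if "i \<notin> A" for i using assms(7) that by blast
  show "co_rank (Q_Phi \<phi>) \<le> (SUP \<xi>\<in>Lambda \<phi>. ecard (Z_tilde \<phi> \<xi>))"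
  proof (cases "SUP \<xi>\<in>Lambda \<phi>. ecard (Z_tilde \<phi> \<xi>)")
    case (enat r)
    have "ecard (Z_tilde \<phi> \<xi>) \<le> enat r" if "\<xi> \<in> Lambda \<phi>" for \<xi>
      unfolding enat[symmetric] using that by (rule SUP_upper)
    from co_rank_le[OF \<phi> this] show ?thesis by (simp add: enat)
  qed simp
  show "(SUP \<xi>\<in>Lambda \<phi>. ecard (Z_tilde \<phi> \<xi>)) \<le> co_rank (Q_Phi \<phi>)"
  proof (rule SUP_least)
    fix \<xi> assume "\<xi> \<in> Lambda \<phi>"
    then obtain p k0 where \<xi>: "\<xi> = parts_at \<phi> p k0" and p: "\<And>i. norm (p i) < 1"
      and k0: "\<And>i. zord (\<phi> i k0) (p i) \<ge> 1"
      unfolding Lambda_eq[OF \<phi>] by blast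
    have Zset: "Z_set \<phi> \<xi> = zero_indices \<phi> p"
      unfolding \<xi> by (rule Z_set_parts_at) (use p k0 \<phi> in auto)
    have loc: "Q_local \<phi> \<xi> Y = closed_span (local_kernels \<phi> p Y)" for Y
      unfolding \<xi> by (rule Q_local_parts_at) (use p k0 \<phi> in auto)
    have fin: "finite (zero_indices \<phi> p)"
    proof -
      from assms(2,3) obtain i j where i: "i \<in> A" and j: "j \<notin> A" by blast
      have "\<exists>k. zord (\<phi> i k) (p i) = 0" for i
        using assms(5) by (intro ex_zord_eq_0 \<phi> p) auto
      then obtain a b where a: "zord (\<phi> i a) (p i) = 0" and b: "zord (\<phi> j b) (p j) = 0" by metis
      have "zero_indices \<phi> p \<subseteq> {a..b}"
      proof
        fix k assume "k \<in> zero_indices \<phi> p"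
        then have k: "zord (\<phi> i k) (p i) \<ge> 1" "zord (\<phi> j k) (p j) \<ge> 1" by (auto simp: zero_indices_def)
        have "\<not> k \<le> a"
          using inner_dvd_ord_le[OF \<phi> \<phi> increasing_seq_dvd[OF inc[OF i]] p[of i], of k a] a k(1) by auto
        moreover have "\<not> b \<le> k"
          using inner_dvd_ord_le[OF \<phi> \<phi> decreasing_seq_dvd[OF dec[OF j]] p[of j], of b k] b k(2) by auto
        ultimately show "k \<in> {a..b}" by simp
      qed
      then show ?thesis by (rule finite_subset) simp
    qed
    define Y where "Y = maximal_indices (\<lambda>i k. zord (\<phi> i k) (p i))"
    have YZ: "Y \<subseteq> Z_set \<phi> \<xi>" by (auto simp: Y_def maximal_indices_def Zset zero_indices_def)
    have dom: "\<exists>k'\<in>Y. \<forall>i. zord (\<phi> i k) (p i) \<le> zord (\<phi> i k') (p i)" if "\<forall>i. zord (\<phi> i k) (p i) \<ge> 1" for k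
      unfolding Y_def using ex_maximal_index[OF fin[unfolded zero_indices_def] that] .
    have "{j. \<exists>k\<in>Y. \<forall>i. j i < zord (\<phi> i k) (p i)} = {j. \<exists>k\<in>Z_set \<phi> \<xi>. \<forall>i. j i < zord (\<phi> i k) (p i)}"
    proof (intro equalityI subsetI CollectI)
      fix j assume "j \<in> {j. \<exists>k\<in>Z_set \<phi> \<xi>. \<forall>i. j i < zord (\<phi> i k) (p i)}"
      then obtain k where k: "\<forall>i. zord (\<phi> i k) (p i) \<ge> 1" "\<forall>i. j i < zord (\<phi> i k) (p i)"
        by (auto simp: Zset zero_indices_def)
      from dom[OF k(1)] k(2) show "\<exists>k\<in>Y. \<forall>i. j i < zord (\<phi> i k) (p i)" by (meson less_le_trans)
    qed (use YZ in blast)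
    then have "Q_local \<phi> \<xi> Y = Q_local \<phi> \<xi> (Z_set \<phi> \<xi>)"
      unfolding loc local_kernels_def by (intro arg_cong[of _ _ closed_span]) blast
    with YZ have Zt: "ecard (Z_tilde \<phi> \<xi>) \<le> ecard Y" by (rule Z_tilde_props(3))
    have finY: "finite Y" using finite_subset[OF YZ] fin by (simp add: Zset)
    show "ecard (Z_tilde \<phi> \<xi>) \<le> co_rank (Q_Phi \<phi>)"
      unfolding co_rank_def adjoint_Mz rank_on_def
    proof (rule Inf_greatest, clarify)
      fix S assume S: "generated backward_shift S = Q_Phi \<phi>"
      show "ecard (Z_tilde \<phi> \<xi>) \<le> ecard S"
      proof (cases "finite S")
        case True
        have "card Y \<le> card S"
          by (rule card_le_generators[OF \<phi> inc dec p fin Y_def True S])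
        with Zt finY True show ?thesis by (simp add: ecard_def order_trans)
      qed (simp add: ecard_def)
    qed
  qed
qed

end
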